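(* Let $d\ge 2$, let $x\in\mathbb R^d$, and suppose that $g:\mathbb R^d\to\mathbb R\cup\{-\infty\}$ is upper semicontinuous with $g(x)\in\mathbb R$ and $$g(y)<g(x)+C_1(1+|y-x|)\quad\text{for all } y\in\mathbb R^d.$$ Then there is a constant $C>0$, depending only on $C_1$, $K$, $\alpha$, $\beta$ and $|b-a|$ (and on $d$, and for $d=2$ on $\nu$), such that $$\operatorname{var}(u(t,x,\omega))\le C\,\frac{t}{\log t}\qquad\text{for all } t\ge 2.$$
   Context: Fix $d\ge2$ and real numbers $a<b$. Let $\Omega=\{a,b\}^{\mathbb Z^d}$ with the product probability measure $\mathbb P$ under which the coordinates $\omega_k$, $k\in\mathbb Z^d$, are i.i.d. with $\mathbb P(\omega_k=a)=\alpha\in(0,1)$ and $\mathbb P(\omega_k=b)=\beta=1-\alpha$. For $k\in\mathbb Z^d$ let $Q_k=k+[0,1)^d$ and define $V(x,\omega)=\sum_k\omega_k\mathbb I_{Q_k}(x)$ (so $V(x,\omega)=\omega_k$ for $x\in Q_k$). Let $K:\mathbb R^d\to[0,\infty)$ be convex with $K(0)=0$ and $K(z)/|z|\to\infty$ as $|z|\to\infty$; if $d=2$ assume moreover that for some $\nu>1$, $K(z)\ge|z|^\nu$ for all $z$ with $|z|<1/2$. For $t>0$ and $x\in\mathbb R^d$, let $\mathcal A_{t,x}=\{\gamma\in W^{1,\infty}([0,t];\mathbb R^d):\gamma(0)=x\}$, $\mathcal L(\gamma,\omega)=\int_0^t K(\gamma'(s))+V(\gamma(s),\omega)\,ds$,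 and $$u(t,x,\omega)=\sup_{\gamma\in\mathcal A_{t,x}}\big(g(\gamma(t))-\mathcal L(\gamma,\omega)\big).$$ The variance is taken with respect to $\mathbb P$. *)

theory Defs
  imports "HOL-Analysis.Analysis" "HOL-Probability.Probability"
begin

definition usc :: "('a::topological_space \<Rightarrow> ereal) \<Rightarrow> bool" where
  "usc g \<longleftrightarrow> (\<forall>y c. g y < c \<longrightarrow> eventually (\<lambda>z. g z < c) (nhds y))"

text \<open>Random environment: omega :: int^d => real; V(x,omega) = omega_k for x in Q_k = k + [0,1)^d.\<close>
definition V_pot :: "real^'n \<Rightarrow> (int^'n \<Rightarrow> real) \<Rightarrow> real" where
  "V_pot x \<omega> = \<omega> (\<chi> i. \<lfloor>x $ i\<rfloor>)"

text \<open>Admissible paths: W^{1,infinity}([0,t]; R^d) = Lipschitz paths on [0,t], starting at x.\<close>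
definition adm_paths :: "real \<Rightarrow> real^'n \<Rightarrow> (real \<Rightarrow> real^'n) set" where
  "adm_paths t x = {\<gamma>. (\<exists>L. L-lipschitz_on {0..t} \<gamma>) \<and> \<gamma> 0 = x}"

definition action :: "(real^'n \<Rightarrow> real) \<Rightarrow> real \<Rightarrow> (real \<Rightarrow> real^'n) \<Rightarrow> (int^'n \<Rightarrow> real) \<Rightarrow> real" where
  "action K t \<gamma> \<omega> =
     integral {0..t} (\<lambda>s. K (vector_derivative \<gamma> (at s within {0..t})) + V_pot (\<gamma> s) \<omega>)"

definition u_val :: "(real^'n \<Rightarrow> real) \<Rightarrow> (real^'n \<Rightarrow> ereal) \<Rightarrow> real \<Rightarrow> real^'n
                     \<Rightarrow> (int^'n \<Rightarrow> real) \<Rightarrow> ereal" where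
  "u_val K g t x \<omega> = (SUP \<gamma>\<in>adm_paths t x. g (\<gamma> t) - ereal (action K t \<gamma> \<omega>))"

definition site_law :: "real \<Rightarrow> real \<Rightarrow> real \<Rightarrow> real measure" where
  "site_law a b \<alpha> = measure_pmf (map_pmf (\<lambda>c. if c then a else b) (bernoulli_pmf \<alpha>))"

definition env_measure :: "real \<Rightarrow> real \<Rightarrow> real \<Rightarrow> (int^'n \<Rightarrow> real) measure" where
  "env_measure a b \<alpha> = PiM UNIV (\<lambda>_. site_law a b \<alpha>)"

definition var :: "'a measure \<Rightarrow> ('a \<Rightarrow> real) \<Rightarrow> real" where
  "var M X = integral\<^sup>L M (\<lambda>\<omega>. (X \<omega> - integral\<^sup>L M X)^2)"

end

theory Submission
  imports Defs
begin

text \<open>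
  An environment is encoded by the set \<open>S\<close> of sites carrying the value \<open>b\<close>, and the action is normalised
  to \<open>a = 0\<close>, \<open>b = \<delta>\<close>.  Since resting at an \<open>a\<close>-site is free, a path whose visit to a cube has become
  expensive can cross it in unit time and spend the rest of that time at an \<open>a\<close>-site near \<open>x\<close>.  Hence
  raising one site changes the value \<open>U\<close> by at most the time spent there, and also by at most
  \<open>C (1 + R)\<close>, where \<open>R\<close> is the distance to nearby \<open>a\<close>-sites, whose mean is bounded.  The first bound sums
  to \<open>O(t)\<close> over all sites, so the squared influences also sum to \<open>O(t)\<close> in mean.

  The logarithm is gained as in the work of Benjamini, Kalai and Schramm: \<open>U\<close> is replaced by its average
  \<open>F\<close> over translations of the environment by vectors in a box of side \<open>m = t powr ((1 - \<kappa>) / 2)\<close>.  This costs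
  \<open>O(m)\<close>, and the \<open>L\<^sup>1\<close> influences of \<open>F\<close> become \<open>O(t powr (- \<kappa>))\<close>: for \<open>d \<ge> 3\<close> because \<open>t\<close> is much
  smaller than \<open>m ^ d\<close>, and for \<open>d = 2\<close> because the lower bound on \<open>K\<close> prevents a nearly optimal path from
  visiting too many cubes of one box.  The entropy argument of Falik and Samorodnitsky, based on a
  logarithmic Sobolev inequality, turns this into \<open>Var F = O(t / ln t)\<close>.
\<close>

section \<open>An entropy bound for the variance on the biased cube\<close>

text \<open>The entropy inequality bounds ln Q times the variance by the energy plus Q times the sum
  of the squared L1 influences, and that sum is at most the largest L1 influence times their total.
  For \<open>U\<close> itself no smallness of the largest influence is available: sites near
  \<open>x\<close> can matter however large \<open>t\<close> is. Averaging spreads each influence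
  over a box; it keeps the bounds O(t) on total influence and energy and lowers only the maximum, to
  the sum over one box divided by m ^ d. With Q = t powr \<kappa> the last term is then O(t) while
  ln Q = \<kappa> * ln t. The error O(m) enters the variance squared, which restricts m to a power
  of t below 1/2; hence m ^ 2 < t, and in dimension 2 the bound O(t) for the sum over one box is
  useless. There a flat \<open>K\<close> would let a path drift through many cubes at almost no
  cost, which the lower bound on \<open>K\<close> excludes. The constant has to be uniform in
  \<open>x\<close> and \<open>g\<close>, so \<open>g\<close> is replaced by g - g x on the set where
  it is finite, and all constants are fixed before a point or a payoff is chosen.\<close>

definition dif :: "'k \<Rightarrow> ('k set \<Rightarrow> real) \<Rightarrow> 'k set \<Rightarrow> real" where
  "dif k f S = f (insert k S) - f (S - {k})"

locale biased =
  fixes \<alpha> :: real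
  assumes \<alpha>_pos: "0 < \<alpha>" and \<alpha>_lt1: "\<alpha> < 1"
begin

text \<open>Expectation of \<open>f\<close> at a random subset of \<open>L\<close> that contains
  each site independently with probability 1 - \<alpha>. As a finite sum it raises no questions of
  measurability or integrability.\<close>

definition Avg :: "'k set \<Rightarrow> ('k set \<Rightarrow> real) \<Rightarrow> real" where
  "Avg L f = (\<Sum>S\<in>Pow L. \<alpha> ^ card (L - S) * (1 - \<alpha>) ^ card S * f S)"

lemma Avg_empty [simp]: "Avg {} f = f {}"
  by (simp add: Avg_def)

text \<open>Integrating out one site; the inductions over \<open>L\<close> below rest on it.\<close>

lemma Avg_insert:
  assumes "finite L" "k \<notin> L"
  shows "Avg (insert k L) f = Avg L (\<lambda>S. \<alpha> * f S + (1 - \<alpha>) * f (insert k S))"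
proof -
  let ?w = "\<lambda>L S. \<alpha> ^ card (L - S) * (1 - \<alpha>) ^ card S"
  have inj: "inj_on (insert k) (Pow L)"
    using assms(2) by (auto simp: inj_on_def)
  have "Avg (insert k L) f = (\<Sum>S\<in>Pow L. ?w (insert k L) S * f S)
      + (\<Sum>S\<in>insert k ` Pow L. ?w (insert k L) S * f S)"
    unfolding Avg_def Pow_insert using assms by (intro sum.union_disjoint) auto
  also have "(\<Sum>S\<in>insert k ` Pow L. ?w (insert k L) S * f S)
      = (\<Sum>S\<in>Pow L. ?w (insert k L) (insert k S) * f (insert k S))"
    by (simp add: sum.reindex[OF inj] o_def)
  also have "\<dots> = (\<Sum>S\<in>Pow L. ?w L S * ((1 - \<alpha>) * f (insert k S)))"
  proof (intro sum.cong refl)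
    fix S assume S: "S \<in> Pow L"
    then have "finite S" "k \<notin> S" using assms finite_subset by auto
    moreover have "insert k L - insert k S = L - S" using assms S by auto
    ultimately show "?w (insert k L) (insert k S) * f (insert k S) = ?w L S * ((1 - \<alpha>) * f (insert k S))"
      by simp
  qed
  also have "(\<Sum>S\<in>Pow L. ?w (insert k L) S * f S) = (\<Sum>S\<in>Pow L. ?w L S * (\<alpha> * f S))"
  proof (intro sum.cong refl)
    fix S assume S: "S \<in> Pow L"
    then have "insert k L - S = insert k (L - S)" "k \<notin> L - S" "finite (L - S)" using assms by auto
    then show "?w (insert k L) S * f S = ?w L S * (\<alpha> * f S)" by simp
  qed
  finally show ?thesis
    unfolding Avg_def distrib_left sum.distrib .
qed

lemma Avg_cong: "(\<And>S. S \<subseteq> L \<Longrightarrow> f S = g S) \<Longrightarrow> Avg L f = Avg L g"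
  unfolding Avg_def by (intro sum.cong) auto

lemma Avg_mono: "(\<And>S. S \<subseteq> L \<Longrightarrow> f S \<le> g S) \<Longrightarrow> Avg L f \<le> Avg L g"
  unfolding Avg_def using \<alpha>_pos \<alpha>_lt1 by (intro sum_mono mult_left_mono) auto

lemma Avg_add: "Avg L (\<lambda>S. f S + g S) = Avg L f + Avg L g"
  by (simp add: Avg_def algebra_simps sum.distrib)

lemma Avg_diff: "Avg L (\<lambda>S. f S - g S) = Avg L f - Avg L g"
  by (simp add: Avg_def algebra_simps sum_subtractf)

lemma Avg_cmult: "Avg L (\<lambda>S. c * f S) = c * Avg L f"
  by (simp add: Avg_def sum_distrib_left algebra_simps)

lemma Avg_sum: "Avg L (\<lambda>S. \<Sum>i\<in>I. f i S) = (\<Sum>i\<in>I. Avg L (f i))"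
  unfolding Avg_def by (subst sum.swap) (simp add: sum_distrib_left)

lemma Avg_const [simp]: "finite L \<Longrightarrow> Avg L (\<lambda>S. c) = c"
  by (induction L rule: finite_induct) (simp_all add: Avg_insert algebra_simps)

lemma Avg_nonneg: "(\<And>S. S \<subseteq> L \<Longrightarrow> 0 \<le> f S) \<Longrightarrow> 0 \<le> Avg L f"
  unfolding Avg_def using \<alpha>_pos \<alpha>_lt1 by (intro sum_nonneg mult_nonneg_nonneg) auto

section \<open>Entropy and the logarithmic Sobolev inequality\<close>

definition Ent :: "'k set \<Rightarrow> ('k set \<Rightarrow> real) \<Rightarrow> real" where
  "Ent L X = Avg L (\<lambda>S. X S * ln (X S)) - Avg L X * ln (Avg L X)"

text \<open>The entropy of a nonnegative variable is at most its variance divided by its mean;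
  on two points this already gives a logarithmic Sobolev inequality.\<close>

lemma two_point_log_Sobolev:
  fixes x y :: real
  defines "m \<equiv> \<alpha> * x\<^sup>2 + (1 - \<alpha>) * y\<^sup>2"
  shows "\<alpha> * (x\<^sup>2 * ln (x\<^sup>2)) + (1 - \<alpha>) * (y\<^sup>2 * ln (y\<^sup>2)) - m * ln m \<le> 2 * (y - x)\<^sup>2"
proof (cases "m = 0")
  case True
  then have "x = 0 \<and> y = 0"
    unfolding m_def using \<alpha>_pos \<alpha>_lt1 by (simp add: add_nonneg_eq_0_iff)
  then show ?thesis by (simp add: m_def)
next
  case False
  have m: "m > 0"
    using False \<alpha>_pos \<alpha>_lt1 unfolding m_def by (simp add: less_le)
  have ptw: "X * ln X \<le> X * ln m + X * (X / m - 1)" if "X \<ge> 0" for X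
  proof (cases "X = 0")
    case False
    with that have "X > 0" by simp
    then have "ln (X / m) \<le> X / m - 1" using m by (intro ln_le_minus_one) auto
    then have "X * ln (X / m) \<le> X * (X / m - 1)" using \<open>X > 0\<close> by (intro mult_left_mono) auto
    then show ?thesis using \<open>X > 0\<close> m by (simp add: ln_div algebra_simps)
  qed simp
  let ?a = \<alpha> and ?b = "1 - \<alpha>"
  have "?a * (x\<^sup>2 * ln (x\<^sup>2)) + ?b * (y\<^sup>2 * ln (y\<^sup>2)) - m * ln m
     \<le> ?a * (x\<^sup>2 * ln m + x\<^sup>2 * (x\<^sup>2 / m - 1)) + ?b * (y\<^sup>2 * ln m + y\<^sup>2 * (y\<^sup>2 / m - 1)) - m * ln m"
    using \<alpha>_pos \<alpha>_lt1 ptw[of "x\<^sup>2"] ptw[of "y\<^sup>2"]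
    by (intro diff_right_mono add_mono mult_left_mono) auto
  also have "\<dots> = (?a * (x\<^sup>2)\<^sup>2 + ?b * (y\<^sup>2)\<^sup>2) / m - m"
  proof -
    have "m * ln m = ?a * (x\<^sup>2 * ln m) + ?b * (y\<^sup>2 * ln m)"
      by (simp add: m_def algebra_simps)
    moreover have "m = ?a * x\<^sup>2 + ?b * y\<^sup>2" by (simp add: m_def)
    moreover have "(?a * (x\<^sup>2)\<^sup>2 + ?b * (y\<^sup>2)\<^sup>2) / m = ?a * (x\<^sup>2 * (x\<^sup>2 / m)) + ?b * (y\<^sup>2 * (y\<^sup>2 / m))"
      by (simp add: power2_eq_square add_divide_distrib)
    moreover have "?a * (x\<^sup>2 * ln m + x\<^sup>2 * (x\<^sup>2 / m - 1)) + ?b * (y\<^sup>2 * ln m + y\<^sup>2 * (y\<^sup>2 / m - 1))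
      = (?a * (x\<^sup>2 * ln m) + ?b * (y\<^sup>2 * ln m))
        + (?a * (x\<^sup>2 * (x\<^sup>2 / m)) + ?b * (y\<^sup>2 * (y\<^sup>2 / m))) - (?a * x\<^sup>2 + ?b * y\<^sup>2)"
      by (simp only: right_diff_distrib distrib_left mult_1_right)
    ultimately show ?thesis by linarith
  qed
  also have "\<dots> = (?a * (x\<^sup>2)\<^sup>2 + ?b * (y\<^sup>2)\<^sup>2 - m\<^sup>2) / m"
    using m by (simp add: field_simps power2_eq_square)
  also have "?a * (x\<^sup>2)\<^sup>2 + ?b * (y\<^sup>2)\<^sup>2 - m\<^sup>2 = ?a * ?b * (x\<^sup>2 - y\<^sup>2)\<^sup>2"
    unfolding m_def by algebra
  also have "(x\<^sup>2 - y\<^sup>2)\<^sup>2 = (x + y)\<^sup>2 * (y - x)\<^sup>2" by algebra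
  also have "?a * ?b * ((x + y)\<^sup>2 * (y - x)\<^sup>2) / m \<le> 2 * (y - x)\<^sup>2"
  proof -
    have "?a * ?b * (x + y)\<^sup>2 \<le> 2 * m"
    proof -
      have "(x + y)\<^sup>2 \<le> 2 * x\<^sup>2 + 2 * y\<^sup>2"
        using sum_squares_ge_zero[of "x - y" 0] by (simp add: power2_eq_square algebra_simps)
      then have "?a * ?b * (x + y)\<^sup>2 \<le> ?a * ?b * (2 * x\<^sup>2 + 2 * y\<^sup>2)"
        using \<alpha>_pos \<alpha>_lt1 by (intro mult_left_mono) auto
      also have "\<dots> = 2 * (?a * x\<^sup>2 * ?b + ?b * y\<^sup>2 * ?a)" by (simp add: algebra_simps)
      also have "\<dots> \<le> 2 * (?a * x\<^sup>2 * 1 + ?b * y\<^sup>2 * 1)"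
        using \<alpha>_pos \<alpha>_lt1 by (intro mult_left_mono add_mono) auto
      finally show ?thesis by (simp add: m_def)
    qed
    then have "?a * ?b * (x + y)\<^sup>2 * (y - x)\<^sup>2 \<le> 2 * m * (y - x)\<^sup>2"
      by (intro mult_right_mono) auto
    then show ?thesis using m by (simp add: field_simps)
  qed
  finally show ?thesis .
qed

text \<open>The reverse triangle inequality for the norm on the plane with weights \<alpha> and 1 -
  \<alpha>. It shows that passing to the conditional L2 norm given the other sites does not increase
  energy.\<close>

lemma sqrt_mean_diff_square_le:
  fixes x y x' y' :: real
  shows "(sqrt (\<alpha> * x\<^sup>2 + (1 - \<alpha>) * y\<^sup>2) - sqrt (\<alpha> * x'\<^sup>2 + (1 - \<alpha>) * y'\<^sup>2))\<^sup>2
     \<le> \<alpha> * (x - x')\<^sup>2 + (1 - \<alpha>) * (y - y')\<^sup>2"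
proof -
  define P where "P = \<alpha> * x\<^sup>2 + (1 - \<alpha>) * y\<^sup>2"
  define P' where "P' = \<alpha> * x'\<^sup>2 + (1 - \<alpha>) * y'\<^sup>2"
  have nn: "P \<ge> 0" "P' \<ge> 0" unfolding P_def P'_def using \<alpha>_pos \<alpha>_lt1 by auto
  have "P * P' - (\<alpha> * x * x' + (1 - \<alpha>) * y * y')\<^sup>2 = \<alpha> * (1 - \<alpha>) * (x * y' - x' * y)\<^sup>2"
    unfolding P_def P'_def by algebra
  also have "\<dots> \<ge> 0" using \<alpha>_pos \<alpha>_lt1 by auto
  finally have "\<alpha> * x * x' + (1 - \<alpha>) * y * y' \<le> sqrt (P * P')"
    by (intro real_le_rsqrt) auto
  then have 1: "\<alpha> * x * x' + (1 - \<alpha>) * y * y' \<le> sqrt P * sqrt P'"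
    by (simp add: real_sqrt_mult)
  have 2: "(sqrt P - sqrt P')\<^sup>2 = P + P' - 2 * (sqrt P * sqrt P')"
    using nn by (simp add: power2_diff)
  have 3: "\<alpha> * (x - x')\<^sup>2 + (1 - \<alpha>) * (y - y')\<^sup>2 = P + P' - 2 * (\<alpha> * x * x' + (1 - \<alpha>) * y * y')"
    unfolding P_def P'_def by algebra
  show ?thesis unfolding P_def[symmetric] P'_def[symmetric] 2 3
    using 1 by (intro diff_left_mono mult_left_mono) auto
qed

lemma Avg_dif_same:
  assumes "finite L" "k \<notin> L"
  shows "Avg (insert k L) (\<lambda>S. \<phi> (dif k f S)) = Avg L (\<lambda>S. \<phi> (f (insert k S) - f S))"
  unfolding Avg_insert[OF assms]
proof (intro Avg_cong)
  fix S assume "S \<subseteq> L"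
  then have "k \<notin> S" using assms by auto
  then show "\<alpha> * \<phi> (dif k f S) + (1 - \<alpha>) * \<phi> (dif k f (insert k S)) = \<phi> (f (insert k S) - f S)"
    by (simp add: dif_def algebra_simps)
qed

text \<open>Tensorisation by the chain rule for entropy: with \<open>h\<close> the conditional L2
  norm of \<open>f\<close> given the sites other than \<open>k\<close>, the entropy splits into that
  of the square of \<open>h\<close> and the mean of two-point entropies. The induction hypothesis
  applies to \<open>h\<close>, whose energy in the remaining directions is at most that of
  \<open>f\<close>.\<close>

lemma log_Sobolev:
  assumes "finite L"
  shows "Ent L (\<lambda>S. (f S)\<^sup>2) \<le> 2 * (\<Sum>k\<in>L. Avg L (\<lambda>S. (dif k f S)\<^sup>2))"
  using assms
proof (induction L arbitrary: f rule: finite_induct)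
  case empty
  then show ?case by (simp add: Ent_def)
next
  case (insert k L)
  define h where "h S = sqrt (\<alpha> * (f S)\<^sup>2 + (1 - \<alpha>) * (f (insert k S))\<^sup>2)" for S
  have h2: "(h S)\<^sup>2 = \<alpha> * (f S)\<^sup>2 + (1 - \<alpha>) * (f (insert k S))\<^sup>2" for S
    unfolding h_def using \<alpha>_pos \<alpha>_lt1 by auto
  have "Ent (insert k L) (\<lambda>S. (f S)\<^sup>2) - Ent L (\<lambda>S. (h S)\<^sup>2)
     = Avg L (\<lambda>S. \<alpha> * ((f S)\<^sup>2 * ln ((f S)\<^sup>2)) + (1 - \<alpha>) * ((f (insert k S))\<^sup>2 * ln ((f (insert k S))\<^sup>2))
               - (h S)\<^sup>2 * ln ((h S)\<^sup>2))"
    unfolding Ent_def Avg_insert[OF insert.hyps] h2 by (simp add: Avg_diff)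
  also have "\<dots> \<le> Avg L (\<lambda>S. 2 * (f (insert k S) - f S)\<^sup>2)"
    by (intro Avg_mono) (use two_point_log_Sobolev h2 in simp)
  also have "\<dots> = 2 * Avg (insert k L) (\<lambda>S. (dif k f S)\<^sup>2)"
    by (simp add: Avg_cmult Avg_dif_same[OF insert.hyps, of "\<lambda>x. x\<^sup>2"])
  finally have 1: "Ent (insert k L) (\<lambda>S. (f S)\<^sup>2)
      \<le> Ent L (\<lambda>S. (h S)\<^sup>2) + 2 * Avg (insert k L) (\<lambda>S. (dif k f S)\<^sup>2)" by simp
  have 2: "Avg L (\<lambda>S. (dif j h S)\<^sup>2) \<le> Avg (insert k L) (\<lambda>S. (dif j f S)\<^sup>2)" if "j \<in> L" for j
    unfolding Avg_insert[OF insert.hyps]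
  proof (intro Avg_mono)
    fix S assume S: "S \<subseteq> L"
    have jk: "j \<noteq> k" "k \<notin> S" using that insert.hyps S by auto
    have [simp]: "insert k S - {j} = insert k (S - {j})" "insert j (insert k S) = insert k (insert j S)"
      using jk by auto
    show "(dif j h S)\<^sup>2 \<le> \<alpha> * (dif j f S)\<^sup>2 + (1 - \<alpha>) * (dif j f (insert k S))\<^sup>2"
      using sqrt_mean_diff_square_le unfolding dif_def h_def by simp
  qed
  have "Ent L (\<lambda>S. (h S)\<^sup>2) \<le> 2 * (\<Sum>j\<in>L. Avg (insert k L) (\<lambda>S. (dif j f S)\<^sup>2))"
    using insert.IH[of h] sum_mono[OF 2] by fastforce
  then show ?case using 1 insert.hyps by simp
qed

text \<open>A function whose L1 norm is small compared with its L2 norm has large entropy. This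
  comes from ln u \<le> u - 1 at u = c / |h S|, whose error is linear in |h S| and therefore
  controlled by the L1 norm.\<close>

lemma second_moment_le_Ent:
  assumes "finite L" "Q > 0"
  shows "ln Q * Avg L (\<lambda>S. (h S)\<^sup>2) \<le> Ent L (\<lambda>S. (h S)\<^sup>2) + Q * (Avg L (\<lambda>S. \<bar>h S\<bar>))\<^sup>2"
proof -
  define N where "N = Avg L (\<lambda>S. (h S)\<^sup>2)"
  define p where "p = Avg L (\<lambda>S. \<bar>h S\<bar>)"
  have N0: "N \<ge> 0" unfolding N_def by (intro Avg_nonneg) auto
  show ?thesis
  proof (cases "N = 0")
    case True
    have "h S = 0" if "S \<subseteq> L" for S
    proof -
      have "\<alpha> ^ card (L - S) * (1 - \<alpha>) ^ card S * (h S)\<^sup>2 = 0"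
        using True that \<alpha>_pos \<alpha>_lt1 assms(1) unfolding N_def Avg_def
        by (subst (asm) sum_nonneg_eq_0_iff) auto
      then show ?thesis using \<alpha>_pos \<alpha>_lt1 by simp
    qed
    then have "Avg L (\<lambda>S. (h S)\<^sup>2 * ln ((h S)\<^sup>2)) = Avg L (\<lambda>S. 0)" by (intro Avg_cong) auto
    then have "Ent L (\<lambda>S. (h S)\<^sup>2) = 0"
      using True assms(1) by (simp add: Ent_def N_def)
    then show ?thesis using True assms(2) by (simp add: N_def)
  next
    case False
    with N0 have N: "N > 0" by simp
    \<comment> \<open>With c^2 = N * Q the leading term N * ln (c^2) exceeds N * ln N by exactly N *
      ln Q; the spare 2 * N helps to pay for the mixed term 2 * c * p.\<close>
    define c where "c = sqrt (N * Q)"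
    have c: "c > 0" "c\<^sup>2 = N * Q" by (simp_all add: c_def N assms(2) less_imp_le)
    have "Avg L (\<lambda>S. (h S)\<^sup>2 * ln (c\<^sup>2) + (2 * (h S)\<^sup>2 - (2 * c) * \<bar>h S\<bar>)) \<le> Avg L (\<lambda>S. (h S)\<^sup>2 * ln ((h S)\<^sup>2))"
    proof (intro Avg_mono)
      fix S assume "S \<subseteq> L"
      show "(h S)\<^sup>2 * ln (c\<^sup>2) + (2 * (h S)\<^sup>2 - (2 * c) * \<bar>h S\<bar>) \<le> (h S)\<^sup>2 * ln ((h S)\<^sup>2)"
      proof (cases "h S = 0")
        case False
        define x where "x = \<bar>h S\<bar>"
        have x: "x > 0" "(h S)\<^sup>2 = x\<^sup>2" using False by (auto simp: x_def)
        have "ln (c / x) \<le> c / x - 1" using c x by (intro ln_le_minus_one) auto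
        then have "ln c - ln x \<le> c / x - 1" using c x by (simp add: ln_div)
        then have "2 * x\<^sup>2 * (ln c - ln x) \<le> 2 * x\<^sup>2 * (c / x - 1)" by (intro mult_left_mono) auto
        also have "\<dots> = 2 * c * x - 2 * x\<^sup>2" using x by (simp add: power2_eq_square field_simps)
        finally have "x\<^sup>2 * (2 * ln c) + (2 * x\<^sup>2 - (2 * c) * x) \<le> x\<^sup>2 * (2 * ln x)"
          by (simp add: algebra_simps)
        moreover have "ln (c\<^sup>2) = 2 * ln c" "ln (x\<^sup>2) = 2 * ln x"
          using c(1) x(1) by (simp_all add: ln_realpow)
        ultimately show ?thesis unfolding x(2) x_def[symmetric] by simp
      qed simp
    qed
    moreover have "Avg L (\<lambda>S. (h S)\<^sup>2 * ln (c\<^sup>2) + (2 * (h S)\<^sup>2 - (2 * c) * \<bar>h S\<bar>)) = N * ln (c\<^sup>2) + (2 * N - 2 * c * p)"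
      by (simp only: Avg_add Avg_diff Avg_cmult N_def p_def mult.commute[of _ "ln (c\<^sup>2)"])
    ultimately have "Ent L (\<lambda>S. (h S)\<^sup>2) \<ge> N * ln (N * Q) + (2 * N - 2 * c * p) - N * ln N"
      unfolding Ent_def N_def[symmetric] c(2) by linarith
    moreover have "N * ln (N * Q) = N * ln N + N * ln Q" using N assms by (simp add: ln_mult algebra_simps)
    moreover have "2 * c * p \<le> N + Q * p\<^sup>2"
    proof -
      have "0 \<le> (sqrt N - sqrt Q * p)\<^sup>2" by simp
      also have "\<dots> = N + Q * p\<^sup>2 - 2 * (sqrt N * sqrt Q) * p"
        using N assms by (simp add: power2_diff power_mult_distrib)
      finally show ?thesis by (simp add: c_def real_sqrt_mult)
    qed
    ultimately show ?thesis unfolding N_def[symmetric] p_def[symmetric]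
      using N by (simp add: algebra_simps)
  qed
qed

text \<open>Induction by martingale differences: f = g + e with \<open>g\<close> the conditional
  mean given all sites but \<open>k\<close>. The variance splits; \<open>e\<close> is treated by
  \<open>second_moment_le_Ent\<close> and \<open>log_Sobolev\<close>, and \<open>g\<close> by
  induction. No factor is lost, since in every other direction the energies of \<open>e\<close> and
  \<open>g\<close> add up to that of \<open>f\<close>, and averaging over \<open>k\<close> does not
  increase L1 influences.\<close>

lemma Falik_Samorodnitsky:
  assumes "finite L" "Q > 0"
  shows "ln Q * (Avg L (\<lambda>S. (f S)\<^sup>2) - (Avg L f)\<^sup>2)
     \<le> 2 * (\<Sum>k\<in>L. Avg L (\<lambda>S. (dif k f S)\<^sup>2)) + Q * (\<Sum>k\<in>L. (Avg L (\<lambda>S. \<bar>dif k f S\<bar>))\<^sup>2)"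
  using assms(1)
proof (induction L arbitrary: f rule: finite_induct)
  case empty
  then show ?case by simp
next
  case (insert k L)
  note ins = Avg_insert[OF insert.hyps]
  define g where "g S = \<alpha> * f S + (1 - \<alpha>) * f (insert k S)" for S
  \<comment> \<open>\<open>g\<close> is the conditional mean only at sets without \<open>k\<close>;
    the argument S - {k} makes it independent of that site.\<close>
  define e where "e S = f S - g (S - {k})" for S
  have fin: "finite (insert k L)" using insert.hyps by simp
  have e1: "e S = (1 - \<alpha>) * (f S - f (insert k S))" "e (insert k S) = \<alpha> * (f (insert k S) - f S)"
    if "S \<subseteq> L" for S
  proof -
    have "k \<notin> S" using that insert.hyps by auto
    then show "e S = (1 - \<alpha>) * (f S - f (insert k S))" "e (insert k S) = \<alpha> * (f (insert k S) - f S)"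
      by (simp_all add: e_def g_def algebra_simps)
  qed
  have "Avg (insert k L) (\<lambda>S. (f S)\<^sup>2) = Avg L (\<lambda>S. (g S)\<^sup>2) + Avg (insert k L) (\<lambda>S. (e S)\<^sup>2)"
    unfolding ins Avg_add[symmetric]
  proof (intro Avg_cong)
    fix S assume "S \<subseteq> L"
    show "\<alpha> * (f S)\<^sup>2 + (1 - \<alpha>) * (f (insert k S))\<^sup>2
        = (g S)\<^sup>2 + (\<alpha> * (e S)\<^sup>2 + (1 - \<alpha>) * (e (insert k S))\<^sup>2)"
      unfolding e1[OF \<open>S \<subseteq> L\<close>] g_def by algebra
  qed
  moreover have "Avg (insert k L) f = Avg L g" unfolding ins g_def by simp
  ultimately have var: "Avg (insert k L) (\<lambda>S. (f S)\<^sup>2) - (Avg (insert k L) f)\<^sup>2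
     = (Avg L (\<lambda>S. (g S)\<^sup>2) - (Avg L g)\<^sup>2) + Avg (insert k L) (\<lambda>S. (e S)\<^sup>2)" by simp
  have ek: "Avg (insert k L) (\<lambda>S. (dif k e S)\<^sup>2) = Avg (insert k L) (\<lambda>S. (dif k f S)\<^sup>2)"
    by (intro Avg_cong) (simp add: dif_def e_def)
  have comm: "insert k S - {j} = insert k (S - {j})" "insert j (insert k S) = insert k (insert j S)"
     "S - {k} = S" "S - {j} - {k} = S - {j}" "insert k S - {k} = S" "insert j S - {k} = insert j S"
     "insert k (insert j S) - {k} = insert j S" "insert k (S - {j}) - {k} = S - {j}"
    if "j \<in> L" "S \<subseteq> L" for j S using that insert.hyps by auto
  \<comment> \<open>For fixed \<open>S\<close>, the two values of \<open>dif j f\<close> have mean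
    \<open>dif j g\<close> and deviations \<open>dif j e\<close>, and a second moment is the
    variance plus the squared mean.\<close>
  have ej: "Avg (insert k L) (\<lambda>S. (dif j e S)\<^sup>2) + Avg L (\<lambda>S. (dif j g S)\<^sup>2)
      = Avg (insert k L) (\<lambda>S. (dif j f S)\<^sup>2)" if "j \<in> L" for j
    unfolding ins Avg_add[symmetric]
  proof (intro Avg_cong)
    fix S assume S: "S \<subseteq> L"
    show "\<alpha> * (dif j e S)\<^sup>2 + (1 - \<alpha>) * (dif j e (insert k S))\<^sup>2 + (dif j g S)\<^sup>2
       = \<alpha> * (dif j f S)\<^sup>2 + (1 - \<alpha>) * (dif j f (insert k S))\<^sup>2"
      unfolding dif_def e_def comm[OF that S] g_def by algebra
  qed
  have gj: "Avg L (\<lambda>S. \<bar>dif j g S\<bar>) \<le> Avg (insert k L) (\<lambda>S. \<bar>dif j f S\<bar>)" if "j \<in> L" for j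
    unfolding ins
  proof (intro Avg_mono)
    fix S assume S: "S \<subseteq> L"
    have "dif j g S = \<alpha> * dif j f S + (1 - \<alpha>) * dif j f (insert k S)"
      unfolding dif_def comm[OF that S] g_def by algebra
    then show "\<bar>dif j g S\<bar> \<le> \<alpha> * \<bar>dif j f S\<bar> + (1 - \<alpha>) * \<bar>dif j f (insert k S)\<bar>"
      using \<alpha>_pos \<alpha>_lt1 abs_triangle_ineq[of "\<alpha> * dif j f S" "(1 - \<alpha>) * dif j f (insert k S)"]
      by (simp add: abs_mult)
  qed
  have "Avg (insert k L) (\<lambda>S. \<bar>e S\<bar>) \<le> Avg (insert k L) (\<lambda>S. \<bar>dif k f S\<bar>)"
    unfolding ins
  proof (intro Avg_mono)
    fix S assume S: "S \<subseteq> L"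
    then have "k \<notin> S" using insert.hyps by auto
    then have d: "dif k f S = f (insert k S) - f S" "dif k f (insert k S) = f (insert k S) - f S"
      by (auto simp: dif_def)
    have "\<bar>e S\<bar> \<le> 1 * \<bar>dif k f S\<bar>" "\<bar>e (insert k S)\<bar> \<le> 1 * \<bar>dif k f (insert k S)\<bar>"
      unfolding e1[OF S] d abs_mult abs_minus_commute[of "f S"]
      using \<alpha>_pos \<alpha>_lt1 by (auto intro!: mult_left_le_one_le)
    then show "\<alpha> * \<bar>e S\<bar> + (1 - \<alpha>) * \<bar>e (insert k S)\<bar>
       \<le> \<alpha> * \<bar>dif k f S\<bar> + (1 - \<alpha>) * \<bar>dif k f (insert k S)\<bar>"
      using \<alpha>_pos \<alpha>_lt1 by (intro add_mono mult_left_mono) auto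
  qed
  then have e_l1: "Q * (Avg (insert k L) (\<lambda>S. \<bar>e S\<bar>))\<^sup>2 \<le> Q * (Avg (insert k L) (\<lambda>S. \<bar>dif k f S\<bar>))\<^sup>2"
    using assms(2) by (intro mult_left_mono power_mono Avg_nonneg) auto
  have e_bd: "ln Q * Avg (insert k L) (\<lambda>S. (e S)\<^sup>2)
     \<le> 2 * (\<Sum>j\<in>insert k L. Avg (insert k L) (\<lambda>S. (dif j e S)\<^sup>2))
        + Q * (Avg (insert k L) (\<lambda>S. \<bar>dif k f S\<bar>))\<^sup>2"
    using second_moment_le_Ent[OF fin assms(2), of e] log_Sobolev[OF fin, of e] e_l1 by linarith
  have gL1: "(\<Sum>j\<in>L. (Avg L (\<lambda>S. \<bar>dif j g S\<bar>))\<^sup>2) \<le> (\<Sum>j\<in>L. (Avg (insert k L) (\<lambda>S. \<bar>dif j f S\<bar>))\<^sup>2)"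
    by (intro sum_mono power_mono gj Avg_nonneg) auto
  have g_bd: "ln Q * (Avg L (\<lambda>S. (g S)\<^sup>2) - (Avg L g)\<^sup>2)
    \<le> 2 * (\<Sum>j\<in>L. Avg L (\<lambda>S. (dif j g S)\<^sup>2)) + Q * (\<Sum>j\<in>L. (Avg (insert k L) (\<lambda>S. \<bar>dif j f S\<bar>))\<^sup>2)"
    using insert.IH[of g] mult_left_mono[OF gL1, of Q] assms(2) by linarith
  have sumL: "(\<Sum>j\<in>L. Avg (insert k L) (\<lambda>S. (dif j e S)\<^sup>2)) + (\<Sum>j\<in>L. Avg L (\<lambda>S. (dif j g S)\<^sup>2))
     = (\<Sum>j\<in>L. Avg (insert k L) (\<lambda>S. (dif j f S)\<^sup>2))"
    unfolding sum.distrib[symmetric] by (intro sum.cong refl ej)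
  show ?case
    unfolding var sum.insert[OF insert.hyps] sumL[symmetric]
    using e_bd g_bd unfolding sum.insert[OF insert.hyps] ek by (simp add: algebra_simps)
qed

end

section \<open>Lipschitz paths\<close>

text \<open>If \<open>f\<close> is Lipschitz then \<open>F = f + (L + 1) id\<close> is bi-Lipschitz, so the image of Lebesgue measure
  under \<open>F\<inverse>\<close> has a density, and the Lebesgue differentiation theorem applies to that density.\<close>

lemma lipschitz_real_ae_derivative:
  fixes f :: "real \<Rightarrow> real"
  assumes lip: "L-lipschitz_on UNIV f"
  obtains N h where "negligible N"
    "\<And>a b. a \<le> b \<Longrightarrow> (h has_integral (f b - f a)) {a..b}"
    "\<And>s. s \<notin> N \<Longrightarrow> (f has_real_derivative h s) (at s)"
proof -
  have L0: "L \<ge> 0" by (rule lipschitz_on_nonneg[OF lip])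
  have fl: "\<bar>f b - f a\<bar> \<le> L * \<bar>b - a\<bar>" for a b
    using lipschitz_onD[OF lip, of b a] by (simp add: dist_real_def)
  define F where "F x = f x + (L + 1) * x" for x
  have lo: "b - a \<le> F b - F a" if "a \<le> b" for a b
    using fl[of b a] that by (auto simp: F_def algebra_simps abs_if split: if_splits)
  have hi: "\<bar>F b - F a\<bar> \<le> (2 * L + 1) * \<bar>b - a\<bar>" for a b
  proof -
    have "\<bar>F b - F a\<bar> \<le> \<bar>f b - f a\<bar> + \<bar>(L + 1) * (b - a)\<bar>"
      unfolding F_def by (rule order_trans[OF _ abs_triangle_ineq]) (simp add: algebra_simps)
    moreover have "\<bar>(L + 1) * (b - a)\<bar> = L * \<bar>b - a\<bar> + \<bar>b - a\<bar>"
      unfolding abs_mult using L0 by (simp add: algebra_simps)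
    ultimately show ?thesis using fl[of b a] by (simp add: algebra_simps)
  qed
  have mono: "F a < F b \<longleftrightarrow> a < b" for a b
    using lo[of a b] lo[of b a] by (cases "a < b") auto
  have "isCont f x" for x
    using lipschitz_on_continuous_on[OF lip] continuous_on_eq_continuous_at by blast
  then have contF: "isCont F x" for x unfolding F_def by (intro continuous_intros) auto
  have surjF: "\<exists>x. F x = y" for y
  proof -
    define r where "r = \<bar>y - F 0\<bar>"
    have "F (- r) \<le> y" "y \<le> F r" using lo[of "-r" 0] lo[of 0 r] by (auto simp: r_def abs_if)
    then show ?thesis using IVT[of F "-r" y r] contF by (auto simp: r_def)
  qed
  have injF: "inj F"
    by (rule injI) (metis mono less_irrefl linorder_neqE_linordered_idom)
  define G where "G = inv F"
  have FG: "F (G y) = y" and GF: "G (F x) = x" for x y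
    unfolding G_def using surjF[of y] injF by (auto simp: f_inv_into_f inv_f_f intro: f_inv_into_f)
  have Gmono: "mono G"
    by (rule monoI) (metis FG mono not_le)
  have Gmeas: "G \<in> borel_measurable borel" by (rule borel_measurable_mono[OF Gmono])
  \<comment> \<open>The Stieltjes measure of \<open>F\<close>; its density is the derivative that is
    sought.\<close>
  define \<mu> where "\<mu> = distr lborel borel G"
  have em: "emeasure \<mu> {a<..b} = ennreal (F b - F a)" if "a \<le> b" for a b
  proof -
    have "G -` {a<..b} = {F a<..F b}"
      using FG mono by (auto simp: ) (metis FG mono not_le)+
    then show ?thesis unfolding \<mu>_def using Gmeas lo[OF that] that
      by (subst emeasure_distr) auto
  qed
  \<comment> \<open>The preimage of a null set under \<open>G\<close> is its image under the
    Lipschitz map \<open>F\<close>, hence null.\<close>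
  have ac: "absolutely_continuous lborel \<mu>"
    unfolding absolutely_continuous_def
  proof
    fix A :: "real set" assume A: "A \<in> null_sets lborel"
    then have Ab: "A \<in> sets borel" by auto
    have "negligible A" using A by (simp add: negligible_iff_null_sets null_sets_completionI)
    moreover have "\<exists>T B. open T \<and> x \<in> T \<and> (\<forall>y\<in>A \<inter> T. norm (F y - F x) \<le> B * norm (y - x))" for x
      using hi by (intro exI[of _ UNIV] exI[of _ "2 * L + 1"]) auto
    ultimately have "negligible (F ` A)"
      by (intro negligible_locally_Lipschitz_image) auto
    moreover have "F ` A = G -` A" by (auto simp: GF) (metis FG image_eqI)
    ultimately have "G -` A \<in> null_sets lebesgue" by (simp add: negligible_iff_null_sets)
    moreover have "G -` A \<in> sets borel" using measurable_sets[OF Gmeas Ab] by simp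
    ultimately have "emeasure lborel (G -` A) = 0"
      by (subst (asm) null_sets_completion_iff) auto
    then show "A \<in> null_sets \<mu>" unfolding \<mu>_def using Ab Gmeas
      by (intro null_setsI) (auto simp: emeasure_distr)
  qed
  have "\<exists>h\<in>borel_measurable lborel. density lborel h = \<mu>"
    by (intro sigma_finite_measure.Radon_Nikodym ac) (auto simp: \<mu>_def sigma_finite_lborel)
  then obtain h' where h': "h' \<in> borel_measurable borel" "density lborel h' = \<mu>" by auto
  have nn: "(\<integral>\<^sup>+x. h' x * indicator {a<..b} x \<partial>lborel) = ennreal (F b - F a)" if "a \<le> b" for a b
    using em[OF that] h' by (subst emeasure_density[symmetric]) auto
  have "AE x in lborel. x \<in> {- real n<..real n} \<longrightarrow> h' x \<noteq> \<infinity>" for n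
  proof -
    have "AE x in lborel. h' x * indicator {- real n<..real n} x \<noteq> \<infinity>"
      using nn[of "- real n" "real n"] h'(1) by (intro nn_integral_PInf_AE) auto
    then show ?thesis by eventually_elim (auto simp: indicator_def)
  qed
  then have "AE x in lborel. \<forall>n. x \<in> {- real n<..real n} \<longrightarrow> h' x \<noteq> \<infinity>"
    unfolding AE_all_countable by blast
  then have hfin: "AE x in lborel. h' x \<noteq> \<infinity>"
  proof eventually_elim
    case (elim x)
    obtain n :: nat where "\<bar>x\<bar> < real n" using reals_Archimedean2 by blast
    then show ?case using elim[rule_format, of n] by (auto simp: abs_less_iff)
  qed
  define h where "h x = enn2real (h' x)" for x
  have hm: "h \<in> borel_measurable borel" unfolding h_def using h'(1) by measurable
  have h0: "h x \<ge> 0" for x by (simp add: h_def)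
  have hI: "(h has_integral (F b - F a)) {a..b}" if "a \<le> b" for a b
  proof -
    have "(\<integral>\<^sup>+x. ennreal (indicator {a<..b} x * h x) \<partial>lborel) = (\<integral>\<^sup>+x. h' x * indicator {a<..b} x \<partial>lborel)"
      by (intro nn_integral_cong_AE, use hfin in eventually_elim)
         (auto simp: h_def indicator_def less_top)
    then have "has_bochner_integral lborel (\<lambda>x. indicator {a<..b} x * h x) (F b - F a)"
      using nn[OF that] lo[OF that] that hm h0 by (intro has_bochner_integral_nn_integral) auto
    then have "((\<lambda>x. indicator {a<..b} x * h x) has_integral (F b - F a)) UNIV"
      using has_integral_integral_lborel[of "\<lambda>x. indicator {a<..b} x * h x"]
      by (simp add: has_bochner_integral_iff)
    moreover have "((\<lambda>x. indicator {a<..b} x * h x) has_integral (F b - F a)) UNIV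
       \<longleftrightarrow> ((\<lambda>x. if x \<in> {a..b} then h x else 0) has_integral (F b - F a)) UNIV"
      by (intro has_integral_spike_eq[of "{a}"]) (auto simp: indicator_def)
    ultimately show ?thesis by (simp only: has_integral_restrict_UNIV)
  qed
  have hint: "h integrable_on cbox a b" for a b
    by (cases "a \<le> b") (use hI in \<open>auto simp: cbox_interval\<close>)
  \<comment> \<open>The differentiation theorem in use concerns intervals to the right of a point;
    the reflected density supplies the difference quotients from the left.\<close>
  have hint': "(\<lambda>x. h (- x)) integrable_on cbox a b" for a b
    using hint[of "-b" "-a"] Henstock_Kurzweil_Integration.integrable_reflect_real[where f = h and a = "-b" and b = "-a"] by (simp add: cbox_interval)
  obtain N1 where N1: "negligible N1" "\<And>x e. \<lbrakk>x \<notin> N1; 0 < e\<rbrakk> \<Longrightarrow> \<exists>d>0. \<forall>k. 0 < k \<and> k < d \<longrightarrow>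
       norm (integral (cbox x (x + k *\<^sub>R One)) h /\<^sub>R k ^ DIM(real) - h x) < e"
    using integrable_ccontinuous_explicit[OF hint] by blast
  obtain N2 where N2: "negligible N2" "\<And>x e. \<lbrakk>x \<notin> N2; 0 < e\<rbrakk> \<Longrightarrow> \<exists>d>0. \<forall>k. 0 < k \<and> k < d \<longrightarrow>
       norm (integral (cbox x (x + k *\<^sub>R One)) (\<lambda>x. h (- x)) /\<^sub>R k ^ DIM(real) - h (- x)) < e"
    using integrable_ccontinuous_explicit[OF hint'] by blast
  define N where "N = N1 \<union> uminus ` N2"
  have "\<exists>T B. open T \<and> x \<in> T \<and> (\<forall>y\<in>N2 \<inter> T. norm (- y - - x) \<le> B * norm (y - x))" for x :: real
    by (rule exI[of _ UNIV], rule exI[of _ 1]) auto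
  then have negN: "negligible N"
    unfolding N_def using N1(1) N2(1)
    by (intro negligible_Un negligible_locally_Lipschitz_image) auto
  have derF: "(F has_real_derivative h s) (at s)" if "s \<notin> N" for s
    unfolding DERIV_def
  proof (rule LIM_I)
    fix e :: real assume "e > 0"
    have "s \<notin> N1" using that by (simp add: N_def)
    then obtain d1 where d1: "d1 > 0" "\<And>k. 0 < k \<Longrightarrow> k < d1 \<Longrightarrow>
       norm (integral (cbox s (s + k *\<^sub>R One)) h /\<^sub>R k ^ DIM(real) - h s) < e"
      using N1(2)[OF _ \<open>e > 0\<close>] by metis
    have "- s \<notin> N2" using that by (auto simp: N_def image_iff)
    then obtain d2 where d2: "d2 > 0" "\<And>k. 0 < k \<Longrightarrow> k < d2 \<Longrightarrow>
       norm (integral (cbox (-s) (-s + k *\<^sub>R One)) (\<lambda>x. h (- x)) /\<^sub>R k ^ DIM(real) - h (- (- s))) < e"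
      using N2(2)[OF _ \<open>e > 0\<close>] by metis
    show "\<exists>d>0. \<forall>k. k \<noteq> 0 \<and> norm (k - 0) < d \<longrightarrow> norm ((F (s + k) - F s) / k - h s) < e"
    proof (intro exI conjI allI impI)
      show "0 < min d1 d2" using d1 d2 by simp
      fix k :: real assume k: "k \<noteq> 0 \<and> norm (k - 0) < min d1 d2"
      show "norm ((F (s + k) - F s) / k - h s) < e"
      proof (cases "k > 0")
        case True
        then have "integral {s..s + k} h = F (s + k) - F s" using hI[of s "s + k"] by (simp add: integral_unique)
        then show ?thesis using d1(2)[of k] True k by (simp add: cbox_interval divide_inverse mult.commute)
      next
        case False
        then have k0: "k < 0" using k by simp
        then have "integral {s + k..s} h = F s - F (s + k)" using hI[of "s + k" s] by (simp add: integral_unique)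
        moreover have "integral {-s..-(s + k)} (\<lambda>x. h (- x)) = integral {s + k..s} h"
          by (rule Henstock_Kurzweil_Integration.integral_reflect_real)
        moreover have "norm (integral {-s..-(s + k)} (\<lambda>x. h (- x)) * inverse (- k) - h s) < e"
          using d2(2)[of "-k"] k0 k by (simp add: cbox_interval mult.commute)
        moreover have "(F s - F (s + k)) * inverse (- k) = (F (s + k) - F s) / k"
          using k0 by (simp add: field_simps)
        ultimately show ?thesis by simp
      qed
    qed
  qed
  show ?thesis
  proof (rule that[of N "\<lambda>s. h s - (L + 1)"])
    show "negligible N" by (rule negN)
    show "((\<lambda>s. h s - (L + 1)) has_integral (f b - f a)) {a..b}" if "a \<le> b" for a b
    proof -
      have "((\<lambda>s. h s - (L + 1)) has_integral ((F b - F a) - (b - a) *\<^sub>R (L + 1))) {a..b}"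
        by (intro has_integral_diff hI that) (use has_integral_const_real[of "L + 1" a b] that in simp)
      then show ?thesis by (simp add: F_def algebra_simps)
    qed
    show "(f has_real_derivative h s - (L + 1)) (at s)" if "s \<notin> N" for s
    proof -
      have "((\<lambda>x. F x - (L + 1) * x) has_real_derivative h s - (L + 1)) (at s)"
        using derF[OF that] by (auto intro!: derivative_eq_intros)
      then show ?thesis by (simp add: F_def)
    qed
  qed
qed

text \<open>The real case applied to each coordinate. Derivatives are claimed at interior points
  only, as nothing is known about \<gamma> outside the interval.\<close>

lemma lipschitz_path_ae_derivative:
  fixes \<gamma> :: "real \<Rightarrow> 'a::euclidean_space"
  assumes lip: "L-lipschitz_on {a..b} \<gamma>" and ab: "a \<le> b"
  obtains N h where "negligible N"
    "\<And>c d. a \<le> c \<Longrightarrow> c \<le> d \<Longrightarrow> d \<le> b \<Longrightarrow> (h has_integral (\<gamma> d - \<gamma> c)) {c..d}"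
    "\<And>s. s \<notin> N \<Longrightarrow> a < s \<Longrightarrow> s < b \<Longrightarrow> (\<gamma> has_vector_derivative h s) (at s)"
    "\<And>s. s \<notin> N \<Longrightarrow> a < s \<Longrightarrow> s < b \<Longrightarrow> norm (h s) \<le> L"
proof -
  \<comment> \<open>Constant continuation beyond the endpoints, because the real case is stated for
    functions on the whole line.\<close>
  define \<eta> where "\<eta> s = \<gamma> (max a (min b s))" for s
  have L0: "L \<ge> 0" by (rule lipschitz_on_nonneg[OF lip])
  have \<eta>lip: "L-lipschitz_on UNIV \<eta>"
  proof (rule lipschitz_onI[OF _ L0])
    fix s r
    have "dist (\<eta> s) (\<eta> r) \<le> L * dist (max a (min b s)) (max a (min b r))"
      unfolding \<eta>_def by (rule lipschitz_onD[OF lip]) (use ab in auto)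
    also have "\<dots> \<le> L * dist s r"
      by (intro mult_left_mono L0) (auto simp: dist_real_def)
    finally show "dist (\<eta> s) (\<eta> r) \<le> L * dist s r" .
  qed
  have "L-lipschitz_on UNIV (\<lambda>s. \<eta> s \<bullet> i)" if "i \<in> Basis" for i
  proof (rule lipschitz_onI[OF _ L0])
    fix s r
    have "dist (\<eta> s \<bullet> i) (\<eta> r \<bullet> i) = \<bar>(\<eta> s - \<eta> r) \<bullet> i\<bar>" by (simp add: dist_real_def inner_diff_left)
    also have "\<dots> \<le> dist (\<eta> s) (\<eta> r)" using Basis_le_norm[OF that] by (simp add: dist_norm)
    also have "\<dots> \<le> L * dist s r" using lipschitz_onD[OF \<eta>lip] by simp
    finally show "dist (\<eta> s \<bullet> i) (\<eta> r \<bullet> i) \<le> L * dist s r" .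
  qed
  then have "\<forall>i\<in>Basis. \<exists>N h. negligible N \<and> (\<forall>c d. c \<le> d \<longrightarrow> (h has_integral (\<eta> d \<bullet> i - \<eta> c \<bullet> i)) {c..d})
     \<and> (\<forall>s. s \<notin> N \<longrightarrow> ((\<lambda>s. \<eta> s \<bullet> i) has_real_derivative h s) (at s))"
    by (metis lipschitz_real_ae_derivative)
  then obtain N h where Nh: "\<And>i. i \<in> Basis \<Longrightarrow> negligible (N i)"
     "\<And>i c d. i \<in> Basis \<Longrightarrow> c \<le> d \<Longrightarrow> (h i has_integral (\<eta> d \<bullet> i - \<eta> c \<bullet> i)) {c..d}"
     "\<And>i s. i \<in> Basis \<Longrightarrow> s \<notin> N i \<Longrightarrow> ((\<lambda>s. \<eta> s \<bullet> i) has_real_derivative h i s) (at s)"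
    by metis
  define H where "H s = (\<Sum>i\<in>Basis. h i s *\<^sub>R i)" for s
  have der: "(\<gamma> has_vector_derivative H s) (at s)" if s: "s \<notin> (\<Union>i\<in>Basis. N i)" "a < s" "s < b" for s
  proof -
    have "((\<lambda>s. \<Sum>i\<in>Basis. (\<eta> s \<bullet> i) *\<^sub>R i) has_vector_derivative H s) (at s)"
      unfolding H_def
    proof (rule has_vector_derivative_sum)
      fix i :: 'a assume i: "i \<in> Basis"
      have "((\<lambda>s. \<eta> s \<bullet> i) has_real_derivative h i s) (at s)" using Nh(3)[OF i] s i by auto
      then show "((\<lambda>s. (\<eta> s \<bullet> i) *\<^sub>R i) has_vector_derivative h i s *\<^sub>R i) (at s)"
        by (auto intro!: derivative_eq_intros)
    qed
    then have "(\<eta> has_vector_derivative H s) (at s)" by (simp add: euclidean_representation)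
    then show ?thesis
      by (rule has_vector_derivative_transform_within_open[of _ _ _ "{a<..<b}"])
         (use s in \<open>auto simp: \<eta>_def\<close>)
  qed
  show ?thesis
  proof (rule that[of "\<Union>i\<in>Basis. N i" H])
    show "negligible (\<Union>i\<in>Basis. N i)" using Nh(1) by (intro negligible_Union) auto
    show "(\<gamma> has_vector_derivative H s) (at s)" if "s \<notin> (\<Union>i\<in>Basis. N i)" "a < s" "s < b" for s
      by (rule der[OF that])
    show "(H has_integral (\<gamma> d - \<gamma> c)) {c..d}" if "a \<le> c" "c \<le> d" "d \<le> b" for c d
    proof -
      have "(H has_integral (\<Sum>i\<in>Basis. (\<eta> d \<bullet> i - \<eta> c \<bullet> i) *\<^sub>R i)) {c..d}"
        unfolding H_def by (intro has_integral_sum has_integral_scaleR_left Nh(2) that) auto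
      moreover have "(\<Sum>i\<in>Basis. (\<eta> d \<bullet> i - \<eta> c \<bullet> i) *\<^sub>R i) = \<eta> d - \<eta> c"
        by (simp add: inner_diff_left[symmetric] euclidean_representation)
      ultimately show ?thesis using that by (simp add: \<eta>_def)
    qed
    show "norm (H s) \<le> L" if s: "s \<notin> (\<Union>i\<in>Basis. N i)" "a < s" "s < b" for s
    proof -
      let ?r = "\<lambda>k. norm (\<gamma> (s + k) - \<gamma> s - k *\<^sub>R H s) / \<bar>k\<bar>"
      have "(?r \<longlongrightarrow> 0) (at 0)"
        using der[OF s] by (simp add: has_vector_derivative_def has_derivative_at)
      then have lim: "((\<lambda>k. L + ?r k) \<longlongrightarrow> L + 0) (at 0)" by (intro tendsto_intros)
      have "eventually (\<lambda>k. norm (H s) \<le> L + ?r k) (at 0)"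
      proof -
        have "norm (H s) \<le> L + ?r k" if k: "k \<noteq> 0" "\<bar>k\<bar> < min (s - a) (b - s)" for k
        proof -
          have "\<bar>k\<bar> * norm (H s) = norm ((\<gamma> (s + k) - \<gamma> s) - (\<gamma> (s + k) - \<gamma> s - k *\<^sub>R H s))" by simp
          also have "\<dots> \<le> norm (\<gamma> (s + k) - \<gamma> s) + norm (\<gamma> (s + k) - \<gamma> s - k *\<^sub>R H s)"
            by (rule norm_triangle_ineq4)
          also have "norm (\<gamma> (s + k) - \<gamma> s) \<le> L * \<bar>k\<bar>"
            using lipschitz_onD[OF lip, of "s + k" s] k s by (simp add: dist_norm abs_less_iff)
          finally show ?thesis using k by (simp add: field_simps)
        qed
        then show ?thesis
          unfolding eventually_at using s by (intro exI[of _ "min (s - a) (b - s)"]) auto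
      qed
      then show ?thesis
        using tendsto_lowerbound[OF lim] by simp
    qed
  qed
qed

section \<open>Action of a path\<close>

definition cube_of :: "real^'n \<Rightarrow> int^'n" where
  "cube_of v = (\<chi> i. \<lfloor>v $ i\<rfloor>)"

definition rvec :: "int^'n \<Rightarrow> real^'n" where
  "rvec z = (\<chi> i. real_of_int (z $ i))"

text \<open>Occupation time of the cubes in \<open>S\<close>. With the potential normalised to the
  values 0 and \<delta>, the potential energy is \<delta> times this.\<close>

definition tim :: "(int^'n) set \<Rightarrow> (real \<Rightarrow> real^'n) \<Rightarrow> real \<Rightarrow> real \<Rightarrow> real" where
  "tim S \<gamma> s r = integral {s..r} (\<lambda>u. indicator S (cube_of (\<gamma> u)))"

definition shift :: "int^'n \<Rightarrow> (int^'n) set \<Rightarrow> (int^'n) set" where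
  "shift z S = {k. k + z \<in> S}"

lemma cube_of_measurable: "cube_of \<in> measurable borel (count_space UNIV)"
  unfolding measurable_count_space_eq2_countable
proof (intro conjI ballI)
  fix k :: "int^'n"
  have "cube_of -` {k} \<inter> space borel = (\<Inter>i. {v :: real^'n. real_of_int (k $ i) \<le> v $ i} \<inter> {v. v $ i < real_of_int (k $ i) + 1})"
    by (auto simp: cube_of_def vec_eq_iff floor_eq_iff)
  also have "\<dots> \<in> sets borel"
    by (intro sets.finite_INT sets.Int borel_closed borel_open closed_Collect_le open_Collect_less continuous_intros) auto
  finally show "cube_of -` {k} \<inter> space borel \<in> sets borel" .
qed auto

lemma cube_of_comp_measurable:
  fixes \<gamma> :: "real \<Rightarrow> real^'n" and f :: "int^'n \<Rightarrow> real"
  assumes "continuous_on {a..b} \<gamma>"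
  shows "(\<lambda>u. f (cube_of (\<gamma> u))) \<in> borel_measurable (lebesgue_on {a..b})"
proof -
  have "\<gamma> \<in> borel_measurable (lebesgue_on {a..b})"
    by (rule continuous_imp_measurable_on_sets_lebesgue[OF assms]) auto
  then have "(\<lambda>u. cube_of (\<gamma> u)) \<in> measurable (lebesgue_on {a..b}) (count_space UNIV)"
    by (rule measurable_compose[OF _ cube_of_measurable])
  then show ?thesis by (rule measurable_compose) simp
qed

lemma tim_integrable:
  fixes \<gamma> :: "real \<Rightarrow> real^'n"
  assumes "continuous_on {a..b} \<gamma>" "a \<le> c" "d \<le> b"
  shows "(\<lambda>u. indicator S (cube_of (\<gamma> u)) :: real) integrable_on {c..d}"
proof (rule measurable_bounded_by_integrable_imp_integrable[where g = "\<lambda>_. 1"])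
  show "(\<lambda>u. indicator S (cube_of (\<gamma> u)) :: real) \<in> borel_measurable (lebesgue_on {c..d})"
    using cube_of_comp_measurable[of c d \<gamma> "indicator S"] assms continuous_on_subset[of "{a..b}" \<gamma> "{c..d}"] by auto
qed (auto simp: indicator_def)

lemma tim_nonneg: "0 \<le> tim S \<gamma> c d"
  unfolding tim_def
  by (cases "(\<lambda>u. indicator S (cube_of (\<gamma> u)) :: real) integrable_on {c..d}")
     (auto intro!: Henstock_Kurzweil_Integration.integral_nonneg simp: not_integrable_integral)

lemma tim_le:
  assumes "continuous_on {a..b} \<gamma>" "a \<le> c" "c \<le> d" "d \<le> b"
  shows "tim S \<gamma> c d \<le> d - c"
proof -
  have "tim S \<gamma> c d \<le> integral {c..d} (\<lambda>_. 1)"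
    unfolding tim_def using assms
    by (intro Henstock_Kurzweil_Integration.integral_le tim_integrable) (auto simp: indicator_def)
  then show ?thesis using assms by simp
qed

lemma tim_combine:
  assumes "continuous_on {a..b} \<gamma>" "a \<le> c" "c \<le> d" "d \<le> e" "e \<le> b"
  shows "tim S \<gamma> c e = tim S \<gamma> c d + tim S \<gamma> d e"
  unfolding tim_def using assms tim_integrable[of a b \<gamma> c e S]
  by (intro Henstock_Kurzweil_Integration.integral_combine[symmetric]) auto

lemma tim_cong:
  assumes "\<And>u. c < u \<Longrightarrow> u < d \<Longrightarrow> cube_of (\<gamma> u) \<in> S \<longleftrightarrow> cube_of (\<eta> u) \<in> S'"
  shows "tim S \<gamma> c d = tim S' \<eta> c d"
  unfolding tim_def
  by (rule integral_spike[of "{c, d}"]) (use assms in \<open>auto simp: indicator_def\<close>)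

lemma tim_shift: "tim S (\<lambda>s. \<gamma> (s + e)) c d = tim S \<gamma> (c + e) (d + e)"
  unfolding tim_def using integral_shift_real_ivl[of "c + e" e "d + e" "\<lambda>u. indicator S (cube_of (\<gamma> u)) :: real"] by simp

lemma tim_insert:
  assumes "continuous_on {a..b} \<gamma>" "a \<le> c" "d \<le> b" "k \<notin> S"
  shows "tim (insert k S) \<gamma> c d = tim S \<gamma> c d + tim {k} \<gamma> c d"
proof -
  have "(\<lambda>u. indicator (insert k S) (cube_of (\<gamma> u)) :: real)
      = (\<lambda>u. indicator S (cube_of (\<gamma> u)) + indicator {k} (cube_of (\<gamma> u)))"
    using assms(4) by (auto simp: indicator_def fun_eq_iff)
  then show ?thesis
    unfolding tim_def using tim_integrable[OF assms(1-3)]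
    by (simp add: Henstock_Kurzweil_Integration.integral_add)
qed

lemma tim_sum:
  assumes "continuous_on {a..b} \<gamma>" "a \<le> c" "d \<le> b" "finite B"
  shows "(\<Sum>k\<in>B. tim {k} \<gamma> c d) = tim B \<gamma> c d"
  using assms(4)
proof (induction B rule: finite_induct)
  case empty
  then show ?case by (simp add: tim_def)
next
  case (insert k B)
  then show ?case using tim_insert[OF assms(1-3), of k B] by simp
qed

lemma tim_mono:
  assumes "continuous_on {a..b} \<gamma>" "a \<le> c" "d \<le> b" "S \<subseteq> S'"
  shows "tim S \<gamma> c d \<le> tim S' \<gamma> c d"
  unfolding tim_def using assms
  by (intro Henstock_Kurzweil_Integration.integral_le tim_integrable) (auto simp: indicator_def)

lemma has_vector_derivative_shift:
  "((\<lambda>s. \<gamma> (s + e)) has_vector_derivative D) (at u) \<longleftrightarrow> (\<gamma> has_vector_derivative D) (at (u + e))"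
  by (simp add: has_vector_derivative_def has_derivative_at add_ac)

lemma has_vector_derivative_translate:
  "((\<lambda>s. \<gamma> s + z) has_vector_derivative D) (at u) \<longleftrightarrow> (\<gamma> has_vector_derivative D) (at u)"
  by (simp add: has_vector_derivative_def has_derivative_at)

section \<open>Kinetic energy and the cost of joining two points\<close>

locale lagrangian =
  fixes K :: "real^'n \<Rightarrow> real" and \<delta> :: real
  assumes K_convex: "convex_on UNIV K"
    and K_nonneg: "K z \<ge> 0"
    and K_zero: "K 0 = 0"
    and K_superlin: "filterlim (\<lambda>z. K z / norm z) at_top at_infinity"
    and \<delta>_pos: "\<delta> > 0"
begin

text \<open>The derivative is two-sided, unlike the one in \<open>action\<close>: the integrand then
  does not depend on the interval, so pieces of a path can be cut and joined. The two differ at most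
  at the endpoints, a null set.\<close>

definition kin :: "(real \<Rightarrow> real^'n) \<Rightarrow> real \<Rightarrow> real \<Rightarrow> real" where
  "kin \<gamma> s r = integral {s..r} (\<lambda>u. K (vector_derivative \<gamma> (at u)))"

lemma K_cont: "continuous_on UNIV K"
  by (rule convex_on_continuous[OF _ K_convex]) simp

lemma K_bounded: "\<exists>M\<ge>0. \<forall>z. norm z \<le> v \<longrightarrow> K z \<le> M"
proof -
  have "compact (K ` cball 0 v)"
    by (intro compact_continuous_image continuous_on_subset[OF K_cont]) auto
  then obtain M where "\<forall>x\<in>K ` cball 0 v. norm x \<le> M"
    using compact_imp_bounded bounded_iff by metis
  then have "K z \<le> max 0 M" if "norm z \<le> v" for z
    using that abs_le_D1[of "K z" M] by (auto intro: max.coboundedI2)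
  then show ?thesis by (intro exI[of _ "max 0 M"]) auto
qed

text \<open>Chosen once from \<open>K\<close> and the speed bound, so that constants built from it
  depend on nothing else.\<close>

definition KM :: "real \<Rightarrow> real" where
  "KM v = (SOME M. M \<ge> 0 \<and> (\<forall>z. norm z \<le> v \<longrightarrow> K z \<le> M))"

lemma KM_nonneg: "KM v \<ge> 0" and KM: "norm z \<le> v \<Longrightarrow> K z \<le> KM v"
  using someI_ex[OF K_bounded[of v]] unfolding KM_def by auto

lemma K_superlinear: "\<exists>c\<ge>0. \<forall>z. M * norm z \<le> K z + c"
proof -
  have "eventually (\<lambda>z. M \<le> K z / norm z) at_infinity"
    using K_superlin by (simp add: filterlim_at_top)
  then obtain r where r: "\<And>z. norm z \<ge> r \<Longrightarrow> M \<le> K z / norm z"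
    unfolding eventually_at_infinity by auto
  show ?thesis
  proof (intro exI conjI allI)
    show "0 \<le> \<bar>M\<bar> * \<bar>r\<bar>" by simp
    fix z :: "real^'n"
    show "M * norm z \<le> K z + \<bar>M\<bar> * \<bar>r\<bar>"
    proof (cases "norm z \<ge> r \<and> z \<noteq> 0")
      case True
      then have "M * norm z \<le> K z" using r[of z] by (simp add: field_simps)
      then show ?thesis by (simp add: add_increasing2)
    next
      case False
      then have "norm z \<le> \<bar>r\<bar>" by auto
      then have "M * norm z \<le> \<bar>M\<bar> * \<bar>r\<bar>" by (intro mult_mono) auto
      then show ?thesis using K_nonneg[of z] by simp
    qed
  qed
qed

text \<open>Measurability is inherited from the density in
  \<open>lipschitz_path_ae_derivative\<close>, which equals the derivative almost
  everywhere.\<close>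

lemma kin_integrable:
  assumes lip: "L-lipschitz_on {a..b} \<gamma>" and "a \<le> c" "d \<le> b"
  shows "(\<lambda>u. K (vector_derivative \<gamma> (at u))) integrable_on {c..d}"
proof (cases "a \<le> b")
  case False
  then have "{c..d} = {}" using assms by auto
  then show ?thesis by (simp add: integrable_on_empty)
next
  case True
  obtain N h where N: "negligible N"
    and hI: "\<And>c d. a \<le> c \<Longrightarrow> c \<le> d \<Longrightarrow> d \<le> b \<Longrightarrow> (h has_integral (\<gamma> d - \<gamma> c)) {c..d}"
    and der: "\<And>s. s \<notin> N \<Longrightarrow> a < s \<Longrightarrow> s < b \<Longrightarrow> (\<gamma> has_vector_derivative h s) (at s)"
    and hL: "\<And>s. s \<notin> N \<Longrightarrow> a < s \<Longrightarrow> s < b \<Longrightarrow> norm (h s) \<le> L"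
    by (rule lipschitz_path_ae_derivative[OF lip True]) blast
  \<comment> \<open>The truncation alters \<open>h\<close> on a null subset of the interval only and
    makes \<open>K\<close> of it bounded by \<open>KM L\<close> everywhere.\<close>
  define h' where "h' s = (if norm (h s) \<le> L then h s else 0)" for s
  have "h integrable_on {a..b}" using hI[of a b] True by auto
  then have hm [measurable]: "h \<in> borel_measurable (lebesgue_on {a..b})"
    by (rule integrable_imp_measurable)
  have "h' \<in> borel_measurable (lebesgue_on {a..b})"
    unfolding h'_def by measurable
  then have m: "(\<lambda>s. K (h' s)) \<in> borel_measurable (lebesgue_on {a..b})"
    by (rule measurable_compose[OF _ borel_measurable_continuous_onI[OF K_cont]])
  have L0: "L \<ge> 0" by (rule lipschitz_on_nonneg[OF lip])
  have "(\<lambda>s. K (h' s)) integrable_on {a..b}"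
  proof (rule measurable_bounded_by_integrable_imp_integrable[OF m, where g = "\<lambda>_. KM L"])
    fix x show "norm (K (h' x)) \<le> KM L"
      using KM[of "h' x" L] K_nonneg[of "h' x"] L0 by (auto simp: h'_def)
  qed auto
  then have "(\<lambda>u. K (vector_derivative \<gamma> (at u))) integrable_on {a..b}"
  proof (rule integrable_spike)
    show "negligible (N \<union> {a, b})" using N by simp
    fix x assume "x \<in> {a..b} - (N \<union> {a, b})"
    then have x: "x \<notin> N" "a < x" "x < b" by auto
    show "K (vector_derivative \<gamma> (at x)) = K (h' x)"
      using vector_derivative_at[OF der[OF x]] hL[OF x] by (simp add: h'_def)
  qed
  then show ?thesis using integrable_subinterval_real assms by fastforce
qed

lemma kin_nonneg: "0 \<le> kin \<gamma> c d"
  unfolding kin_def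
  by (cases "(\<lambda>u. K (vector_derivative \<gamma> (at u))) integrable_on {c..d}")
     (auto intro!: Henstock_Kurzweil_Integration.integral_nonneg simp: not_integrable_integral K_nonneg)

lemma kin_combine:
  assumes "L-lipschitz_on {a..b} \<gamma>" "a \<le> c" "c \<le> d" "d \<le> e" "e \<le> b"
  shows "kin \<gamma> c e = kin \<gamma> c d + kin \<gamma> d e"
  unfolding kin_def using assms kin_integrable[of L a b \<gamma> c e]
  by (intro Henstock_Kurzweil_Integration.integral_combine[symmetric]) auto

lemma kin_cong:
  assumes "\<And>u. c < u \<Longrightarrow> u < d \<Longrightarrow> \<gamma> u = \<eta> u"
  shows "kin \<gamma> c d = kin \<eta> c d"
  unfolding kin_def
proof (rule integral_spike[of "{c, d}"])
  fix u assume "u \<in> {c..d} - {c, d}"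
  then have u: "u \<in> {c<..<d}" by auto
  have "eventually (\<lambda>x. x \<in> {c<..<d}) (nhds u)"
    using u by (intro eventually_nhds_in_open) auto
  then have "eventually (\<lambda>x. x \<in> UNIV \<longrightarrow> \<eta> x = \<gamma> x) (nhds u)"
    by eventually_elim (use assms in auto)
  then have "vector_derivative \<eta> (at u) = vector_derivative \<gamma> (at u)"
    by (intro vector_derivative_cong_eq) auto
  then show "K (vector_derivative \<eta> (at u)) = K (vector_derivative \<gamma> (at u))" by simp
qed simp

lemma kin_shift: "kin (\<lambda>s. \<gamma> (s + e)) c d = kin \<gamma> (c + e) (d + e)"
  unfolding kin_def vector_derivative_def has_vector_derivative_shift
  using integral_shift_real_ivl[of "c + e" e "d + e" "\<lambda>u. K (SOME f'. (\<gamma> has_vector_derivative f') (at u))"] by simp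

lemma kin_translate: "kin (\<lambda>s. \<gamma> s + z) c d = kin \<gamma> c d"
  unfolding kin_def vector_derivative_def has_vector_derivative_translate by simp

text \<open>Converts time and kinetic energy into distance. The hypothesis on \<open>p\<close> and
  \<open>q\<close> is a linear lower bound for \<open>K\<close>: superlinear growth supplies one
  with any q > 0, and in dimension 2 the power bound supplies one with small
  \<open>p\<close>.\<close>

lemma displacement_le:
  assumes lip: "L-lipschitz_on {a..b} \<gamma>" and cd: "a \<le> c" "c \<le> d" "d \<le> b"
    and pq: "\<And>z. norm z \<le> p + q * K z"
  shows "norm (\<gamma> d - \<gamma> c) \<le> p * (d - c) + q * kin \<gamma> c d"
proof -
  have ab: "a \<le> b" using cd by simp
  obtain N h where N: "negligible N"
    and hI: "\<And>c d. a \<le> c \<Longrightarrow> c \<le> d \<Longrightarrow> d \<le> b \<Longrightarrow> (h has_integral (\<gamma> d - \<gamma> c)) {c..d}"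
    and der: "\<And>s. s \<notin> N \<Longrightarrow> a < s \<Longrightarrow> s < b \<Longrightarrow> (\<gamma> has_vector_derivative h s) (at s)"
    and "\<And>s. s \<notin> N \<Longrightarrow> a < s \<Longrightarrow> s < b \<Longrightarrow> norm (h s) \<le> L"
    by (rule lipschitz_path_ae_derivative[OF lip ab]) blast
  \<comment> \<open>On the exceptional set the value 0 keeps the pointwise bound true, since the
    hypothesis itself makes p + q * K nonnegative.\<close>
  define h' where "h' s = (if s \<in> N \<union> {a, b} then 0 else h s)" for s
  have h': "(h' has_integral (\<gamma> d - \<gamma> c)) {c..d}"
    by (rule has_integral_spike[OF _ _ hI[OF cd], of "N \<union> {a, b}"]) (use N in \<open>auto simp: h'_def\<close>)
  have ki: "(\<lambda>u. K (vector_derivative \<gamma> (at u))) integrable_on {c..d}"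
    by (rule kin_integrable[OF lip cd(1,3)])
  have ptw: "norm (h' s) \<le> p + q * K (vector_derivative \<gamma> (at s))" if "s \<in> {c..d}" for s
  proof (cases "s \<in> N \<union> {a, b}")
    case True
    have "0 \<le> p + q * K (vector_derivative \<gamma> (at s))"
      using pq[of "vector_derivative \<gamma> (at s)"] norm_ge_zero order_trans by blast
    then show ?thesis using True by (auto simp: h'_def)
  next
    case False
    then show ?thesis
      using vector_derivative_at[OF der[of s]] pq[of "h s"] cd that by (auto simp: h'_def)
  qed
  have "norm (integral {c..d} h') \<le> integral {c..d} (\<lambda>s. p + q * K (vector_derivative \<gamma> (at s)))"
    by (rule Henstock_Kurzweil_Integration.integral_norm_bound_integral)
       (use h' ki ptw in \<open>auto intro!: integrable_add integrable_on_mult_right\<close>)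
  also have "\<dots> = p * (d - c) + q * kin \<gamma> c d"
    unfolding kin_def using ki cd
    by (subst Henstock_Kurzweil_Integration.integral_add) (auto intro!: integrable_on_mult_right)
  finally show ?thesis using integral_unique[OF h'] by simp
qed

text \<open>Competitors are assembled through this relation, so that constructing one becomes
  arithmetic with times and costs. \<open>A\<close> only bounds the cost from above, which makes the
  relation monotone.\<close>

definition reach :: "(int^'n) set \<Rightarrow> real \<Rightarrow> real^'n \<Rightarrow> real^'n \<Rightarrow> real \<Rightarrow> bool" where
  "reach S T y z A \<longleftrightarrow> 0 \<le> T \<and> (\<exists>\<gamma> L. L-lipschitz_on {0..T} \<gamma> \<and> \<gamma> 0 = y \<and> \<gamma> T = z
     \<and> kin \<gamma> 0 T + \<delta> * tim S \<gamma> 0 T \<le> A)"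

lemma reach_mono: "reach S T y z A \<Longrightarrow> A \<le> A' \<Longrightarrow> reach S T y z A'"
  unfolding reach_def by force

lemma reach_sub:
  assumes lip: "L-lipschitz_on {0..T} \<gamma>" and cd: "0 \<le> c" "c \<le> d" "d \<le> T"
  shows "reach S (d - c) (\<gamma> c) (\<gamma> d) (kin \<gamma> c d + \<delta> * tim S \<gamma> c d)"
proof -
  have "L-lipschitz_on {0..d - c} (\<lambda>s. \<gamma> (s + c))"
  proof (rule lipschitz_onI)
    fix s r assume "s \<in> {0..d - c}" "r \<in> {0..d - c}"
    then show "dist (\<gamma> (s + c)) (\<gamma> (r + c)) \<le> L * dist s r"
      using lipschitz_onD[OF lip, of "s + c" "r + c"] cd by (simp add: dist_real_def)
  qed (rule lipschitz_on_nonneg[OF lip])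
  then show ?thesis
    unfolding reach_def using cd
    by (auto intro!: exI[of _ "\<lambda>s. \<gamma> (s + c)"] simp: kin_shift tim_shift)
qed

lemma reach_concat:
  assumes "reach S T y w A" "reach S T' w z A'"
  shows "reach S (T + T') y z (A + A')"
proof -
  obtain \<gamma> L where g: "L-lipschitz_on {0..T} \<gamma>" "\<gamma> 0 = y" "\<gamma> T = w"
     "kin \<gamma> 0 T + \<delta> * tim S \<gamma> 0 T \<le> A" and T: "0 \<le> T"
    using assms(1) unfolding reach_def by auto
  obtain \<gamma>' L' where g': "L'-lipschitz_on {0..T'} \<gamma>'" "\<gamma>' 0 = w" "\<gamma>' T' = z"
     "kin \<gamma>' 0 T' + \<delta> * tim S \<gamma>' 0 T' \<le> A'" and T': "0 \<le> T'"
    using assms(2) unfolding reach_def by auto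
  define \<eta> where "\<eta> s = (if s \<le> T then \<gamma> s else \<gamma>' (s + - T))" for s
  have "L'-lipschitz_on {T..T + T'} (\<lambda>s. \<gamma>' (s + - T))"
  proof (rule lipschitz_onI)
    fix s r assume "s \<in> {T..T + T'}" "r \<in> {T..T + T'}"
    then show "dist (\<gamma>' (s + - T)) (\<gamma>' (r + - T)) \<le> L' * dist s r"
      using lipschitz_onD[OF g'(1), of "s + - T" "r + - T"] by (simp add: dist_real_def)
  qed (rule lipschitz_on_nonneg[OF g'(1)])
  then have lip: "(max L L')-lipschitz_on {0..T + T'} \<eta>"
    unfolding \<eta>_def using g g' by (intro lipschitz_on_concat_max) auto
  have cont: "continuous_on {0..T + T'} \<eta>" by (rule lipschitz_on_continuous_on[OF lip])
  have "kin \<eta> 0 (T + T') = kin \<eta> 0 T + kin \<eta> T (T + T')"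
    using T T' by (intro kin_combine[OF lip]) auto
  also have "kin \<eta> 0 T = kin \<gamma> 0 T" by (rule kin_cong) (simp add: \<eta>_def)
  also have "kin \<eta> T (T + T') = kin (\<lambda>s. \<gamma>' (s + - T)) T (T + T')" by (rule kin_cong) (simp add: \<eta>_def)
  also have "\<dots> = kin \<gamma>' 0 T'" by (subst kin_shift) simp
  finally have k: "kin \<eta> 0 (T + T') = kin \<gamma> 0 T + kin \<gamma>' 0 T'" .
  have "tim S \<eta> 0 (T + T') = tim S \<eta> 0 T + tim S \<eta> T (T + T')"
    using T T' by (intro tim_combine[OF cont]) auto
  also have "tim S \<eta> 0 T = tim S \<gamma> 0 T" by (rule tim_cong) (simp add: \<eta>_def)
  also have "tim S \<eta> T (T + T') = tim S (\<lambda>s. \<gamma>' (s + - T)) T (T + T')" by (rule tim_cong) (simp add: \<eta>_def)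
  also have "\<dots> = tim S \<gamma>' 0 T'" by (subst tim_shift) simp
  finally have t: "tim S \<eta> 0 (T + T') = tim S \<gamma> 0 T + tim S \<gamma>' 0 T'" .
  have "\<eta> 0 = y" "\<eta> (T + T') = z" using g g' T T' by (auto simp: \<eta>_def)
  moreover have "kin \<eta> 0 (T + T') + \<delta> * tim S \<eta> 0 (T + T') \<le> A + A'"
    using k t g(4) g'(4) by (simp add: algebra_simps)
  ultimately show ?thesis unfolding reach_def using lip T T' by auto
qed

lemma kin_const_vel:
  assumes "\<And>u. c < u \<Longrightarrow> u < d \<Longrightarrow> (\<gamma> has_vector_derivative v) (at u)" "c \<le> d"
  shows "kin \<gamma> c d = (d - c) * K v"
proof -
  have "kin \<gamma> c d = integral {c..d} (\<lambda>_. K v)"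
    unfolding kin_def
  proof (rule integral_spike[of "{c, d}"])
    fix x assume "x \<in> {c..d} - {c, d}"
    then show "K v = K (vector_derivative \<gamma> (at x))"
      using vector_derivative_at[OF assms(1)[of x]] by auto
  qed simp
  then show ?thesis using assms by simp
qed

lemma reach_line:
  assumes "norm (z - y) \<le> v * T" "0 \<le> T"
  shows "reach S T y z (T * (KM v + \<delta>))"
proof -
  define w where "w = (z - y) /\<^sub>R T"
  define \<gamma> where "\<gamma> s = y + s *\<^sub>R w" for s
  have T: "T *\<^sub>R w = z - y" using assms by (cases "T = 0") (auto simp: w_def)
  have lip: "(norm w)-lipschitz_on {0..T} \<gamma>"
    by (rule lipschitz_onI) (auto simp: \<gamma>_def dist_norm scaleR_diff_left[symmetric] mult.commute)
  have kin: "kin \<gamma> 0 T = (T - 0) * K w"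
    by (rule kin_const_vel) (use assms in \<open>auto simp: \<gamma>_def[abs_def] intro!: derivative_eq_intros\<close>)
  have "T * K w \<le> T * KM v"
  proof (cases "T = 0")
    case False
    moreover have "norm w = norm (z - y) / \<bar>T\<bar>" by (simp add: w_def divide_inverse mult.commute)
    ultimately have "norm w \<le> v" using assms by (simp add: pos_divide_le_eq)
    then show ?thesis using KM[of w v] assms by (intro mult_left_mono) auto
  qed simp
  moreover have "tim S \<gamma> 0 T \<le> T - 0"
    by (rule tim_le[OF lipschitz_on_continuous_on[OF lip]]) (use assms in auto)
  then have "\<delta> * tim S \<gamma> 0 T \<le> \<delta> * T" using \<delta>_pos by simp
  ultimately have "kin \<gamma> 0 T + \<delta> * tim S \<gamma> 0 T \<le> T * (KM v + \<delta>)"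
    using kin by (simp add: algebra_simps)
  moreover have "\<gamma> 0 = y" "\<gamma> T = z" using T by (auto simp: \<gamma>_def)
  ultimately show ?thesis unfolding reach_def using assms lip by auto
qed

lemma reach_rest:
  assumes "0 \<le> T"
  shows "reach S T y y (\<delta> * T)" and "cube_of y \<notin> S \<Longrightarrow> reach S T y y 0"
proof -
  have lip: "0-lipschitz_on {0..T} (\<lambda>s. y)" by (rule lipschitz_on_constant)
  have kin: "kin (\<lambda>s. y) 0 T = (T - 0) * K 0"
    by (rule kin_const_vel) (use assms in auto)
  have "tim S (\<lambda>s. y) 0 T \<le> T - 0"
    by (rule tim_le[OF lipschitz_on_continuous_on[OF lip]]) (use assms in auto)
  then have "kin (\<lambda>s. y) 0 T + \<delta> * tim S (\<lambda>s. y) 0 T \<le> \<delta> * T" using kin \<delta>_pos by (simp add: K_zero)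
  then show "reach S T y y (\<delta> * T)" unfolding reach_def using assms lip by blast
  assume "cube_of y \<notin> S"
  then have "tim S (\<lambda>s. y) 0 T = 0" by (simp add: tim_def)
  then have "kin (\<lambda>s. y) 0 T + \<delta> * tim S (\<lambda>s. y) 0 T \<le> 0" using kin by (simp add: K_zero)
  then show "reach S T y y 0" unfolding reach_def using assms lip by blast
qed

lemma reach_translate:
  assumes "reach S T (y + rvec z) (w + rvec z) A"
  shows "reach (shift z S) T y w A"
proof -
  obtain \<gamma> L where g: "L-lipschitz_on {0..T} \<gamma>" "\<gamma> 0 = y + rvec z" "\<gamma> T = w + rvec z"
     "kin \<gamma> 0 T + \<delta> * tim S \<gamma> 0 T \<le> A" and T: "0 \<le> T"
    using assms(1) unfolding reach_def by auto
  define \<eta> where "\<eta> s = \<gamma> s + - rvec z" for s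
  have "L-lipschitz_on {0..T} \<eta>"
    using g(1) unfolding lipschitz_on_def \<eta>_def by (simp add: dist_norm)
  moreover have "kin \<eta> 0 T = kin \<gamma> 0 T" unfolding \<eta>_def by (rule kin_translate)
  moreover have "cube_of (\<eta> s) + z = cube_of (\<gamma> s)" for s
    by (simp add: cube_of_def \<eta>_def rvec_def vec_eq_iff)
  then have "tim (shift z S) \<eta> 0 T = tim S \<gamma> 0 T"
    by (intro tim_cong) (simp add: shift_def)
  ultimately show ?thesis unfolding reach_def using g T
    by (auto intro!: exI[of _ \<eta>] simp: \<eta>_def)
qed

end

section \<open>Replacing pieces of a path\<close>

lemma finite_card_vec_box:
  fixes A :: "'n::finite \<Rightarrow> 'a set"
  assumes "\<And>i. finite (A i)"
  shows "finite {k :: 'a^'n. \<forall>i. k $ i \<in> A i}" "card {k :: 'a^'n. \<forall>i. k $ i \<in> A i} = (\<Prod>i\<in>UNIV. card (A i))"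
proof -
  have b: "bij_betw vec_lambda (PiE UNIV A) {k :: 'a^'n. \<forall>i. k $ i \<in> A i}"
    by (rule bij_betw_byWitness[where f' = vec_nth]) (auto simp: PiE_def Pi_def vec_lambda_inverse)
  show "finite {k :: 'a^'n. \<forall>i. k $ i \<in> A i}"
    using bij_betw_finite[OF b] finite_PiE[of UNIV A] assms by simp
  show "card {k :: 'a^'n. \<forall>i. k $ i \<in> A i} = (\<Prod>i\<in>UNIV. card (A i))"
    using bij_betw_same_card[OF b] card_PiE[of UNIV A] by simp
qed

definition ibox :: "int^'n \<Rightarrow> nat \<Rightarrow> (int^'n) set" where
  "ibox p m = {k. \<forall>i. k $ i \<in> {p $ i..<p $ i + int m}}"

lemma finite_ibox: "finite (ibox (p :: int^'n) m)" and card_ibox: "card (ibox (p :: int^'n) m) = m ^ CARD('n)"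
proof -
  show "finite (ibox p m)"
    unfolding ibox_def by (rule finite_card_vec_box) simp
  have "card (ibox p m) = (\<Prod>i\<in>(UNIV::'n set). card {p $ i..<p $ i + int m})"
    unfolding ibox_def by (rule finite_card_vec_box) simp
  then show "card (ibox p m) = m ^ CARD('n)" by simp
qed

text \<open>The value \<open>n\<close> means that none of the sites \<open>f 0, \<dots>, f (n - 1)\<close> lies outside \<open>S\<close>.\<close>

definition lead :: "nat \<Rightarrow> (nat \<Rightarrow> 'k) \<Rightarrow> 'k set \<Rightarrow> real" where
  "lead n f S = (\<Sum>j<n. if f ` {..j} \<subseteq> S then 1 else 0)"

lemma lead_nonneg: "0 \<le> lead n f S"
  unfolding lead_def by (intro sum_nonneg) auto

lemma lead_first: "(\<exists>j<n. f j \<notin> S \<and> real j \<le> lead n f S) \<or> lead n f S = real n"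
proof (cases "\<exists>j<n. f j \<notin> S")
  case False
  then have "lead n f S = (\<Sum>j<n. 1)" unfolding lead_def by (intro sum.cong) auto
  then show ?thesis by simp
next
  case True
  then obtain j where j: "j < n" "f j \<notin> S" "\<And>i. i < j \<Longrightarrow> f i \<in> S"
    using exists_least_iff[of "\<lambda>j. j < n \<and> f j \<notin> S"] by auto
  have "real j = (\<Sum>i<j. 1)" by simp
  also have "\<dots> = (\<Sum>i<j. if f ` {..i} \<subseteq> S then 1 else 0)" using j by (intro sum.cong) auto
  also have "\<dots> \<le> lead n f S" unfolding lead_def using j by (intro sum_mono2) auto
  finally show ?thesis using j by auto
qed

text \<open>Two disjoint rays in an arbitrary coordinate direction: one of them avoids any given site.\<close>

definition ray1 :: "int^'n \<Rightarrow> nat \<Rightarrow> int^'n" where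
  "ray1 c j = c + axis undefined (int j)"

definition ray2 :: "int^'n \<Rightarrow> nat \<Rightarrow> int^'n" where
  "ray2 c j = c + axis undefined (- 1 - int j)"

text \<open>First and last visit are attained because \<open>C\<close> is closed and the time
  interval compact; this is why the half-open cubes are enlarged to closed ones in its
  applications.\<close>

lemma entry_exit_times:
  fixes \<gamma> :: "real \<Rightarrow> 'a::metric_space"
  assumes "continuous_on {0..t} \<gamma>" "closed C" "s \<in> {0..t}" "\<gamma> s \<in> C"
  obtains s1 s2 where "0 \<le> s1" "s1 \<le> s" "s \<le> s2" "s2 \<le> t" "\<gamma> s1 \<in> C" "\<gamma> s2 \<in> C"
    "\<And>r. r \<in> {0..t} \<Longrightarrow> \<gamma> r \<in> C \<Longrightarrow> s1 \<le> r \<and> r \<le> s2"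
proof -
  have "closed ({0..t} \<inter> \<gamma> -` C)" by (rule continuous_closed_preimage[OF assms(1) _ assms(2)]) simp
  then have c: "compact ({0..t} \<inter> \<gamma> -` C)"
    by (metis closed_Int_compact compact_Icc inf.left_idem inf_commute)
  have ne: "{0..t} \<inter> \<gamma> -` C \<noteq> {}" using assms by auto
  obtain s1 where s1: "s1 \<in> {0..t} \<inter> \<gamma> -` C" "\<And>r. r \<in> {0..t} \<inter> \<gamma> -` C \<Longrightarrow> s1 \<le> r"
    using compact_attains_inf[OF c ne] by auto
  obtain s2 where s2: "s2 \<in> {0..t} \<inter> \<gamma> -` C" "\<And>r. r \<in> {0..t} \<inter> \<gamma> -` C \<Longrightarrow> r \<le> s2"
    using compact_attains_sup[OF c ne] by auto
  show ?thesis by (rule that[of s1 s2]) (use s1 s2 assms in auto)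
qed

lemma norm_le_card_mult:
  fixes v :: "real^'n"
  assumes "\<And>i. \<bar>v $ i\<bar> \<le> c"
  shows "norm v \<le> real CARD('n) * c"
proof -
  have "norm v \<le> (\<Sum>i\<in>UNIV. \<bar>v $ i\<bar>)" by (rule norm_le_l1_cart)
  also have "\<dots> \<le> (\<Sum>i\<in>(UNIV::'n set). c)" by (intro sum_mono assms)
  finally show ?thesis by simp
qed

lemma cube_of_in_cube:
  fixes p :: "int^'n" and v :: "real^'n"
  assumes "cube_of v \<in> ibox p m"
  shows "v \<in> {v. \<forall>i. real_of_int (p $ i) \<le> v $ i \<and> v $ i \<le> real_of_int (p $ i) + real m}"
proof -
  have "real_of_int (p $ i) \<le> v $ i \<and> v $ i \<le> real_of_int (p $ i) + real m" for i
  proof -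
    have "p $ i \<le> \<lfloor>v $ i\<rfloor>" "\<lfloor>v $ i\<rfloor> < p $ i + int m" using assms by (auto simp: ibox_def cube_of_def)
    then have "real_of_int (p $ i) \<le> v $ i" "v $ i < real_of_int (p $ i + int m)"
      by (simp_all add: le_floor_iff floor_less_iff)
    then show ?thesis by simp
  qed
  then show ?thesis by simp
qed

lemma closed_cube: "closed {v :: real^'n. \<forall>i. a i \<le> v $ i \<and> v $ i \<le> b i}"
  by (intro closed_Collect_all closed_Collect_conj closed_Collect_le continuous_intros)

lemma cube_diameter:
  fixes v w :: "real^'n" and p :: "int^'n"
  assumes "v \<in> {v. \<forall>i. real_of_int (p $ i) \<le> v $ i \<and> v $ i \<le> real_of_int (p $ i) + real m}"
    "w \<in> {v. \<forall>i. real_of_int (p $ i) \<le> v $ i \<and> v $ i \<le> real_of_int (p $ i) + real m}"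
  shows "norm (v - w) \<le> real CARD('n) * real m"
proof (rule norm_le_card_mult)
  fix i
  have "real_of_int (p $ i) \<le> v $ i" "v $ i \<le> real_of_int (p $ i) + real m"
    "real_of_int (p $ i) \<le> w $ i" "w $ i \<le> real_of_int (p $ i) + real m" using assms by auto
  then show "\<bar>(v - w) $ i\<bar> \<le> real m" by (simp add: abs_le_iff)
qed

lemma tim_eq_subinterval:
  assumes cont: "continuous_on {0..t} \<gamma>" and s: "0 \<le> s1" "s1 \<le> s2" "s2 \<le> t"
    and "\<And>r. r \<in> {0..t} \<Longrightarrow> cube_of (\<gamma> r) \<in> B \<Longrightarrow> s1 \<le> r \<and> r \<le> s2"
  shows "tim B \<gamma> 0 t = tim B \<gamma> s1 s2"
proof -
  have "tim B \<gamma> 0 t = tim B \<gamma> 0 s1 + tim B \<gamma> s1 t" using s by (intro tim_combine[OF cont]) auto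
  also have "tim B \<gamma> s1 t = tim B \<gamma> s1 s2 + tim B \<gamma> s2 t" using s by (intro tim_combine[OF cont]) auto
  also have "tim B \<gamma> 0 s1 = tim {} \<gamma> 0 s1"
  proof (rule tim_cong)
    show "cube_of (\<gamma> u) \<in> B \<longleftrightarrow> cube_of (\<gamma> u) \<in> {}" if "0 < u" "u < s1" for u
      using assms(5)[of u] that s by auto
  qed
  also have "tim B \<gamma> s2 t = tim {} \<gamma> s2 t"
  proof (rule tim_cong)
    show "cube_of (\<gamma> u) \<in> B \<longleftrightarrow> cube_of (\<gamma> u) \<in> {}" if "s2 < u" "u < t" for u
      using assms(5)[of u] that s by auto
  qed
  finally show ?thesis by (simp add: tim_def)
qed

context lagrangian
begin

text \<open>Cost per unit of time, in any environment, of straight motion with speed at most d =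
  \<open>CARD('n)\<close>. A cube of side m has diameter at most d * m and is thus crossed in time m
  at cost m * \<open>vel\<close>.\<close>

definition vel :: real where "vel = KM (real CARD('n)) + \<delta>"

lemma vel_ge: "\<delta> \<le> vel" "0 < vel"
  using KM_nonneg \<delta>_pos by (auto simp: vel_def add_nonneg_pos)

lemma reach_line_box:
  assumes "norm (z - y) \<le> real CARD('n) * T" "0 \<le> T"
  shows "reach S T y z (T * vel)"
  unfolding vel_def by (rule reach_line[OF assms])

lemma reach_antimono:
  assumes "reach S' T y z A" "S \<subseteq> S'"
  shows "reach S T y z A"
proof -
  obtain \<gamma> L where g: "L-lipschitz_on {0..T} \<gamma>" "\<gamma> 0 = y" "\<gamma> T = z"
     "kin \<gamma> 0 T + \<delta> * tim S' \<gamma> 0 T \<le> A" and T: "0 \<le> T"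
    using assms(1) unfolding reach_def by auto
  have "tim S \<gamma> 0 T \<le> tim S' \<gamma> 0 T"
    by (rule tim_mono[OF lipschitz_on_continuous_on[OF g(1)]]) (use assms in auto)
  then have "\<delta> * tim S \<gamma> 0 T \<le> \<delta> * tim S' \<gamma> 0 T" using \<delta>_pos by simp
  then have "kin \<gamma> 0 T + \<delta> * tim S \<gamma> 0 T \<le> A" using g(4) by linarith
  then show ?thesis unfolding reach_def using g T by blast
qed

text \<open>Between its first and last visit to the cube \<open>k\<close> a path may be replaced by a segment traversed in
  unit time; what is lost is time rather than action.\<close>

lemma cut_cube:
  assumes lip: "L-lipschitz_on {0..t} \<gamma>" and t: "0 \<le> t" and k: "k \<notin> S"
  shows "\<exists>T. 0 \<le> T \<and> T \<le> t \<and> reach (insert k S) T (\<gamma> 0) (\<gamma> t) (kin \<gamma> 0 t + \<delta> * tim S \<gamma> 0 t + vel)"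
proof -
  have cont: "continuous_on {0..t} \<gamma>" by (rule lipschitz_on_continuous_on[OF lip])
  have whole: "reach (insert k S) t (\<gamma> 0) (\<gamma> t) (kin \<gamma> 0 t + \<delta> * tim S \<gamma> 0 t + \<delta> * tim {k} \<gamma> 0 t)"
    using reach_sub[OF lip, of 0 t "insert k S"] t tim_insert[OF cont, of 0 t k S] k
    by (simp add: algebra_simps)
  define C where "C = {v :: real^'n. \<forall>i. real_of_int (k $ i) \<le> v $ i \<and> v $ i \<le> real_of_int (k $ i) + real 1}"
  have inC: "\<gamma> r \<in> C" if "cube_of (\<gamma> r) = k" for r
    using cube_of_in_cube[of "\<gamma> r" k 1] that by (simp add: C_def ibox_def)
  show ?thesis
  proof (cases "\<exists>s\<in>{0..t}. \<gamma> s \<in> C")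
    case False
    then have "tim {k} \<gamma> 0 t = tim {} \<gamma> 0 t" using inC by (intro tim_cong) force
    then have "reach (insert k S) t (\<gamma> 0) (\<gamma> t) (kin \<gamma> 0 t + \<delta> * tim S \<gamma> 0 t + vel)"
      using reach_mono[OF whole, of "kin \<gamma> 0 t + \<delta> * tim S \<gamma> 0 t + vel"] vel_ge by (simp add: tim_def)
    then show ?thesis using t by blast
  next
    case True
    then obtain s where s: "s \<in> {0..t}" "\<gamma> s \<in> C" by auto
    have "closed C" unfolding C_def by (rule closed_cube)
    then obtain s1 s2 where s12: "0 \<le> s1" "s1 \<le> s" "s \<le> s2" "s2 \<le> t" "\<gamma> s1 \<in> C" "\<gamma> s2 \<in> C"
      "\<And>r. r \<in> {0..t} \<Longrightarrow> \<gamma> r \<in> C \<Longrightarrow> s1 \<le> r \<and> r \<le> s2"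
      using entry_exit_times[OF cont _ s, of thesis] by blast
    have tk: "tim {k} \<gamma> 0 t = tim {k} \<gamma> s1 s2"
      by (rule tim_eq_subinterval[OF cont]) (use s12 inC in auto)
    show ?thesis
    \<comment> \<open>No time can be gained from visits spanning at most one unit, but then raising
      \<open>k\<close> costs at most \<delta> \<le> \<open>vel\<close> along the unchanged
      path.\<close>
    proof (cases "s2 - s1 \<le> 1")
      case True
      have "tim {k} \<gamma> s1 s2 \<le> s2 - s1" by (rule tim_le[OF cont]) (use s12 in auto)
      then have "\<delta> * tim {k} \<gamma> 0 t \<le> \<delta> * 1" using True \<delta>_pos tk by (intro mult_left_mono) auto
      then have "reach (insert k S) t (\<gamma> 0) (\<gamma> t) (kin \<gamma> 0 t + \<delta> * tim S \<gamma> 0 t + vel)"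
        using reach_mono[OF whole, of "kin \<gamma> 0 t + \<delta> * tim S \<gamma> 0 t + vel"] vel_ge by simp
      then show ?thesis using t by blast
    next
      case False
      have out: "tim (insert k S) \<gamma> 0 s1 = tim S \<gamma> 0 s1" "tim (insert k S) \<gamma> s2 t = tim S \<gamma> s2 t"
      proof -
        have ne: "cube_of (\<gamma> u) \<noteq> k" if "0 \<le> u" "u \<le> t" "u < s1 \<or> s2 < u" for u
          using s12(7)[of u] inC[of u] that by auto
        show "tim (insert k S) \<gamma> 0 s1 = tim S \<gamma> 0 s1"
          by (rule tim_cong) (use ne s12 in auto)
        show "tim (insert k S) \<gamma> s2 t = tim S \<gamma> s2 t"
          by (rule tim_cong) (use ne s12 in auto)
      qed
      have r1: "reach (insert k S) (s1 - 0) (\<gamma> 0) (\<gamma> s1) (kin \<gamma> 0 s1 + \<delta> * tim S \<gamma> 0 s1)"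
        using reach_sub[OF lip, of 0 s1 "insert k S"] s12 out by simp
      have r3: "reach (insert k S) (t - s2) (\<gamma> s2) (\<gamma> t) (kin \<gamma> s2 t + \<delta> * tim S \<gamma> s2 t)"
        using reach_sub[OF lip, of s2 t "insert k S"] s12 out by simp
      have r2: "reach (insert k S) 1 (\<gamma> s1) (\<gamma> s2) (1 * vel)"
        by (rule reach_line_box) (use cube_diameter[of "\<gamma> s2" k 1 "\<gamma> s1"] s12 in \<open>auto simp: C_def\<close>)
      have r: "reach (insert k S) (s1 - 0 + 1 + (t - s2)) (\<gamma> 0) (\<gamma> t)
        (kin \<gamma> 0 s1 + \<delta> * tim S \<gamma> 0 s1 + 1 * vel + (kin \<gamma> s2 t + \<delta> * tim S \<gamma> s2 t))"
        by (rule reach_concat[OF reach_concat[OF r1 r2] r3])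
      have "kin \<gamma> 0 t = kin \<gamma> 0 s1 + kin \<gamma> s1 t" "kin \<gamma> s1 t = kin \<gamma> s1 s2 + kin \<gamma> s2 t"
        "tim S \<gamma> 0 t = tim S \<gamma> 0 s1 + tim S \<gamma> s1 t" "tim S \<gamma> s1 t = tim S \<gamma> s1 s2 + tim S \<gamma> s2 t"
        using s12 by (auto intro!: kin_combine[OF lip] tim_combine[OF cont])
      then have "kin \<gamma> 0 s1 + \<delta> * tim S \<gamma> 0 s1 + 1 * vel + (kin \<gamma> s2 t + \<delta> * tim S \<gamma> s2 t)
         + (kin \<gamma> s1 s2 + \<delta> * tim S \<gamma> s1 s2) = kin \<gamma> 0 t + \<delta> * tim S \<gamma> 0 t + vel"
        by (simp add: algebra_simps)
      moreover have "0 \<le> kin \<gamma> s1 s2 + \<delta> * tim S \<gamma> s1 s2"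
        using kin_nonneg[of \<gamma> s1 s2] tim_nonneg[of S \<gamma> s1 s2] \<delta>_pos by simp
      ultimately have "reach (insert k S) (s1 - 0 + 1 + (t - s2)) (\<gamma> 0) (\<gamma> t) (kin \<gamma> 0 t + \<delta> * tim S \<gamma> 0 t + vel)"
        by (intro reach_mono[OF r]) linarith
      then show ?thesis using s12 False by (intro exI[of _ "s1 - 0 + 1 + (t - s2)"]) auto
    qed
  qed
qed

text \<open>Cubes visited while the length parameter stays in one unit interval are neighbours of each other.\<close>

lemma card_visited_le:
  assumes lip: "L-lipschitz_on {a..b} \<gamma>" and ab: "a \<le> b"
    and pq: "\<And>z. norm z \<le> p + q * K z" and p: "0 \<le> p" and q: "0 \<le> q"
  shows "finite ((\<lambda>s. cube_of (\<gamma> s)) ` {a..b})"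
    and "real (card ((\<lambda>s. cube_of (\<gamma> s)) ` {a..b})) \<le> 3 ^ CARD('n) * (p * (b - a) + q * kin \<gamma> a b + 2)"
proof -
  \<comment> \<open>The length parameter: its increments dominate displacements. Two times at which
    it has the same integer part give points at distance less than 1, so their cubes differ by at
    most 1 in each coordinate.\<close>
  define \<Phi> where "\<Phi> s = p * (s - a) + q * kin \<gamma> a s" for s
  have \<Phi>: "norm (\<gamma> r - \<gamma> s) \<le> \<Phi> r - \<Phi> s" if "a \<le> s" "s \<le> r" "r \<le> b" for s r
    using displacement_le[OF lip that pq] kin_combine[OF lip order_refl that] by (simp add: \<Phi>_def algebra_simps)
  have \<Phi>a: "\<Phi> a = 0" by (simp add: \<Phi>_def kin_def)
  define N where "N = nat \<lfloor>\<Phi> b\<rfloor>"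
  have \<Phi>b: "0 \<le> \<Phi> b" using p q ab kin_nonneg by (simp add: \<Phi>_def)
  define cls where "cls i = (\<lambda>s. cube_of (\<gamma> s)) ` {s \<in> {a..b}. nat \<lfloor>\<Phi> s\<rfloor> = i}" for i
  have sub: "(\<lambda>s. cube_of (\<gamma> s)) ` {a..b} \<subseteq> (\<Union>i\<in>{..N}. cls i)"
  proof
    fix k assume "k \<in> (\<lambda>s. cube_of (\<gamma> s)) ` {a..b}"
    then obtain s where s: "s \<in> {a..b}" "k = cube_of (\<gamma> s)" by auto
    have "norm (\<gamma> b - \<gamma> s) \<le> \<Phi> b - \<Phi> s" using \<Phi>[of s b] s by auto
    then have "\<Phi> s \<le> \<Phi> b" using norm_ge_zero[of "\<gamma> b - \<gamma> s"] by linarith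
    then have "nat \<lfloor>\<Phi> s\<rfloor> \<le> N" unfolding N_def by (intro nat_mono floor_mono)
    then show "k \<in> (\<Union>i\<in>{..N}. cls i)" using s by (auto simp: cls_def)
  qed
  have cls: "finite (cls i) \<and> card (cls i) \<le> 3 ^ CARD('n)" for i
  proof (cases "cls i = {}")
    case False
    then obtain s where s: "s \<in> {a..b}" "nat \<lfloor>\<Phi> s\<rfloor> = i" by (auto simp: cls_def)
    have "cls i \<subseteq> {k. \<forall>j. k $ j \<in> {cube_of (\<gamma> s) $ j - 1..cube_of (\<gamma> s) $ j + 1}}" (is "_ \<subseteq> ?E")
    proof
      fix k assume "k \<in> cls i"
      then obtain r where r: "r \<in> {a..b}" "nat \<lfloor>\<Phi> r\<rfloor> = i" "k = cube_of (\<gamma> r)" by (auto simp: cls_def)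
      have pos: "0 \<le> \<Phi> u" if "u \<in> {a..b}" for u
        using order_trans[OF norm_ge_zero \<Phi>[of a u]] that \<Phi>a by auto
      have "\<lfloor>\<Phi> s\<rfloor> = \<lfloor>\<Phi> r\<rfloor>" using s r pos[of s] pos[of r] by (auto simp: nat_eq_iff2)
      then have d: "\<bar>\<Phi> s - \<Phi> r\<bar> < 1" by linarith
      have "norm (\<gamma> r - \<gamma> s) \<le> \<bar>\<Phi> s - \<Phi> r\<bar>"
        using \<Phi>[of s r] \<Phi>[of r s] s r by (cases "s \<le> r") (auto simp: norm_minus_commute)
      then have n: "norm (\<gamma> r - \<gamma> s) < 1" using d by simp
      have "k $ j \<in> {cube_of (\<gamma> s) $ j - 1..cube_of (\<gamma> s) $ j + 1}" for j
      proof -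
        have "\<bar>\<gamma> r $ j - \<gamma> s $ j\<bar> < 1" using n component_le_norm_cart[of "\<gamma> r - \<gamma> s" j] by simp
        then have "\<lfloor>\<gamma> s $ j\<rfloor> - 1 \<le> \<lfloor>\<gamma> r $ j\<rfloor>" "\<lfloor>\<gamma> r $ j\<rfloor> \<le> \<lfloor>\<gamma> s $ j\<rfloor> + 1" by linarith+
        then show ?thesis by (simp add: r cube_of_def)
      qed
      then show "k \<in> ?E" by simp
    qed
    moreover have "finite ?E" "card ?E = (\<Prod>j\<in>(UNIV::'n set). card {cube_of (\<gamma> s) $ j - 1..cube_of (\<gamma> s) $ j + 1})"
      by (rule finite_card_vec_box; simp)+
    moreover have "(\<Prod>j\<in>(UNIV::'n set). card {cube_of (\<gamma> s) $ j - 1..cube_of (\<gamma> s) $ j + 1}) = 3 ^ CARD('n)"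
      by simp
    ultimately show ?thesis using card_mono[of ?E "cls i"] finite_subset[of "cls i" ?E] by auto
  qed simp
  have fin: "finite (\<Union>i\<in>{..N}. cls i)" using cls by auto
  show "finite ((\<lambda>s. cube_of (\<gamma> s)) ` {a..b})" using finite_subset[OF sub fin] .
  have "card ((\<lambda>s. cube_of (\<gamma> s)) ` {a..b}) \<le> card (\<Union>i\<in>{..N}. cls i)" by (rule card_mono[OF fin sub])
  also have "\<dots> \<le> (\<Sum>i\<in>{..N}. card (cls i))" by (rule card_UN_le) simp
  also have "\<dots> \<le> (\<Sum>i\<in>{..N}. 3 ^ CARD('n))" using cls by (intro sum_mono) auto
  also have "\<dots> = (N + 1) * 3 ^ CARD('n)" by simp
  finally have "real (card ((\<lambda>s. cube_of (\<gamma> s)) ` {a..b})) \<le> real ((N + 1) * 3 ^ CARD('n))" by linarith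
  also have "\<dots> = 3 ^ CARD('n) * (real N + 1)" by (simp add: algebra_simps)
  also have "\<dots> \<le> 3 ^ CARD('n) * (p * (b - a) + q * kin \<gamma> a b + 2)"
  proof (rule mult_left_mono)
    have "real N \<le> \<Phi> b" using \<Phi>b unfolding N_def by linarith
    then show "real N + 1 \<le> p * (b - a) + q * kin \<gamma> a b + 2" by (simp add: \<Phi>_def)
  qed simp
  finally show "real (card ((\<lambda>s. cube_of (\<gamma> s)) ` {a..b})) \<le> 3 ^ CARD('n) * (p * (b - a) + q * kin \<gamma> a b + 2)" .
qed

end

section \<open>The value function in a fixed environment\<close>

context lagrangian
begin

text \<open>The constants are explicit because they may depend on \<open>K\<close>, \<open>\<delta>\<close> and the growth rate of \<open>g\<close> only.\<close>

definition c0 :: "real \<Rightarrow> real" where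
  "c0 C = (SOME c. c \<ge> 0 \<and> (\<forall>z. 2 * C * norm z \<le> K z + c))"

lemma c0: "c0 C \<ge> 0" "2 * C * norm z \<le> K z + c0 C"
  using someI_ex[OF K_superlinear[of "2 * C"]] unfolding c0_def by auto

definition pc :: "real \<Rightarrow> real" where "pc C = c0 C / (2 * C)"
definition qc :: "real \<Rightarrow> real" where "qc C = 1 / (2 * C)"

lemma pq: "C > 0 \<Longrightarrow> norm z \<le> pc C + qc C * K z"
  using c0(2)[of C z] by (simp add: pc_def qc_def field_simps)

lemma pq_nonneg: "C > 0 \<Longrightarrow> 0 \<le> pc C" "C > 0 \<Longrightarrow> 0 \<le> qc C"
  using c0(1)[of C] by (auto simp: pc_def qc_def)

text \<open>Kinetic energy per unit of time of a nearly optimal path, found by comparing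
  \<open>payoff_le\<close> with the payoff of resting at \<open>x\<close>.\<close>

definition ca :: "real \<Rightarrow> real" where "ca C = 2 * C + c0 C + 2 * \<delta> + 2"

text \<open>A speed sufficient to cover in time 2 * m the displacement of a piece of duration 4 * m
  and kinetic energy at most 8 * \<open>ca C\<close> * m.\<close>

definition vshift :: "real \<Rightarrow> real" where "vshift C = 2 * pc C + 4 * qc C * ca C"

definition cshift :: "real \<Rightarrow> real" where
  "cshift C = 1 + 2 * KM (vshift C) + 2 * \<delta> + 2 * vel"

definition cflip :: real where "cflip = 1 + 4 * vel"

definition cvisit :: real where
  "cvisit = 1 + 2 * \<delta> + cflip * 3 ^ CARD('n) * (3 + 2 * vel)"

end

text \<open>\<open>G\<close> stands for g - g x and \<open>Dm\<close> for the set where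
  \<open>g\<close> is finite. Subtracting g x leaves \<open>C1\<close> as the only trace of the
  payoff in the constants.\<close>

locale value_fun = lagrangian K \<delta> for K :: "real^'n \<Rightarrow> real" and \<delta> :: real +
  fixes C1 :: real and x :: "real^'n" and Dm :: "(real^'n) set" and G :: "real^'n \<Rightarrow> real" and t :: real
  assumes C1_pos: "C1 > 0" and x_Dm: "x \<in> Dm" and G_x: "G x = 0"
    and G_le: "y \<in> Dm \<Longrightarrow> G y \<le> C1 * (1 + norm (y - x))" and t_ge: "t \<ge> 1"
begin

text \<open>The value function up to the additive constant g x - a * t, see \<open>u_val_eq\<close>;
  this constant is deterministic and does not affect the variance.\<close>

definition U :: "(int^'n) set \<Rightarrow> real" where
  "U S = Sup {G y - A | y A. y \<in> Dm \<and> reach S t x y A}"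

text \<open>The slope 2 * C in \<open>c0\<close> lets the growth of \<open>G\<close> consume only
  half of the action; the remaining half bounds the cost of nearly optimal paths.\<close>

lemma payoff_le:
  assumes "y \<in> Dm" "reach S t x y A"
  shows "G y - A \<le> C1 + c0 C1 * t / 2 - A / 2"
proof -
  obtain \<gamma> L where g: "L-lipschitz_on {0..t} \<gamma>" "\<gamma> 0 = x" "\<gamma> t = y"
     "kin \<gamma> 0 t + \<delta> * tim S \<gamma> 0 t \<le> A"
    using assms(2) unfolding reach_def by auto
  have "norm (\<gamma> t - \<gamma> 0) \<le> pc C1 * (t - 0) + qc C1 * kin \<gamma> 0 t"
    by (rule displacement_le[OF g(1)]) (use t_ge pq C1_pos in auto)
  also have "kin \<gamma> 0 t \<le> A" using g(4) \<delta>_pos tim_nonneg[of S \<gamma> 0 t] by (smt (verit) mult_nonneg_nonneg)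
  finally have n: "norm (y - x) \<le> pc C1 * t + qc C1 * A"
    using pq_nonneg(2)[OF C1_pos] g by (simp add: mult_left_mono)
  have "G y \<le> C1 + C1 * norm (y - x)" using G_le[OF assms(1)] by (simp add: algebra_simps)
  also have "C1 * norm (y - x) \<le> C1 * (pc C1 * t + qc C1 * A)" using n C1_pos by (intro mult_left_mono) auto
  also have "\<dots> = c0 C1 * t / 2 + A / 2" using C1_pos by (simp add: pc_def qc_def field_simps)
  finally show ?thesis by simp
qed

lemma reach_cost_nonneg: "reach S T y z A \<Longrightarrow> 0 \<le> A"
  unfolding reach_def using kin_nonneg tim_nonneg \<delta>_pos by (smt (verit) mult_nonneg_nonneg)

lemma payoff_bdd: "bdd_above {G y - A | y A. y \<in> Dm \<and> reach S t x y A}"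
proof (rule bdd_aboveI[of _ "C1 + c0 C1 * t / 2"])
  fix v assume "v \<in> {G y - A | y A. y \<in> Dm \<and> reach S t x y A}"
  then obtain y A where "v = G y - A" "y \<in> Dm" "reach S t x y A" by auto
  then show "v \<le> C1 + c0 C1 * t / 2" using payoff_le[of y S A] reach_cost_nonneg[of S t x y A] by simp
qed

lemma payoff_le_U: "y \<in> Dm \<Longrightarrow> reach S t x y A \<Longrightarrow> G y - A \<le> U S"
  unfolding U_def by (rule cSup_upper[OF _ payoff_bdd]) auto

lemma U_ge: "- \<delta> * t \<le> U S"
  using payoff_le_U[OF x_Dm reach_rest(1)[of t S x]] t_ge G_x by simp

lemma payoff_nonempty: "{G y - A | y A. y \<in> Dm \<and> reach S t x y A} \<noteq> {}"
  using x_Dm reach_rest(1)[of t S x] t_ge by auto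

lemma U_le: "U S \<le> C1 + c0 C1 * t / 2"
  unfolding U_def
proof (rule cSup_least[OF payoff_nonempty])
  fix v assume "v \<in> {G y - A | y A. y \<in> Dm \<and> reach S t x y A}"
  then obtain y A where "v = G y - A" "y \<in> Dm" "reach S t x y A" by auto
  then show "v \<le> C1 + c0 C1 * t / 2" using payoff_le[of y S A] reach_cost_nonneg[of S t x y A] by simp
qed

lemma U_abs_le: "\<bar>U S\<bar> \<le> (C1 + c0 C1 + \<delta>) * t"
proof -
  have "C1 * 1 \<le> C1 * t" "0 \<le> c0 C1 * t" "0 \<le> C1 * t" "0 \<le> \<delta> * t"
    using C1_pos t_ge c0(1)[of C1] \<delta>_pos by auto
  moreover have "(C1 + c0 C1 + \<delta>) * t = C1 * t + c0 C1 * t + \<delta> * t" by (simp add: algebra_simps)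
  moreover have "c0 C1 * t / 2 \<le> c0 C1 * t" using \<open>0 \<le> c0 C1 * t\<close> by linarith
  ultimately show ?thesis using U_ge[of S] U_le[of S] unfolding abs_le_iff by linarith
qed

lemma U_antimono:
  assumes "S \<subseteq> S'"
  shows "U S' \<le> U S"
  unfolding U_def
  by (rule cSup_subset_mono[OF payoff_nonempty payoff_bdd]) (use reach_antimono assms in blast)

text \<open>Optimality up to \<epsilon> makes it unnecessary to know that the supremum is attained.
  The bound on the kinetic energy is part of the notion because it is needed to find a cheap piece
  of the path and to confine the path to a bounded region.\<close>

definition nearopt :: "(int^'n) set \<Rightarrow> real \<Rightarrow> (real \<Rightarrow> real^'n) \<Rightarrow> bool" where
  "nearopt S \<epsilon> \<gamma> \<longleftrightarrow> (\<exists>L. L-lipschitz_on {0..t} \<gamma>) \<and> \<gamma> 0 = x \<and> \<gamma> t \<in> Dm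
     \<and> U S - \<epsilon> \<le> G (\<gamma> t) - (kin \<gamma> 0 t + \<delta> * tim S \<gamma> 0 t) \<and> kin \<gamma> 0 t \<le> ca C1 * t"

lemma nearopt_exists:
  assumes "0 < \<epsilon>" "\<epsilon> \<le> 1"
  shows "\<exists>\<gamma>. nearopt S \<epsilon> \<gamma>"
proof -
  have "U S - \<epsilon> < Sup {G y - A | y A. y \<in> Dm \<and> reach S t x y A}" using assms by (simp add: U_def)
  then obtain y A where y: "y \<in> Dm" "reach S t x y A" "U S - \<epsilon> < G y - A"
    using less_cSupE[OF _ payoff_nonempty] by blast
  then obtain \<gamma> L where g: "L-lipschitz_on {0..t} \<gamma>" "\<gamma> 0 = x" "\<gamma> t = y"
     "kin \<gamma> 0 t + \<delta> * tim S \<gamma> 0 t \<le> A"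
    unfolding reach_def by auto
  have "kin \<gamma> 0 t \<le> A" using g(4) \<delta>_pos tim_nonneg[of S \<gamma> 0 t] by (smt (verit) mult_nonneg_nonneg)
  moreover have "A \<le> ca C1 * t"
  proof -
    have "- \<delta> * t - 1 \<le> C1 + c0 C1 * t / 2 - A / 2"
      using payoff_le[OF y(1,2)] y(3) U_ge[of S] assms by linarith
    then have "A \<le> 2 * C1 + c0 C1 * t + 2 * \<delta> * t + 2" by simp
    also have "\<dots> \<le> 2 * C1 * t + c0 C1 * t + 2 * \<delta> * t + 2 * t"
    proof -
      have "2 * C1 * 1 \<le> 2 * C1 * t" using C1_pos t_ge by (intro mult_left_mono) auto
      then show ?thesis using t_ge by linarith
    qed
    also have "\<dots> = ca C1 * t" by (simp add: ca_def algebra_simps)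
    finally show ?thesis .
  qed
  ultimately have "nearopt S \<epsilon> \<gamma>" unfolding nearopt_def using g y by auto
  then show ?thesis by blast
qed

text \<open>The same path is a competitor in the raised environment, where it pays in addition only
  for its time in \<open>k\<close>.\<close>

lemma flip_le_time:
  assumes "nearopt S \<epsilon> \<gamma>" "k \<notin> S"
  shows "U S - U (insert k S) \<le> \<epsilon> + \<delta> * tim {k} \<gamma> 0 t"
proof -
  obtain L where lip: "L-lipschitz_on {0..t} \<gamma>" using assms unfolding nearopt_def by auto
  have cont: "continuous_on {0..t} \<gamma>" by (rule lipschitz_on_continuous_on[OF lip])
  have "reach (insert k S) t (\<gamma> 0) (\<gamma> t) (kin \<gamma> 0 t + \<delta> * tim S \<gamma> 0 t + \<delta> * tim {k} \<gamma> 0 t)"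
    using reach_sub[OF lip, of 0 t "insert k S"] t_ge tim_insert[OF cont, of 0 t k S] assms
    by (simp add: algebra_simps)
  then have "G (\<gamma> t) - (kin \<gamma> 0 t + \<delta> * tim S \<gamma> 0 t + \<delta> * tim {k} \<gamma> 0 t) \<le> U (insert k S)"
    using assms(1) by (intro payoff_le_U) (auto simp: nearopt_def)
  then show ?thesis using assms(1) unfolding nearopt_def by linarith
qed

text \<open>One path serves all sites simultaneously, so the times add up instead of being maximised
  site by site. The tolerance 1 / (1 + card B) keeps the accumulated error below 1.\<close>

lemma sum_flip_le_time:
  assumes B: "finite B" and near: "nearopt S (1 / (1 + real (card B))) \<gamma>"
  shows "(\<Sum>k\<in>B - S. U S - U (insert k S)) \<le> 1 + \<delta> * tim (B - S) \<gamma> 0 t"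
proof -
  obtain L where lip: "L-lipschitz_on {0..t} \<gamma>" using near unfolding nearopt_def by auto
  have cont: "continuous_on {0..t} \<gamma>" by (rule lipschitz_on_continuous_on[OF lip])
  have "(\<Sum>k\<in>B - S. U S - U (insert k S)) \<le> (\<Sum>k\<in>B - S. 1 / (1 + real (card B)) + \<delta> * tim {k} \<gamma> 0 t)"
    by (intro sum_mono flip_le_time near) auto
  also have "\<dots> = real (card (B - S)) * (1 / (1 + real (card B))) + \<delta> * tim (B - S) \<gamma> 0 t"
    using tim_sum[OF cont, of 0 t "B - S"] B by (simp add: sum.distrib sum_distrib_left[symmetric])
  also have "real (card (B - S)) * (1 / (1 + real (card B))) \<le> 1"
  proof -
    have "card (B - S) \<le> card B" using B by (intro card_mono) auto
    then show ?thesis by (simp add: field_simps)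
  qed
  finally show ?thesis by simp
qed

lemma sum_flip_le:
  assumes B: "finite B"
  shows "(\<Sum>k\<in>B - S. U S - U (insert k S)) \<le> (1 + \<delta>) * t"
proof -
  obtain \<gamma> where near: "nearopt S (1 / (1 + real (card B))) \<gamma>"
    using nearopt_exists[of "1 / (1 + real (card B))" S] by (auto simp: field_simps)
  obtain L where lip: "L-lipschitz_on {0..t} \<gamma>" using near unfolding nearopt_def by auto
  have "tim (B - S) \<gamma> 0 t \<le> t - 0"
    by (rule tim_le[OF lipschitz_on_continuous_on[OF lip]]) (use t_ge in auto)
  then have "\<delta> * tim (B - S) \<gamma> 0 t \<le> \<delta> * t" using \<delta>_pos by simp
  then show ?thesis using sum_flip_le_time[OF B near] t_ge by (simp add: algebra_simps)
qed

text \<open>\<open>cut_cube\<close> saves the time t - T for additional action \<open>vel\<close>.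
  The saved time is spent at the start, on a trip from \<open>x\<close> to an \<open>a\<close>-site
  of a ray and back. The ray is chosen to avoid \<open>k\<close>, because raising \<open>k\<close>
  must not destroy that site.\<close>

lemma flip_le:
  assumes k: "k \<notin> S" and n: "t \<le> real n"
  shows "U S - U (insert k S) \<le> cflip * (1 + lead n (ray1 (cube_of x)) S + lead n (ray2 (cube_of x)) S)"
proof -
  let ?R = "lead n (ray1 (cube_of x)) S + lead n (ray2 (cube_of x)) S"
  have ray1_k: "ray1 (cube_of x) i \<noteq> ray2 (cube_of x) j" for i j
    by (simp add: ray1_def ray2_def axis_eq_axis)
  obtain f where f: "f = ray1 (cube_of x) \<or> f = ray2 (cube_of x)" "\<And>j. f j \<noteq> k"
    using ray1_k by metis
  have fR: "lead n f S \<le> ?R" using f(1) lead_nonneg[of n] by auto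
  have cf: "cflip * (1 + ?R) = (1 + ?R) + 4 * vel * (1 + ?R)" by (simp add: cflip_def algebra_simps)
  have R0: "?R \<ge> 0" by (intro add_nonneg_nonneg lead_nonneg)
  show ?thesis
  \<comment> \<open>A ray whose first n sites contain no \<open>a\<close>-site has
    \<open>lead\<close> equal to n \<ge> t, and then the bound by the total time is good
    enough.\<close>
  proof (cases "lead n f S = real n")
    case True
    have "U S - U (insert k S) \<le> (1 + \<delta>) * t"
      using sum_flip_le[of "{k}" S] k by (simp add: insert_Diff_if)
    also have "\<dots> \<le> (1 + \<delta>) * (1 + ?R)" using fR True n \<delta>_pos by (intro mult_left_mono) auto
    also have "\<dots> \<le> cflip * (1 + ?R)" using vel_ge R0 by (intro mult_right_mono) (auto simp: cflip_def)
    finally show ?thesis by (simp add: add.assoc)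
  next
    case False
    then obtain j where j: "j < n" "f j \<notin> S" "real j \<le> lead n f S" using lead_first[of n f S] by auto
    obtain z where z: "cube_of z = f j" "norm (z - x) \<le> real CARD('n) * (real j + 1)"
    proof -
      have n: "norm (axis undefined c :: real^'n) \<le> real CARD('n) * (real j + 1)" if "\<bar>c\<bar> \<le> real j + 1" for c
        by (rule norm_le_card_mult) (use that in \<open>auto simp: axis_def\<close>)
      from f(1) show ?thesis
      proof
        assume f1: "f = ray1 (cube_of x)"
        show ?thesis
          by (rule that[of "x + axis undefined (real j)"])
             (use n[of "real j"] in \<open>auto simp: f1 ray1_def cube_of_def vec_eq_iff axis_def\<close>)
      next
        assume f2: "f = ray2 (cube_of x)"
        have "cube_of (x + axis undefined (- 1 - real j)) = f j"
          unfolding f2 ray2_def cube_of_def vec_eq_iff axis_def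
          using floor_add_int[of "x $ undefined" "- 1 - int j"] by auto
        then show ?thesis using n[of "- 1 - real j"] by (intro that[of "x + axis undefined (- 1 - real j)"]) auto
      qed
    qed
    \<comment> \<open>\<open>?q\<close> is a sufficient travel time from \<open>x\<close> to
      \<open>z\<close>; it is j + 1 rather than j because \<open>ray2\<close> starts at offset
      -1.\<close>
    let ?S = "insert k S" and ?q = "real j + 1"
    have zS: "cube_of z \<notin> ?S" using z j f by auto
    have go: "reach ?S ?q x z (?q * vel)" "reach ?S ?q z x (?q * vel)"
      using z(2) by (auto intro!: reach_line_box simp: norm_minus_commute)
    obtain \<gamma> where near: "nearopt S 1 \<gamma>" using nearopt_exists[of 1 S] by auto
    obtain L where lip: "L-lipschitz_on {0..t} \<gamma>" using near unfolding nearopt_def by auto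
    let ?A = "kin \<gamma> 0 t + \<delta> * tim S \<gamma> 0 t"
    obtain T where T: "0 \<le> T" "T \<le> t" "reach ?S T (\<gamma> 0) (\<gamma> t) (?A + vel)"
      using cut_cube[OF lip _ k] t_ge by auto
    have x0: "\<gamma> 0 = x" using near by (simp add: nearopt_def)
    \<comment> \<open>When the saved time is too short for the round trip, resting at
      \<open>x\<close> costs at most \<delta> * (t - T) \<le> \<open>vel\<close> * (2 * ?q).\<close>
    have wait: "reach ?S (t - T) x x (2 * ?q * vel)"
    proof (cases "t - T \<ge> 2 * ?q")
      case True
      have "reach ?S (?q + (t - T - 2 * ?q) + ?q) x x (?q * vel + 0 + ?q * vel)"
        by (intro reach_concat[OF reach_concat[OF go(1) reach_rest(2)] go(2)]) (use zS True in auto)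
      then show ?thesis by (simp add: algebra_simps)
    next
      case False
      have "\<delta> * (t - T) \<le> vel * (2 * ?q)" using False T vel_ge \<delta>_pos by (intro mult_mono) auto
      then show ?thesis using T by (intro reach_mono[OF reach_rest(1)]) (auto simp: algebra_simps)
    qed
    have "reach ?S (t - T + T) x (\<gamma> t) (2 * ?q * vel + (?A + vel))"
      by (rule reach_concat[OF wait T(3)[unfolded x0]])
    then have "G (\<gamma> t) - (2 * ?q * vel + (?A + vel)) \<le> U ?S"
      using near by (intro payoff_le_U) (auto simp: nearopt_def)
    moreover have "U S - 1 \<le> G (\<gamma> t) - ?A" using near by (simp add: nearopt_def)
    ultimately have "U S - U ?S \<le> 1 + vel + 2 * ?q * vel" by linarith
    also have "\<dots> \<le> 1 + vel + 2 * (?R + 1) * vel" using j fR vel_ge by (intro add_left_mono mult_right_mono) auto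
    also have "\<dots> \<le> cflip * (1 + ?R)"
      using R0 vel_ge mult_nonneg_nonneg[of ?R vel] unfolding cf by (simp add: algebra_simps)
    finally show ?thesis by (simp add: add.assoc)
  qed
qed

text \<open>Pigeonhole over consecutive blocks of length 4 * m. Rounding t / h down loses at most a
  factor 2, so some block carries at most twice the average 4 * c * m. The length is 4 * m because
  running such a piece at double speed saves 2 * m, the time of two translations whose coordinates
  are at most m.\<close>

lemma cheap_interval:
  assumes lip: "L-lipschitz_on {0..t} \<gamma>" and m: "1 \<le> m" "8 * real m \<le> t" and kin: "kin \<gamma> 0 t \<le> c * t"
  shows "\<exists>s. 0 \<le> s \<and> s + 4 * real m \<le> t \<and> kin \<gamma> s (s + 4 * real m) \<le> 8 * c * real m"
proof -
  define h where "h = 4 * real m"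
  define N where "N = nat \<lfloor>t / h\<rfloor>"
  have h: "h > 0" using m by (simp add: h_def)
  have th: "2 \<le> t / h" using m h by (simp add: h_def field_simps)
  then have N1: "t / h \<le> 2 * real N" and N2: "real N \<le> t / h" unfolding N_def by linarith+
  have N0: "N > 0" using N1 th by (cases N) auto
  have Nh: "real N * h \<le> t" using N2 h by (simp add: field_simps)
  have tele: "(\<Sum>i<n. kin \<gamma> (real i * h) (real i * h + h)) = kin \<gamma> 0 (real n * h)" if "n \<le> N" for n
    using that
  proof (induction n)
    case 0
    then show ?case by (simp add: kin_def)
  next
    case (Suc n)
    have "real (Suc n) * h \<le> real N * h" using Suc.prems h by (intro mult_right_mono) auto
    then have "kin \<gamma> 0 (real n * h + h) = kin \<gamma> 0 (real n * h) + kin \<gamma> (real n * h) (real n * h + h)"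
      using Nh h by (intro kin_combine[OF lip]) (auto simp: algebra_simps)
    then show ?case using Suc by (simp add: algebra_simps)
  qed
  have "\<exists>i<N. kin \<gamma> (real i * h) (real i * h + h) \<le> c * t / real N"
  proof (rule ccontr)
    assume "\<not> ?thesis"
    then have "(\<Sum>i<N. c * t / real N) < (\<Sum>i<N. kin \<gamma> (real i * h) (real i * h + h))"
      using N0 by (intro sum_strict_mono) auto
    then have "c * t < kin \<gamma> 0 (real N * h)" using tele[of N] N0 by simp
    moreover have "kin \<gamma> 0 t = kin \<gamma> 0 (real N * h) + kin \<gamma> (real N * h) t"
      using Nh h by (intro kin_combine[OF lip]) auto
    ultimately show False using kin kin_nonneg[of \<gamma> "real N * h" t] by linarith
  qed
  then obtain i where i: "i < N" "kin \<gamma> (real i * h) (real i * h + h) \<le> c * t / real N" by auto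
  have c: "0 \<le> c"
  proof -
    have "0 \<le> c * t" using kin kin_nonneg[of \<gamma> 0 t] by linarith
    then show ?thesis using t_ge by (simp add: zero_le_mult_iff)
  qed
  have "c * t / real N \<le> 8 * c * real m"
  proof -
    have "t \<le> 2 * real N * h" using N1 h by (simp add: field_simps)
    then have "c * t \<le> c * (2 * real N * h)" using c by (intro mult_left_mono)
    then show ?thesis using N0 by (simp add: h_def field_simps)
  qed
  moreover have "real i * h + h \<le> t"
  proof -
    have "real (Suc i) * h \<le> real N * h" using i h by (intro mult_right_mono) auto
    then show ?thesis using Nh by (simp add: algebra_simps)
  qed
  ultimately show ?thesis using i h unfolding h_def by (intro exI[of _ "real i * (4 * real m)"]) auto
qed

text \<open>The time needed for the two translations by \<open>z\<close> is gained on a cheap piece of the path, which is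
  traversed twice as fast.\<close>

lemma shift_ge:
  assumes m: "1 \<le> m" "8 * real m \<le> t" and z: "\<And>i. \<bar>z $ i\<bar> \<le> int m"
  shows "U S - cshift C1 * real m \<le> U (shift z S)"
proof -
  obtain \<gamma> where near: "nearopt S 1 \<gamma>" using nearopt_exists[of 1 S] by auto
  obtain L where lip: "L-lipschitz_on {0..t} \<gamma>" using near unfolding nearopt_def by auto
  have cont: "continuous_on {0..t} \<gamma>" by (rule lipschitz_on_continuous_on[OF lip])
  let ?m = "real m"
  obtain s where s: "0 \<le> s" "s + 4 * ?m \<le> t" "kin \<gamma> s (s + 4 * ?m) \<le> 8 * ca C1 * ?m"
    using cheap_interval[OF lip m, of "ca C1"] near by (auto simp: nearopt_def)
  let ?r = "s + 4 * ?m"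
  have "norm (\<gamma> ?r - \<gamma> s) \<le> pc C1 * (?r - s) + qc C1 * kin \<gamma> s ?r"
    by (rule displacement_le[OF lip]) (use s pq C1_pos in auto)
  also have "\<dots> \<le> pc C1 * (?r - s) + qc C1 * (8 * ca C1 * ?m)"
    using s pq_nonneg C1_pos by (intro add_left_mono mult_left_mono) auto
  also have "\<dots> = vshift C1 * (2 * ?m)" by (simp add: vshift_def algebra_simps)
  finally have mid: "reach S (2 * ?m) (\<gamma> s) (\<gamma> ?r) (2 * ?m * (KM (vshift C1) + \<delta>))"
    by (intro reach_line) auto
  have r1: "reach S (s - 0) (\<gamma> 0) (\<gamma> s) (kin \<gamma> 0 s + \<delta> * tim S \<gamma> 0 s)"
    by (rule reach_sub[OF lip]) (use s in auto)
  have r3: "reach S (t - ?r) (\<gamma> ?r) (\<gamma> t) (kin \<gamma> ?r t + \<delta> * tim S \<gamma> ?r t)"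
    by (rule reach_sub[OF lip]) (use s in auto)
  have "norm (rvec z) \<le> real CARD('n) * ?m"
  proof (rule norm_le_card_mult)
    fix i
    have "real_of_int \<bar>z $ i\<bar> \<le> real_of_int (int m)" using z[of i] by (simp only: of_int_le_iff)
    then show "\<bar>rvec z $ i\<bar> \<le> ?m" by (simp add: rvec_def)
  qed
  \<comment> \<open>In the environment \<open>S\<close> the new path joins the translates of both
    endpoints by \<open>z\<close>; \<open>reach_translate\<close> carries it back to the original
    endpoints, now in the environment \<open>shift z S\<close>.\<close>
  then have rin: "reach S ?m (\<gamma> 0 + rvec z) (\<gamma> 0) (?m * vel)" and rout: "reach S ?m (\<gamma> t) (\<gamma> t + rvec z) (?m * vel)"
    by (auto intro!: reach_line_box)
  let ?A = "kin \<gamma> 0 t + \<delta> * tim S \<gamma> 0 t"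
  let ?B = "?m * vel + (kin \<gamma> 0 s + \<delta> * tim S \<gamma> 0 s) + 2 * ?m * (KM (vshift C1) + \<delta>)
      + (kin \<gamma> ?r t + \<delta> * tim S \<gamma> ?r t) + ?m * vel"
  have "reach S (?m + (s - 0) + 2 * ?m + (t - ?r) + ?m) (\<gamma> 0 + rvec z) (\<gamma> t + rvec z) ?B"
    by (rule reach_concat[OF reach_concat[OF reach_concat[OF reach_concat[OF rin r1] mid] r3] rout])
  moreover have "?m + (s - 0) + 2 * ?m + (t - ?r) + ?m = t" by simp
  ultimately have "reach (shift z S) t (\<gamma> 0) (\<gamma> t) ?B" using reach_translate by simp
  then have 1: "G (\<gamma> t) - ?B \<le> U (shift z S)"
    using near by (intro payoff_le_U) (auto simp: nearopt_def)
  have "kin \<gamma> 0 t = kin \<gamma> 0 s + kin \<gamma> s t" "kin \<gamma> s t = kin \<gamma> s ?r + kin \<gamma> ?r t"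
    "tim S \<gamma> 0 t = tim S \<gamma> 0 s + tim S \<gamma> s t" "tim S \<gamma> s t = tim S \<gamma> s ?r + tim S \<gamma> ?r t"
    using s m by (auto intro!: kin_combine[OF lip] tim_combine[OF cont])
  then have "?A = (kin \<gamma> 0 s + \<delta> * tim S \<gamma> 0 s) + (kin \<gamma> ?r t + \<delta> * tim S \<gamma> ?r t)
       + (kin \<gamma> s ?r + \<delta> * tim S \<gamma> s ?r)"
    by (simp add: algebra_simps)
  moreover have "0 \<le> kin \<gamma> s ?r + \<delta> * tim S \<gamma> s ?r"
    using kin_nonneg[of \<gamma> s ?r] tim_nonneg[of S \<gamma> s ?r] \<delta>_pos by simp
  ultimately have "?B \<le> ?A + 2 * ?m * (KM (vshift C1) + \<delta>) + 2 * (?m * vel)" by linarith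
  moreover have "U S - 1 \<le> G (\<gamma> t) - ?A" using near by (simp add: nearopt_def)
  ultimately have "U S - 1 - (2 * ?m * (KM (vshift C1) + \<delta>) + 2 * (?m * vel)) \<le> U (shift z S)"
    using 1 by linarith
  moreover have "1 + (2 * ?m * (KM (vshift C1) + \<delta>) + 2 * (?m * vel)) \<le> cshift C1 * ?m"
    using m by (simp add: cshift_def algebra_simps)
  ultimately show ?thesis by linarith
qed

text \<open>A nearly optimal path that meets an \<open>a\<close>-site of the box spends only kinetic energy \<open>O(m)\<close> between its
  first and last visit to the box, since it could rest at that site instead.\<close>

lemma sum_flip_box_le:
  assumes m: "1 \<le> m" and n: "t \<le> real n" and lm: "0 \<le> \<theta>" "0 \<le> \<mu>"
    and K: "\<And>z. norm z \<le> \<theta> + \<mu> * K z"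
  shows "(\<Sum>k\<in>ibox p m - S. U S - U (insert k S))
    \<le> cvisit * (1 + lead n (ray1 (cube_of x)) S + lead n (ray2 (cube_of x)) S) * (real m + \<theta> * t + \<mu> * real m)"
proof -
  let ?B = "ibox p m" and ?R = "lead n (ray1 (cube_of x)) S + lead n (ray2 (cube_of x)) S"
  let ?\<epsilon> = "1 / (1 + real (card ?B))" and ?W = "real m + \<theta> * t + \<mu> * real m"
  have R0: "?R \<ge> 0" by (intro add_nonneg_nonneg lead_nonneg)
  have W: "?W \<ge> real m" "?W \<ge> 1" using m lm t_ge by (auto simp: add_nonneg_nonneg add_increasing2)
  have cf: "0 \<le> cflip" using vel_ge by (simp add: cflip_def)
  have cb: "cvisit \<ge> 1 + 2 * \<delta>" using vel_ge cf by (simp add: cvisit_def)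
  \<comment> \<open>Covers the two cases without a long stay: no \<open>a\<close>-site of the box is
    met, or the first and last visits are less than 2 * m apart.\<close>
  have easy: "v \<le> cvisit * (1 + ?R) * ?W" if "v \<le> 1 + 2 * \<delta> * real m" for v
  proof -
    have "1 + 2 * \<delta> * real m \<le> (1 + 2 * \<delta>) * real m" using m by (simp add: algebra_simps)
    also have "\<dots> \<le> cvisit * 1 * ?W" using cb \<delta>_pos W by (simp add: mult_mono)
    also have "\<dots> \<le> cvisit * (1 + ?R) * ?W" using cb \<delta>_pos W R0 by (intro mult_right_mono mult_left_mono) auto
    finally show ?thesis using that by linarith
  qed
  obtain \<gamma> where near: "nearopt S ?\<epsilon> \<gamma>"
    using nearopt_exists[of ?\<epsilon> S] by (auto simp: field_simps)
  obtain L where lip: "L-lipschitz_on {0..t} \<gamma>" using near unfolding nearopt_def by auto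
  have cont: "continuous_on {0..t} \<gamma>" by (rule lipschitz_on_continuous_on[OF lip])
  note sft = sum_flip_le_time[OF finite_ibox near]
  define C where "C = {v :: real^'n. \<forall>i. real_of_int (p $ i) \<le> v $ i \<and> v $ i \<le> real_of_int (p $ i) + real m}"
  have inC: "\<gamma> r \<in> C" if "cube_of (\<gamma> r) \<in> ?B" for r
    using cube_of_in_cube[OF that] by (simp add: C_def)
  show ?thesis
  proof (cases "\<exists>s\<in>{0..t}. cube_of (\<gamma> s) \<in> ?B - S")
    case False
    then have "tim (?B - S) \<gamma> 0 t = tim {} \<gamma> 0 t" by (intro tim_cong) auto
    then have "(\<Sum>k\<in>?B - S. U S - U (insert k S)) \<le> 1 + 2 * \<delta> * real m"
      using sft \<delta>_pos by (simp add: tim_def add_increasing2)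
    from easy[OF this] show ?thesis by (simp add: add.assoc)
  next
    case True
    then obtain s where s: "s \<in> {0..t}" "cube_of (\<gamma> s) \<in> ?B" "cube_of (\<gamma> s) \<notin> S" by auto
    have "closed C" unfolding C_def by (rule closed_cube)
    then obtain s1 s2 where s12: "0 \<le> s1" "s1 \<le> s" "s \<le> s2" "s2 \<le> t" "\<gamma> s1 \<in> C" "\<gamma> s2 \<in> C"
      "\<And>r. r \<in> {0..t} \<Longrightarrow> \<gamma> r \<in> C \<Longrightarrow> s1 \<le> r \<and> r \<le> s2"
      using entry_exit_times[OF cont _ s(1) inC[OF s(2)], of thesis] by blast
    show ?thesis
    proof (cases "s2 - s1 < 2 * real m")
      case True
      have "tim (?B - S) \<gamma> 0 t = tim (?B - S) \<gamma> s1 s2"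
        by (rule tim_eq_subinterval[OF cont]) (use s12 inC in auto)
      also have "\<dots> \<le> s2 - s1" by (rule tim_le[OF cont]) (use s12 in auto)
      finally have "tim (?B - S) \<gamma> 0 t \<le> 2 * real m" using True by simp
      then have "\<delta> * tim (?B - S) \<gamma> 0 t \<le> \<delta> * (2 * real m)" using \<delta>_pos by (intro mult_left_mono) auto
      then have "(\<Sum>k\<in>?B - S. U S - U (insert k S)) \<le> 1 + 2 * \<delta> * real m" using sft by simp
      from easy[OF this] show ?thesis by (simp add: add.assoc)
    next
      case False
      let ?A = "kin \<gamma> 0 t + \<delta> * tim S \<gamma> 0 t"
      have r1: "reach S (s1 - 0) (\<gamma> 0) (\<gamma> s1) (kin \<gamma> 0 s1 + \<delta> * tim S \<gamma> 0 s1)"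
        by (rule reach_sub[OF lip]) (use s12 in auto)
      have r5: "reach S (t - s2) (\<gamma> s2) (\<gamma> t) (kin \<gamma> s2 t + \<delta> * tim S \<gamma> s2 t)"
        by (rule reach_sub[OF lip]) (use s12 in auto)
      have r2: "reach S (real m) (\<gamma> s1) (\<gamma> s) (real m * vel)" and r4: "reach S (real m) (\<gamma> s) (\<gamma> s2) (real m * vel)"
        using cube_diameter[of "\<gamma> s" p m "\<gamma> s1"] cube_diameter[of "\<gamma> s2" p m "\<gamma> s"] s12 inC[OF s(2)]
        by (auto intro!: reach_line_box simp: C_def)
      \<comment> \<open>The whole middle part is replaced by a trip to the \<open>a\<close>-site
        containing \<gamma> s, a free rest there, and the way out: cost 2 * m * \<open>vel\<close>
        for the box instead of its kinetic and potential energy.\<close>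
      have r3: "reach S (s2 - s1 - 2 * real m) (\<gamma> s) (\<gamma> s) 0"
        by (rule reach_rest(2)) (use False s in auto)
      let ?A' = "kin \<gamma> 0 s1 + \<delta> * tim S \<gamma> 0 s1 + real m * vel + 0 + real m * vel + (kin \<gamma> s2 t + \<delta> * tim S \<gamma> s2 t)"
      have "reach S (s1 - 0 + real m + (s2 - s1 - 2 * real m) + real m + (t - s2)) (\<gamma> 0) (\<gamma> t) ?A'"
        by (rule reach_concat[OF reach_concat[OF reach_concat[OF reach_concat[OF r1 r2] r3] r4] r5])
      moreover have "s1 - 0 + real m + (s2 - s1 - 2 * real m) + real m + (t - s2) = t" by simp
      ultimately have "reach S t x (\<gamma> t) ?A'" using near by (simp add: nearopt_def)
      then have "G (\<gamma> t) - ?A' \<le> U S" using near by (intro payoff_le_U) (auto simp: nearopt_def)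
      moreover have "U S - ?\<epsilon> \<le> G (\<gamma> t) - ?A" using near by (simp add: nearopt_def)
      ultimately have "?A \<le> ?A' + ?\<epsilon>" by linarith
      moreover have "?\<epsilon> \<le> 1" by simp
      moreover have "kin \<gamma> 0 t = kin \<gamma> 0 s1 + kin \<gamma> s1 t" "kin \<gamma> s1 t = kin \<gamma> s1 s2 + kin \<gamma> s2 t"
        "tim S \<gamma> 0 t = tim S \<gamma> 0 s1 + tim S \<gamma> s1 t" "tim S \<gamma> s1 t = tim S \<gamma> s1 s2 + tim S \<gamma> s2 t"
        using s12 by (auto intro!: kin_combine[OF lip] tim_combine[OF cont])
      then have "?A = (kin \<gamma> 0 s1 + \<delta> * tim S \<gamma> 0 s1) + (kin \<gamma> s2 t + \<delta> * tim S \<gamma> s2 t)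
          + kin \<gamma> s1 s2 + \<delta> * tim S \<gamma> s1 s2"
        by (simp add: algebra_simps)
      moreover have "0 \<le> \<delta> * tim S \<gamma> s1 s2" using tim_nonneg[of S \<gamma> s1 s2] \<delta>_pos by simp
      ultimately have kin12: "kin \<gamma> s1 s2 \<le> 2 * (real m * vel) + 1" by linarith
      define Vis where "Vis = (\<lambda>s. cube_of (\<gamma> s)) ` {s1..s2}"
      have lip12: "L-lipschitz_on {s1..s2} \<gamma>" by (rule lipschitz_on_subset[OF lip]) (use s12 in auto)
      have Vis: "finite Vis" "real (card Vis) \<le> 3 ^ CARD('n) * (\<theta> * (s2 - s1) + \<mu> * kin \<gamma> s1 s2 + 2)"
        unfolding Vis_def using card_visited_le[OF lip12 _ K lm] s12 by auto
      have cardVis: "real (card Vis) \<le> 3 ^ CARD('n) * (2 + 2 * vel) * ?W"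
      proof -
        have "\<theta> * (s2 - s1) \<le> \<theta> * t" using s12 lm by (intro mult_left_mono) auto
        moreover have "\<mu> * kin \<gamma> s1 s2 \<le> \<mu> * ((2 * vel + 1) * real m)"
          using kin12 m lm by (intro mult_left_mono) (auto simp: algebra_simps)
        ultimately have "\<theta> * (s2 - s1) + \<mu> * kin \<gamma> s1 s2 + 2 \<le> \<theta> * t + (2 * vel + 1) * (\<mu> * real m) + 2 * real m"
          using m by (simp add: algebra_simps)
        also have "\<dots> \<le> (2 + 2 * vel) * ?W"
        proof -
          have "0 \<le> (1 + 2 * vel) * (\<theta> * t)" "0 \<le> \<mu> * real m" "0 \<le> 2 * vel * real m"
            using vel_ge lm t_ge by auto
          moreover have "(2 + 2 * vel) * ?W = \<theta> * t + (2 * vel + 1) * (\<mu> * real m) + 2 * real m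
             + (1 + 2 * vel) * (\<theta> * t) + \<mu> * real m + 2 * vel * real m" by (simp add: algebra_simps)
          ultimately show ?thesis by linarith
        qed
        finally have "3 ^ CARD('n) * (\<theta> * (s2 - s1) + \<mu> * kin \<gamma> s1 s2 + 2) \<le> 3 ^ CARD('n) * ((2 + 2 * vel) * ?W)"
          by (intro mult_left_mono) auto
        then show ?thesis using Vis(2) unfolding mult.assoc by linarith
      qed
      have fB: "finite (?B - S)" using finite_ibox[of p m] by simp
      \<comment> \<open>Unvisited sites cost only the tolerance and visited ones are bounded by
        \<open>flip_le\<close>, so the number of visited cubes takes the place of the occupation
        time.\<close>
      have "(\<Sum>k\<in>?B - S. U S - U (insert k S)) \<le> (\<Sum>k\<in>?B - S. ?\<epsilon> + (if k \<in> Vis then cflip * (1 + ?R) else 0))"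
      proof (intro sum_mono)
        fix k assume k: "k \<in> ?B - S"
        show "U S - U (insert k S) \<le> ?\<epsilon> + (if k \<in> Vis then cflip * (1 + ?R) else 0)"
        proof (cases "k \<in> Vis")
          case True
          have "0 \<le> ?\<epsilon>" by simp
          moreover have "U S - U (insert k S) \<le> cflip * (1 + ?R)" using flip_le[of k S n] k n by (simp add: add.assoc)
          ultimately show ?thesis using True by (simp only: if_True)
        next
          case False
          have "cube_of (\<gamma> u) \<noteq> k" if "0 < u" "u < t" for u
            using s12(7)[of u] inC[of u] False k that by (auto simp: Vis_def)
          then have "tim {k} \<gamma> 0 t = tim {} \<gamma> 0 t" by (intro tim_cong) auto
          then show ?thesis using flip_le_time[OF near, of k] k False by (simp add: tim_def)
        qed
      qed
      also have "\<dots> = real (card (?B - S)) * ?\<epsilon> + real (card ((?B - S) \<inter> Vis)) * (cflip * (1 + ?R))"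
        using fB by (simp add: sum.distrib sum.If_cases Int_def)
      also have "real (card (?B - S)) * ?\<epsilon> \<le> 1"
      proof -
        have "card (?B - S) \<le> card ?B" using finite_ibox by (intro card_mono) auto
        then show ?thesis by (simp add: field_simps)
      qed
      also have "real (card ((?B - S) \<inter> Vis)) * (cflip * (1 + ?R)) \<le> 3 ^ CARD('n) * (2 + 2 * vel) * ?W * (cflip * (1 + ?R))"
      proof (rule mult_right_mono)
        have "card ((?B - S) \<inter> Vis) \<le> card Vis" using Vis by (intro card_mono) auto
        then show "real (card ((?B - S) \<inter> Vis)) \<le> 3 ^ CARD('n) * (2 + 2 * vel) * ?W" using cardVis by linarith
      qed (use cf R0 in auto)
      finally have "(\<Sum>k\<in>?B - S. U S - U (insert k S)) \<le> 1 + cflip * 3 ^ CARD('n) * (2 + 2 * vel) * ((1 + ?R) * ?W)"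
        by (simp add: algebra_simps)
      also have "\<dots> \<le> cvisit * ((1 + ?R) * ?W)"
      proof -
        have "1 * 1 \<le> (1 + ?R) * ?W" using R0 W by (intro mult_mono) auto
        moreover have "cflip * 3 ^ CARD('n) * (2 + 2 * vel) * ((1 + ?R) * ?W) \<le> cflip * 3 ^ CARD('n) * (3 + 2 * vel) * ((1 + ?R) * ?W)"
          using cf R0 W by (intro mult_right_mono mult_left_mono) auto
        moreover have "0 \<le> 2 * \<delta> * ((1 + ?R) * ?W)" using \<delta>_pos R0 W by simp
        ultimately show ?thesis by (simp add: cvisit_def distrib_right)
      qed
      finally show ?thesis by (simp add: add.assoc mult.assoc)
    qed
  qed
qed

text \<open>A nearly optimal path has kinetic energy at most \<open>ca C1\<close> * t, whatever the
  environment, and so stays within a fixed distance \<rho> of \<open>x\<close>. This reduces all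
  expectations to finite averages.\<close>

lemma U_local: "\<exists>\<Lambda>. finite \<Lambda> \<and> (\<forall>S S'. S \<inter> \<Lambda> = S' \<inter> \<Lambda> \<longrightarrow> U S = U S')"
proof -
  define \<rho> where "\<rho> = pc C1 * t + qc C1 * (ca C1 * t)"
  define \<Lambda> where "\<Lambda> = {k :: int^'n. \<forall>i. k $ i \<in> {\<lfloor>x $ i - \<rho>\<rfloor>..\<lfloor>x $ i + \<rho>\<rfloor>}}"
  have fin: "finite \<Lambda>" unfolding \<Lambda>_def by (rule finite_card_vec_box) simp
  have le: "U S \<le> U S'" if eq: "S \<inter> \<Lambda> = S' \<inter> \<Lambda>" for S S'
  proof (rule field_le_epsilon)
    fix e :: real assume e: "0 < e"
    let ?e = "min e 1"
    obtain \<gamma> where near: "nearopt S ?e \<gamma>" using nearopt_exists[of ?e S] e by auto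
    obtain L where lip: "L-lipschitz_on {0..t} \<gamma>" using near unfolding nearopt_def by auto
    have "cube_of (\<gamma> s) \<in> \<Lambda>" if s: "0 \<le> s" "s \<le> t" for s
    proof -
      have "norm (\<gamma> s - \<gamma> 0) \<le> pc C1 * (s - 0) + qc C1 * kin \<gamma> 0 s"
        by (rule displacement_le[OF lip]) (use s pq C1_pos in auto)
      also have "\<dots> \<le> \<rho>"
      proof -
        have "kin \<gamma> 0 t = kin \<gamma> 0 s + kin \<gamma> s t" using s by (intro kin_combine[OF lip]) auto
        then have "kin \<gamma> 0 s \<le> ca C1 * t" using near kin_nonneg[of \<gamma> s t] by (simp add: nearopt_def)
        then show ?thesis unfolding \<rho>_def using pq_nonneg[OF C1_pos] s
          by (intro add_mono mult_left_mono) auto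
      qed
      finally have n: "norm (\<gamma> s - x) \<le> \<rho>" using near by (simp add: nearopt_def)
      have "cube_of (\<gamma> s) $ i \<in> {\<lfloor>x $ i - \<rho>\<rfloor>..\<lfloor>x $ i + \<rho>\<rfloor>}" for i
      proof -
        have "\<bar>\<gamma> s $ i - x $ i\<bar> \<le> \<rho>" using n component_le_norm_cart[of "\<gamma> s - x" i] by simp
        then show ?thesis by (auto simp: cube_of_def intro!: floor_mono)
      qed
      then show ?thesis by (simp add: \<Lambda>_def)
    qed
    then have "cube_of (\<gamma> u) \<in> S' \<longleftrightarrow> cube_of (\<gamma> u) \<in> S" if "0 < u" "u < t" for u using eq that by force
    then have "tim S' \<gamma> 0 t = tim S \<gamma> 0 t" by (rule tim_cong)
    then have "reach S' t x (\<gamma> t) (kin \<gamma> 0 t + \<delta> * tim S \<gamma> 0 t)"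
      using reach_sub[OF lip, of 0 t S'] t_ge near by (simp add: nearopt_def)
    then have "G (\<gamma> t) - (kin \<gamma> 0 t + \<delta> * tim S \<gamma> 0 t) \<le> U S'"
      using near by (intro payoff_le_U) (auto simp: nearopt_def)
    then show "U S \<le> U S' + e" using near unfolding nearopt_def by linarith
  qed
  show ?thesis by (rule exI[of _ \<Lambda>]) (use fin le in \<open>auto intro: antisym\<close>)
qed

end

section \<open>Averaging over translations\<close>

context biased
begin

lemma Avg_local:
  assumes "finite L" "M \<subseteq> L" and loc: "\<And>S. f S = f (S \<inter> M)"
  shows "Avg L f = Avg M f"
proof -
  have "Avg (M \<union> N) f = Avg M f" if "finite N" "N \<inter> M = {}" for N
    using that
  proof (induction N rule: finite_induct)
    case (insert k N)
    have fM: "finite M" using assms finite_subset by auto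
    have "f (insert k S) = f S" for S
    proof -
      have "insert k S \<inter> M = S \<inter> M" using insert.prems by auto
      then show ?thesis using loc[of S] loc[of "insert k S"] by simp
    qed
    then have "Avg (insert k (M \<union> N)) f = Avg (M \<union> N) f"
      using insert fM by (subst Avg_insert) (auto simp: algebra_simps)
    then show ?case using insert by simp
  qed simp
  from this[of "L - M"] show ?thesis using assms by (simp add: Un_absorb1 Diff_Int_distrib2)
qed

lemma Avg_superset_indicator:
  assumes "finite L" "A \<subseteq> L"
  shows "Avg L (\<lambda>S. if A \<subseteq> S then 1 else 0) = (1 - \<alpha>) ^ card A"
proof -
  have fA: "finite A" using assms finite_subset by auto
  have "Avg L (\<lambda>S. if A \<subseteq> S then 1 else 0) = Avg A (\<lambda>S. if A \<subseteq> S then 1 else 0)"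
    by (rule Avg_local[OF assms]) auto
  also have "\<dots> = (\<Sum>S\<in>Pow A. if S = A then (1 - \<alpha>) ^ card A else 0)"
    unfolding Avg_def by (intro sum.cong) auto
  finally show ?thesis using fA by simp
qed

text \<open>The mean of a truncated geometric waiting time: the first j + 1 sites all lie in
  \<open>S\<close> with probability (1 - \<alpha>) ^ (j + 1).\<close>

lemma Avg_lead_le:
  assumes "finite L" "inj f" "f ` {..<n} \<subseteq> L"
  shows "Avg L (lead n f) \<le> 1 / \<alpha>"
proof -
  have "Avg L (lead n f) = (\<Sum>j<n. Avg L (\<lambda>S. if f ` {..j} \<subseteq> S then 1 else 0))"
    unfolding lead_def[abs_def] by (rule Avg_sum)
  also have "\<dots> = (\<Sum>j<n. (1 - \<alpha>) ^ Suc j)"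
  proof (intro sum.cong refl)
    fix j assume "j \<in> {..<n}"
    then have "f ` {..j} \<subseteq> L" using assms(3) by auto
    moreover have "card (f ` {..j}) = Suc j"
      using card_image[of f "{..j}"] assms(2) by (simp add: inj_on_subset)
    ultimately show "Avg L (\<lambda>S. if f ` {..j} \<subseteq> S then 1 else 0) = (1 - \<alpha>) ^ Suc j"
      using Avg_superset_indicator[OF assms(1), of "f ` {..j}"] by simp
  qed
  also have "\<dots> \<le> (\<Sum>j<n. (1 - \<alpha>) ^ j)"
    using \<alpha>_pos \<alpha>_lt1 by (intro sum_mono) (auto intro: mult_left_le_one_le)
  also have "\<dots> = (1 - (1 - \<alpha>) ^ n) / \<alpha>"
    using \<alpha>_pos by (simp add: sum_gp_strict)
  also have "\<dots> \<le> 1 / \<alpha>" using \<alpha>_pos \<alpha>_lt1 by (intro divide_right_mono) auto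
  finally show ?thesis .
qed

text \<open>\<open>dif k f\<close> ignores whether \<open>k\<close> belongs to \<open>S\<close>, so
  it may be averaged on the event that it does not, of probability \<alpha>. This matters because
  the pathwise estimates speak only of raising a site outside \<open>S\<close>.\<close>

lemma Avg_dif:
  assumes "finite L" "k \<in> L"
  shows "Avg L (\<lambda>S. \<phi> (dif k f S)) = (1 / \<alpha>) * Avg L (\<lambda>S. if k \<notin> S then \<phi> (f (insert k S) - f S) else 0)"
proof -
  define L' where "L' = L - {k}"
  have L': "finite L'" "k \<notin> L'" "L = insert k L'" using assms by (auto simp: L'_def)
  have "Avg L (\<lambda>S. if k \<notin> S then \<phi> (f (insert k S) - f S) else 0)
     = Avg L' (\<lambda>S. \<alpha> * \<phi> (f (insert k S) - f S))"
    unfolding L'(3) Avg_insert[OF L'(1,2)] by (intro Avg_cong) (use L' in auto)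
  then show ?thesis
    unfolding L'(3) Avg_dif_same[OF L'(1,2), where \<phi> = \<phi>] using \<alpha>_pos by (simp add: Avg_cmult)
qed

lemma sum_Avg_dif:
  assumes "finite L" "B \<subseteq> L"
  shows "(\<Sum>k\<in>B. Avg L (\<lambda>S. \<phi> (dif k f S))) = (1 / \<alpha>) * Avg L (\<lambda>S. \<Sum>k\<in>B - S. \<phi> (f (insert k S) - f S))"
proof -
  have fB: "finite B" using assms finite_subset by auto
  have "(\<Sum>k\<in>B. Avg L (\<lambda>S. \<phi> (dif k f S)))
      = (\<Sum>k\<in>B. (1 / \<alpha>) * Avg L (\<lambda>S. if k \<notin> S then \<phi> (f (insert k S) - f S) else 0))"
    by (intro sum.cong Avg_dif assms(1) refl) (use assms in auto)
  also have "\<dots> = (1 / \<alpha>) * Avg L (\<lambda>S. \<Sum>k\<in>B. if k \<notin> S then \<phi> (f (insert k S) - f S) else 0)"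
    by (simp only: sum_distrib_left[symmetric] Avg_sum)
  also have "(\<lambda>S. \<Sum>k\<in>B. if k \<notin> S then \<phi> (f (insert k S) - f S) else 0)
      = (\<lambda>S. \<Sum>k\<in>B - S. \<phi> (f (insert k S) - f S))"
    using fB by (auto simp: sum.If_cases Int_def set_diff_eq intro!: ext sum.cong)
  finally show ?thesis .
qed

lemma Avg_shift:
  fixes f :: "(int^'n) set \<Rightarrow> real"
  shows "Avg L (\<lambda>S. f (shift z S)) = Avg (shift z L) f"
proof -
  have sh: "shift z S = (\<lambda>k. k - z) ` S" for S :: "(int^'n) set"
    by (force simp: shift_def image_iff)
  have inj: "inj (\<lambda>k :: int^'n. k - z)" by (simp add: inj_on_def)
  have bij: "bij_betw (shift z) (Pow L) (Pow (shift z L))"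
  proof (rule bij_betw_byWitness[where f' = "shift (- z)"])
    show "\<forall>S\<in>Pow L. shift (- z) (shift z S) = S" "\<forall>S\<in>Pow (shift z L). shift z (shift (- z) S) = S"
      by (auto simp: shift_def)
    show "shift z ` Pow L \<subseteq> Pow (shift z L)" "shift (- z) ` Pow (shift z L) \<subseteq> Pow L"
      by (auto simp: shift_def)
  qed
  have card: "card (shift z S) = card S" for S :: "(int^'n) set"
    unfolding sh using inj by (intro card_image) (auto intro: inj_on_subset)
  have diff: "shift z L - shift z S = shift z (L - S)" for S by (auto simp: shift_def)
  show ?thesis
    unfolding Avg_def sum.reindex_bij_betw[OF bij, symmetric] diff card ..
qed

end

lemma shift_insert: "shift z (insert k S) = insert (k - z) (shift z S)"
  by (auto simp: shift_def algebra_simps)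

lemma shift_remove: "shift z (S - {k}) = shift z S - {k - z}"
  by (auto simp: shift_def algebra_simps)

lemma shift_inverse: "shift (- z) (shift z S) = S"
  by (auto simp: shift_def)

lemma bij_betw_shift: "bij_betw (\<lambda>k. k - z) L (shift z L)"
  by (rule bij_betw_byWitness[where f' = "\<lambda>k. k + z"]) (auto simp: shift_def)

lemma finite_shift: "finite L \<Longrightarrow> finite (shift z L)"
  using bij_betw_finite[OF bij_betw_shift] by blast

locale random_value = value_fun K \<delta> C1 x Dm G t + biased \<alpha>
  for K :: "real^'n \<Rightarrow> real" and \<delta> C1 x Dm G t \<alpha>
begin

definition R :: "nat \<Rightarrow> (int^'n) set \<Rightarrow> real" where
  "R n S = lead n (ray1 (cube_of x)) S + lead n (ray2 (cube_of x)) S"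

lemma R_nonneg: "0 \<le> R n S"
  unfolding R_def by (intro add_nonneg_nonneg lead_nonneg)

definition rays :: "nat \<Rightarrow> (int^'n) set" where
  "rays n = ray1 (cube_of x) ` {..<n} \<union> ray2 (cube_of x) ` {..<n}"

lemma Avg_R_le:
  assumes "finite L" "rays n \<subseteq> L"
  shows "Avg L (\<lambda>S. 1 + R n S) \<le> 1 + 2 / \<alpha>"
proof -
  have "inj (ray1 (cube_of x))" "inj (ray2 (cube_of x))"
    by (auto simp: inj_on_def ray1_def ray2_def axis_eq_axis)
  then have "Avg L (lead n (ray1 (cube_of x))) \<le> 1 / \<alpha>" "Avg L (lead n (ray2 (cube_of x))) \<le> 1 / \<alpha>"
    using assms by (auto intro!: Avg_lead_le simp: rays_def)
  then show ?thesis using assms by (simp add: Avg_add R_def)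
qed

lemma flip_nonneg: "0 \<le> U S - U (insert k S)"
  using U_antimono[of S "insert k S"] by auto

lemma sum_Avg_dif_le:
  assumes "finite L" "B \<subseteq> L"
  shows "(\<Sum>k\<in>B. Avg L (\<lambda>S. \<bar>dif k U S\<bar>)) \<le> (1 + \<delta>) * t / \<alpha>"
proof -
  have fB: "finite B" using assms finite_subset by auto
  have "Avg L (\<lambda>S. \<Sum>k\<in>B - S. \<bar>U (insert k S) - U S\<bar>) \<le> Avg L (\<lambda>S. (1 + \<delta>) * t)"
  proof (intro Avg_mono)
    fix S
    have "(\<Sum>k\<in>B - S. \<bar>U (insert k S) - U S\<bar>) = (\<Sum>k\<in>B - S. U S - U (insert k S))"
      using flip_nonneg[of S] by (intro sum.cong) auto
    then show "(\<Sum>k\<in>B - S. \<bar>U (insert k S) - U S\<bar>) \<le> (1 + \<delta>) * t" using sum_flip_le[OF fB] by simp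
  qed
  then show ?thesis unfolding sum_Avg_dif[OF assms, where \<phi> = abs]
    using assms \<alpha>_pos by (simp add: divide_right_mono)
qed

lemma sum_Avg_dif_le_weighted:
  assumes "finite L" "B \<subseteq> L" "rays n \<subseteq> L" "0 \<le> H"
    and H: "\<And>S. (\<Sum>k\<in>B - S. U S - U (insert k S)) \<le> H * (1 + R n S)"
  shows "(\<Sum>k\<in>B. Avg L (\<lambda>S. \<bar>dif k U S\<bar>)) \<le> H * (1 + 2 / \<alpha>) / \<alpha>"
proof -
  have "Avg L (\<lambda>S. \<Sum>k\<in>B - S. \<bar>U (insert k S) - U S\<bar>) \<le> Avg L (\<lambda>S. H * (1 + R n S))"
  proof (intro Avg_mono)
    fix S
    have "(\<Sum>k\<in>B - S. \<bar>U (insert k S) - U S\<bar>) = (\<Sum>k\<in>B - S. U S - U (insert k S))"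
      using flip_nonneg[of S] by (intro sum.cong) auto
    then show "(\<Sum>k\<in>B - S. \<bar>U (insert k S) - U S\<bar>) \<le> H * (1 + R n S)" using H[of S] by simp
  qed
  also have "\<dots> \<le> H * (1 + 2 / \<alpha>)"
    unfolding Avg_cmult by (intro mult_left_mono Avg_R_le assms)
  finally show ?thesis unfolding sum_Avg_dif[OF assms(1,2), where \<phi> = abs]
    using \<alpha>_pos by (simp add: divide_right_mono)
qed

definition cen :: real where "cen = cflip * (1 + \<delta>) * (1 + 2 / \<alpha>) / \<alpha>"

text \<open>One factor of each square is bounded by \<open>flip_le\<close> uniformly in
  \<open>k\<close>, and the other factors are summed by \<open>sum_flip_le\<close>; the mean of
  \<open>R\<close> is taken only at the end.\<close>

lemma sum_Avg_dif_square_le: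
  assumes "finite L" "rays n \<subseteq> L" "t \<le> real n"
  shows "(\<Sum>k\<in>L. Avg L (\<lambda>S. (dif k U S)\<^sup>2)) \<le> cen * t"
proof -
  have cf: "0 \<le> cflip" using vel_ge by (simp add: cflip_def)
  have "Avg L (\<lambda>S. \<Sum>k\<in>L - S. (U (insert k S) - U S)\<^sup>2) \<le> Avg L (\<lambda>S. (cflip * ((1 + \<delta>) * t)) * (1 + R n S))"
  proof (intro Avg_mono)
    fix S
    have "(\<Sum>k\<in>L - S. (U (insert k S) - U S)\<^sup>2) \<le> (\<Sum>k\<in>L - S. (cflip * (1 + R n S)) * (U S - U (insert k S)))"
    proof (intro sum_mono)
      fix k assume k: "k \<in> L - S"
      have "(U (insert k S) - U S)\<^sup>2 = (U S - U (insert k S)) * (U S - U (insert k S))"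
        by (simp add: power2_eq_square algebra_simps)
      also have "\<dots> \<le> (cflip * (1 + R n S)) * (U S - U (insert k S))"
        using flip_le[of k S n] k assms(3) flip_nonneg[of S k]
        by (intro mult_right_mono) (auto simp: R_def add.assoc)
      finally show "(U (insert k S) - U S)\<^sup>2 \<le> (cflip * (1 + R n S)) * (U S - U (insert k S))" .
    qed
    also have "\<dots> = (cflip * (1 + R n S)) * (\<Sum>k\<in>L - S. U S - U (insert k S))"
      by (simp add: sum_distrib_left)
    also have "\<dots> \<le> (cflip * (1 + R n S)) * ((1 + \<delta>) * t)"
      using cf R_nonneg[of n S] by (intro mult_left_mono sum_flip_le assms(1)) auto
    finally show "(\<Sum>k\<in>L - S. (U (insert k S) - U S)\<^sup>2) \<le> (cflip * ((1 + \<delta>) * t)) * (1 + R n S)"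
      by (simp add: algebra_simps)
  qed
  also have "\<dots> \<le> (cflip * ((1 + \<delta>) * t)) * (1 + 2 / \<alpha>)"
    unfolding Avg_cmult using cf \<delta>_pos t_ge by (intro mult_left_mono Avg_R_le assms) auto
  finally have "(\<Sum>k\<in>L. Avg L (\<lambda>S. (dif k U S)\<^sup>2)) \<le> (1 / \<alpha>) * ((cflip * ((1 + \<delta>) * t)) * (1 + 2 / \<alpha>))"
    unfolding sum_Avg_dif[OF assms(1) order_refl, where \<phi> = "\<lambda>v. v\<^sup>2"] using \<alpha>_pos by (intro mult_left_mono) auto
  also have "\<dots> = cen * t" by (simp add: cen_def)
  finally show ?thesis .
qed

lemma variance_le_box:
  assumes m: "1 \<le> m" "8 * real m \<le> t" and n: "t \<le> real n" and H0: "0 \<le> H"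
    and H: "\<And>p S. (\<Sum>k\<in>ibox p m - S. U S - U (insert k S)) \<le> H * (1 + R n S)"
    and Q: "Q > 1"
    and M: "finite M" "rays n \<subseteq> M" and loc: "\<And>S. U S = U (S \<inter> M)"
  shows "Avg M (\<lambda>S. (U S)\<^sup>2) - (Avg M U)\<^sup>2 \<le> 2 * (cshift C1 * real m)\<^sup>2
    + 2 * (2 * cen * t + Q * (H * (1 + 2 / \<alpha>) / \<alpha> / real m ^ CARD('n)) * ((1 + \<delta>) * t / \<alpha>)) / ln Q"
proof -
  define Z where "Z = ibox (0 :: int^'n) m"
  define c where "c = real m ^ CARD('n)"
  have cZ: "real (card Z) = c" unfolding Z_def card_ibox c_def by simp
  have c: "c > 0" using m by (simp add: c_def)
  have fZ: "finite Z" unfolding Z_def by (rule finite_ibox)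
  have Z0: "0 \<in> Z" using m by (simp add: Z_def ibox_def)
  define F where "F S = (\<Sum>z\<in>Z. U (shift z S)) / c" for S
  \<comment> \<open>\<open>F\<close> reads the sites k + z with k in \<open>M\<close> and z in
    \<open>Z\<close>. Every translate \<open>shift z L\<close> with z in \<open>Z\<close> contains
    \<open>M\<close>, so means of \<open>U\<close> may be taken over any of them.\<close>
  define L where "L = (\<lambda>(k, z). k + z) ` (M \<times> Z)"
  have fL: "finite L" unfolding L_def using M fZ by simp
  have Msub: "M \<subseteq> shift z L" if "z \<in> Z" for z using that by (auto simp: shift_def L_def)
  have Msub0: "M \<subseteq> L" using Msub[OF Z0] by (simp add: shift_def)
  have difF: "dif k F S = (\<Sum>z\<in>Z. dif (k - z) U (shift z S)) / c" for k S
    by (simp add: dif_def F_def shift_insert shift_remove sum_subtractf diff_divide_distrib)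
  have l1: "Avg L (\<lambda>S. \<bar>dif k F S\<bar>) \<le> (\<Sum>z\<in>Z. Avg (shift z L) (\<lambda>S. \<bar>dif (k - z) U S\<bar>)) / c" for k
  proof -
    have "Avg L (\<lambda>S. \<bar>dif k F S\<bar>) \<le> Avg L (\<lambda>S. (1 / c) * (\<Sum>z\<in>Z. \<bar>dif (k - z) U (shift z S)\<bar>))"
      unfolding difF using c by (intro Avg_mono) (auto intro!: divide_right_mono sum_abs)
    also have "\<dots> = (1 / c) * (\<Sum>z\<in>Z. Avg L (\<lambda>S. \<bar>dif (k - z) U (shift z S)\<bar>))"
      by (simp add: Avg_cmult Avg_sum del: times_divide_eq_left)
    also have "\<dots> = (1 / c) * (\<Sum>z\<in>Z. Avg (shift z L) (\<lambda>S. \<bar>dif (k - z) U S\<bar>))"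
      using Avg_shift[of L "\<lambda>S. \<bar>dif j U S\<bar>" for j] by simp
    finally show ?thesis by simp
  qed
  have l1_max: "Avg L (\<lambda>S. \<bar>dif k F S\<bar>) \<le> H * (1 + 2 / \<alpha>) / \<alpha> / c" if k: "k \<in> L" for k
  proof -
    \<comment> \<open>The sites k - z with z in \<open>Z\<close>. Since the coordinates of z run
      from 0 to m - 1, the lowest corner is k - m + 1.\<close>
    define B where "B = ibox (\<chi> i. k $ i - int m + 1) m"
    have bij: "bij_betw (\<lambda>z. k - z) Z B"
    proof (rule bij_betw_byWitness[where f' = "\<lambda>z. k - z"])
      have "k - z \<in> B" if "z \<in> Z" for z
      proof -
        have "0 \<le> z $ i \<and> z $ i < int m" for i using that by (simp add: Z_def ibox_def)
        then have "k $ i - int m + 1 \<le> k $ i - z $ i \<and> k $ i - z $ i < k $ i - int m + 1 + int m" for i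
          by (smt (verit, best))
        then show ?thesis by (simp add: B_def ibox_def)
      qed
      then show "(\<lambda>z. k - z) ` Z \<subseteq> B" by auto
      have "k - z \<in> Z" if "z \<in> B" for z
      proof -
        have "k $ i - int m + 1 \<le> z $ i \<and> z $ i < k $ i - int m + 1 + int m" for i
          using that by (simp add: B_def ibox_def)
        then have "0 \<le> k $ i - z $ i \<and> k $ i - z $ i < int m" for i by (smt (verit, best))
        then show ?thesis by (simp add: Z_def ibox_def)
      qed
      then show "(\<lambda>z. k - z) ` B \<subseteq> Z" by auto
    qed auto
    have fB: "finite B" unfolding B_def by (rule finite_ibox)
    \<comment> \<open>The index sets \<open>shift z L\<close> vary with z, but the influence at j
      depends only on the sites of \<open>insert j M\<close>; all means can therefore be moved to
      the common set M \<union> B.\<close>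
    have red: "Avg L' (\<lambda>S. \<bar>dif j U S\<bar>) = Avg (insert j M) (\<lambda>S. \<bar>dif j U S\<bar>)"
      if "finite L'" "insert j M \<subseteq> L'" for L' j
    proof (rule Avg_local[OF that])
      fix S
      have "U (insert j S) = U (insert j (S \<inter> insert j M))"
        using loc[of "insert j S"] loc[of "insert j (S \<inter> insert j M)"] by (metis Int_insert_left Int_insert_right_if0 Int_insert_right_if1 inf.right_idem insert_absorb2 Int_absorb Int_assoc)
      moreover have "U (S - {j}) = U (S \<inter> insert j M - {j})"
      proof -
        have "(S - {j}) \<inter> M = (S \<inter> insert j M - {j}) \<inter> M" by auto
        then show ?thesis using loc[of "S - {j}"] loc[of "S \<inter> insert j M - {j}"] by simp
      qed
      ultimately show "\<bar>dif j U S\<bar> = \<bar>dif j U (S \<inter> insert j M)\<bar>" by (simp add: dif_def)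
    qed
    have "(\<Sum>z\<in>Z. Avg (shift z L) (\<lambda>S. \<bar>dif (k - z) U S\<bar>))
        = (\<Sum>z\<in>Z. Avg (insert (k - z) M) (\<lambda>S. \<bar>dif (k - z) U S\<bar>))"
      by (intro sum.cong refl red finite_shift fL) (use Msub k in \<open>auto simp: shift_def\<close>)
    also have "\<dots> = (\<Sum>j\<in>B. Avg (insert j M) (\<lambda>S. \<bar>dif j U S\<bar>))"
      by (rule sum.reindex_bij_betw[OF bij])
    also have "\<dots> = (\<Sum>j\<in>B. Avg (M \<union> B) (\<lambda>S. \<bar>dif j U S\<bar>))"
      by (intro sum.cong refl red[symmetric]) (use M fB in auto)
    also have "\<dots> \<le> H * (1 + 2 / \<alpha>) / \<alpha>"
      by (rule sum_Avg_dif_le_weighted[where n = n]) (use M fB H0 H in \<open>auto simp: B_def\<close>)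
    finally have "(\<Sum>z\<in>Z. Avg (shift z L) (\<lambda>S. \<bar>dif (k - z) U S\<bar>)) / c \<le> H * (1 + 2 / \<alpha>) / \<alpha> / c"
      using c by (intro divide_right_mono) auto
    then show ?thesis using l1[of k] by linarith
  qed
  have l1_sum: "(\<Sum>k\<in>L. Avg L (\<lambda>S. \<bar>dif k F S\<bar>)) \<le> (1 + \<delta>) * t / \<alpha>"
  proof -
    have "(\<Sum>k\<in>L. Avg L (\<lambda>S. \<bar>dif k F S\<bar>)) \<le> (\<Sum>k\<in>L. (\<Sum>z\<in>Z. Avg (shift z L) (\<lambda>S. \<bar>dif (k - z) U S\<bar>)) / c)"
      by (intro sum_mono l1)
    also have "\<dots> = (\<Sum>z\<in>Z. \<Sum>k\<in>L. Avg (shift z L) (\<lambda>S. \<bar>dif (k - z) U S\<bar>)) / c"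
      unfolding sum_divide_distrib[symmetric] by (subst sum.swap) simp
    also have "\<dots> \<le> (\<Sum>z\<in>Z. (1 + \<delta>) * t / \<alpha>) / c"
    proof (intro divide_right_mono sum_mono)
      fix z
      have "(\<Sum>k\<in>L. Avg (shift z L) (\<lambda>S. \<bar>dif (k - z) U S\<bar>)) = (\<Sum>j\<in>shift z L. Avg (shift z L) (\<lambda>S. \<bar>dif j U S\<bar>))"
        by (rule sum.reindex_bij_betw[OF bij_betw_shift])
      then show "(\<Sum>k\<in>L. Avg (shift z L) (\<lambda>S. \<bar>dif (k - z) U S\<bar>)) \<le> (1 + \<delta>) * t / \<alpha>"
        using sum_Avg_dif_le[OF finite_shift[OF fL] order_refl] by simp
    qed (use c in simp)
    also have "\<dots> = (1 + \<delta>) * t / \<alpha>" using c by (simp add: cZ)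
    finally show ?thesis .
  qed
  have l2: "(\<Sum>k\<in>L. Avg L (\<lambda>S. (dif k F S)\<^sup>2)) \<le> cen * t"
  proof -
    have "(\<Sum>k\<in>L. Avg L (\<lambda>S. (dif k F S)\<^sup>2))
       \<le> (\<Sum>k\<in>L. (\<Sum>z\<in>Z. Avg (shift z L) (\<lambda>S. (dif (k - z) U S)\<^sup>2)) / c)"
    proof (intro sum_mono)
      fix k
      have "Avg L (\<lambda>S. (dif k F S)\<^sup>2) \<le> Avg L (\<lambda>S. (1 / c) * (\<Sum>z\<in>Z. (dif (k - z) U (shift z S))\<^sup>2))"
      proof (intro Avg_mono)
        fix S
        have "(\<Sum>z\<in>Z. dif (k - z) U (shift z S))\<^sup>2 \<le> c * (\<Sum>z\<in>Z. (dif (k - z) U (shift z S))\<^sup>2)"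
          using Cauchy_Schwarz_ineq_sum[of "\<lambda>_. 1" "\<lambda>z. dif (k - z) U (shift z S)" Z] by (simp add: cZ)
        then show "(dif k F S)\<^sup>2 \<le> (1 / c) * (\<Sum>z\<in>Z. (dif (k - z) U (shift z S))\<^sup>2)"
          unfolding difF using c by (simp add: power_divide power2_eq_square field_simps)
      qed
      also have "\<dots> = (1 / c) * (\<Sum>z\<in>Z. Avg L (\<lambda>S. (dif (k - z) U (shift z S))\<^sup>2))"
        by (simp add: Avg_cmult Avg_sum del: times_divide_eq_left)
      also have "\<dots> = (1 / c) * (\<Sum>z\<in>Z. Avg (shift z L) (\<lambda>S. (dif (k - z) U S)\<^sup>2))"
        using Avg_shift[of L "\<lambda>S. (dif j U S)\<^sup>2" for j] by simp
      finally show "Avg L (\<lambda>S. (dif k F S)\<^sup>2) \<le> (\<Sum>z\<in>Z. Avg (shift z L) (\<lambda>S. (dif (k - z) U S)\<^sup>2)) / c" by simp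
    qed
    also have "\<dots> = (\<Sum>z\<in>Z. \<Sum>k\<in>L. Avg (shift z L) (\<lambda>S. (dif (k - z) U S)\<^sup>2)) / c"
      unfolding sum_divide_distrib[symmetric] by (subst sum.swap) simp
    also have "\<dots> \<le> (\<Sum>z\<in>Z. cen * t) / c"
    proof (intro divide_right_mono sum_mono)
      fix z assume z: "z \<in> Z"
      have "(\<Sum>k\<in>L. Avg (shift z L) (\<lambda>S. (dif (k - z) U S)\<^sup>2)) = (\<Sum>j\<in>shift z L. Avg (shift z L) (\<lambda>S. (dif j U S)\<^sup>2))"
        by (rule sum.reindex_bij_betw[OF bij_betw_shift])
      then show "(\<Sum>k\<in>L. Avg (shift z L) (\<lambda>S. (dif (k - z) U S)\<^sup>2)) \<le> cen * t"
        using sum_Avg_dif_square_le[OF finite_shift[OF fL] _ n, of z] M(2) Msub[OF z] by auto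
    qed (use c in simp)
    also have "\<dots> = cen * t" using c by (simp add: cZ)
    finally show ?thesis .
  qed
  let ?h = "H * (1 + 2 / \<alpha>) / \<alpha> / c"
  \<comment> \<open>One factor of each square is bounded by the maximum, which has gained from
    averaging; the other factors are summed to the total influence.\<close>
  have "(\<Sum>k\<in>L. (Avg L (\<lambda>S. \<bar>dif k F S\<bar>))\<^sup>2) \<le> (\<Sum>k\<in>L. ?h * Avg L (\<lambda>S. \<bar>dif k F S\<bar>))"
    unfolding power2_eq_square by (intro sum_mono mult_right_mono l1_max Avg_nonneg) auto
  also have "\<dots> = ?h * (\<Sum>k\<in>L. Avg L (\<lambda>S. \<bar>dif k F S\<bar>))" by (simp add: sum_distrib_left)
  also have "\<dots> \<le> ?h * ((1 + \<delta>) * t / \<alpha>)"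
    using H0 \<alpha>_pos c by (intro mult_left_mono l1_sum) auto
  finally have "Q * (\<Sum>k\<in>L. (Avg L (\<lambda>S. \<bar>dif k F S\<bar>))\<^sup>2) \<le> Q * (?h * ((1 + \<delta>) * t / \<alpha>))"
    using Q by (intro mult_left_mono) auto
  then have "ln Q * (Avg L (\<lambda>S. (F S)\<^sup>2) - (Avg L F)\<^sup>2) \<le> 2 * cen * t + Q * ?h * ((1 + \<delta>) * t / \<alpha>)"
    using Falik_Samorodnitsky[OF fL, of Q F] l2 Q by (simp add: mult.assoc)
  moreover have lnQ: "ln Q > 0" using Q by simp
  ultimately have varF: "Avg L (\<lambda>S. (F S)\<^sup>2) - (Avg L F)\<^sup>2 \<le> (2 * cen * t + Q * ?h * ((1 + \<delta>) * t / \<alpha>)) / ln Q"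
    by (simp add: pos_le_divide_eq mult.commute)
  have UF: "\<bar>U S - F S\<bar> \<le> cshift C1 * real m" for S
  proof -
    have each: "\<bar>U S - U (shift z S)\<bar> \<le> cshift C1 * real m" if "z \<in> Z" for z
    proof -
      have z: "\<bar>z $ i\<bar> \<le> int m" "\<bar>(- z) $ i\<bar> \<le> int m" for i
      proof -
        have "0 \<le> z $ i \<and> z $ i < int m" using that by (simp add: Z_def ibox_def)
        then show "\<bar>z $ i\<bar> \<le> int m" "\<bar>(- z) $ i\<bar> \<le> int m" by simp_all
      qed
      have "U S - cshift C1 * real m \<le> U (shift z S)" by (rule shift_ge[OF m z(1)])
      moreover have "U (shift z S) - cshift C1 * real m \<le> U (shift (- z) (shift z S))"
        by (rule shift_ge[OF m z(2)])
      ultimately show ?thesis unfolding shift_inverse abs_le_iff by linarith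
    qed
    have "U S - F S = (\<Sum>z\<in>Z. U S - U (shift z S)) / c"
      using c by (simp add: F_def sum_subtractf cZ diff_divide_distrib)
    then have "\<bar>U S - F S\<bar> \<le> (\<Sum>z\<in>Z. \<bar>U S - U (shift z S)\<bar>) / c"
      using c by (simp add: divide_right_mono)
    also have "\<dots> \<le> (\<Sum>z\<in>Z. cshift C1 * real m) / c" using c each by (intro divide_right_mono sum_mono) auto
    also have "\<dots> = cshift C1 * real m" using c by (simp add: cZ)
    finally show ?thesis .
  qed
  \<comment> \<open>The mean of \<open>F\<close> serves as centre for \<open>U\<close> too;
    replacing it by the mean of \<open>U\<close> can only lower the second moment.\<close>
  define e where "e = Avg L F"
  have expand: "Avg L (\<lambda>S. (g S - e)\<^sup>2) = Avg L (\<lambda>S. (g S)\<^sup>2) - 2 * e * Avg L g + e\<^sup>2" for g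
  proof -
    have "(\<lambda>S. (g S - e)\<^sup>2) = (\<lambda>S. (g S)\<^sup>2 - (2 * e) * g S + e\<^sup>2)" by (auto simp: power2_diff algebra_simps)
    then show ?thesis using fL by (simp add: Avg_add Avg_diff Avg_cmult del: mult.assoc)
  qed
  have "Avg L (\<lambda>S. (U S - e)\<^sup>2) \<le> Avg L (\<lambda>S. 2 * (cshift C1 * real m)\<^sup>2 + 2 * (F S - e)\<^sup>2)"
  proof (intro Avg_mono)
    fix S
    have "(U S - e)\<^sup>2 \<le> 2 * (U S - F S)\<^sup>2 + 2 * (F S - e)\<^sup>2"
      using sum_squares_ge_zero[of "(U S - F S) - (F S - e)" 0] by (simp add: power2_eq_square algebra_simps)
    also have "(U S - F S)\<^sup>2 \<le> (cshift C1 * real m)\<^sup>2"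
      using UF[of S] abs_le_square_iff[of "U S - F S" "cshift C1 * real m"] by linarith
    finally show "(U S - e)\<^sup>2 \<le> 2 * (cshift C1 * real m)\<^sup>2 + 2 * (F S - e)\<^sup>2" by simp
  qed
  also have "\<dots> = 2 * (cshift C1 * real m)\<^sup>2 + 2 * (Avg L (\<lambda>S. (F S)\<^sup>2) - (Avg L F)\<^sup>2)"
    using fL expand[of F] by (simp add: Avg_add Avg_cmult e_def[symmetric] power2_eq_square)
  also have "\<dots> \<le> 2 * (cshift C1 * real m)\<^sup>2 + 2 * ((2 * cen * t + Q * ?h * ((1 + \<delta>) * t / \<alpha>)) / ln Q)"
    by (intro add_left_mono mult_left_mono varF) simp
  finally have up: "Avg L (\<lambda>S. (U S - e)\<^sup>2) \<le> \<dots>" .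
  have "Avg L (\<lambda>S. (U S)\<^sup>2) - (Avg L U)\<^sup>2 \<le> Avg L (\<lambda>S. (U S - e)\<^sup>2)"
  proof -
    have "0 \<le> (Avg L U - e)\<^sup>2" by simp
    then show ?thesis unfolding expand[of U] by (simp add: power2_diff algebra_simps)
  qed
  moreover have "Avg L (\<lambda>S. (U S)\<^sup>2) = Avg M (\<lambda>S. (U S)\<^sup>2)" "Avg L U = Avg M U"
    by (rule Avg_local[OF fL Msub0]; use loc in simp)+
  ultimately show ?thesis using up by (simp add: c_def)
qed


definition cvar :: "real \<Rightarrow> real \<Rightarrow> real" where
  "cvar \<kappa> c = (2 * (cshift C1)\<^sup>2 + 2 * (2 * cen + c * (1 + 2 / \<alpha>) / \<alpha> * ((1 + \<delta>) / \<alpha>))) / \<kappa>"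

lemma variance_le_large_time:
  assumes t: "64 \<le> t" and \<kappa>: "0 < \<kappa>" "\<kappa> < 1" and c: "0 \<le> c"
  defines "m \<equiv> nat \<lfloor>t powr ((1 - \<kappa>) / 2)\<rfloor>"
  assumes box: "\<And>n p S. t \<le> real n \<Longrightarrow> (\<Sum>k\<in>ibox p m - S. U S - U (insert k S))
      \<le> c * real m ^ CARD('n) * t powr (- \<kappa>) * (1 + R n S)"
    and M: "finite M" and loc: "\<And>S. U S = U (S \<inter> M)"
  shows "Avg M (\<lambda>S. (U S)\<^sup>2) - (Avg M U)\<^sup>2 \<le> cvar \<kappa> c * t / ln t"
proof -
  define n where "n = nat \<lceil>t\<rceil>"
  have n: "t \<le> real n" unfolding n_def by linarith
  define r where "r = t powr ((1 - \<kappa>) / 2)"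
  have r1: "1 \<le> r" unfolding r_def using t \<kappa> by (intro ge_one_powr_ge_zero) auto
  have m1: "1 \<le> m" unfolding m_def r_def[symmetric] using r1 by (simp add: le_nat_iff le_floor_iff)
  have mr: "real m \<le> r" unfolding m_def r_def[symmetric] using r1 by linarith
  have "r \<le> t powr (1 / 2)" unfolding r_def using t \<kappa> by (intro powr_mono) auto
  also have "\<dots> = sqrt t" using t by (simp add: powr_half_sqrt)
  finally have "r \<le> sqrt t" .
  \<comment> \<open>The origin of the threshold 64: it leaves room for the cheap piece that
    \<open>shift_ge\<close> needs.\<close>
  moreover have "8 * sqrt t \<le> t"
  proof -
    have "8 \<le> sqrt t" using t by (intro real_le_rsqrt) simp
    then have "8 * sqrt t \<le> sqrt t * sqrt t" using t by (intro mult_right_mono) auto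
    then show ?thesis using t by simp
  qed
  ultimately have m8: "8 * real m \<le> t" using mr by linarith
  \<comment> \<open>Chosen to cancel the factor t powr (- \<kappa>) of the box bound, with ln Q
    still proportional to ln t.\<close>
  define Q where "Q = t powr \<kappa>"
  have Q: "Q > 1" unfolding Q_def using t \<kappa> by (intro gr_one_powr) auto
  have lnt: "ln t > 0" using t by simp
  have lnQ: "ln Q = \<kappa> * ln t" unfolding Q_def using t by (simp add: ln_powr)
  define H where "H = c * real m ^ CARD('n) * t powr (- \<kappa>)"
  have H0: "0 \<le> H" unfolding H_def using c by simp
  \<comment> \<open>The ray sites are added so that the mean of \<open>R n\<close> can be taken over
    the same set; the moments of \<open>U\<close> do not change, as \<open>U\<close> depends on the
    trace on \<open>M\<close> only.\<close>
  let ?M = "M \<union> rays n"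
  have fM: "finite ?M" using M by (simp add: rays_def)
  have loc': "U S = U (S \<inter> ?M)" for S
    using loc[of S] loc[of "S \<inter> ?M"] by (simp add: Int_assoc Un_Int_eq)
  have "Avg ?M (\<lambda>S. (U S)\<^sup>2) - (Avg ?M U)\<^sup>2 \<le> 2 * (cshift C1 * real m)\<^sup>2
    + 2 * (2 * cen * t + Q * (H * (1 + 2 / \<alpha>) / \<alpha> / real m ^ CARD('n)) * ((1 + \<delta>) * t / \<alpha>)) / ln Q"
    by (rule variance_le_box[OF m1 m8 n H0 _ Q fM _ loc']) (use box n in \<open>auto simp: H_def\<close>)
  also have "Q * (H * (1 + 2 / \<alpha>) / \<alpha> / real m ^ CARD('n)) = c * (1 + 2 / \<alpha>) / \<alpha>"
  proof -
    have "Q * t powr (- \<kappa>) = 1" unfolding Q_def using t by (simp add: powr_add[symmetric])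
    moreover have "Q * (H * (1 + 2 / \<alpha>) / \<alpha> / real m ^ CARD('n)) = (Q * t powr (- \<kappa>)) * (c * (1 + 2 / \<alpha>) / \<alpha>)"
      unfolding H_def using m1 by simp
    ultimately show ?thesis by simp
  qed
  also have "2 * (cshift C1 * real m)\<^sup>2 \<le> 2 * (cshift C1)\<^sup>2 * (t / (\<kappa> * ln t))"
  proof -
    have "(real m)\<^sup>2 \<le> r\<^sup>2" using mr by (intro power_mono) auto
    also have "\<dots> = t powr (1 - \<kappa>)" unfolding r_def power2_eq_square powr_add[symmetric] by simp
    also have "\<dots> = t / Q" unfolding Q_def using t by (simp add: powr_diff)
    \<comment> \<open>The squared cost of averaging is smaller than t by the power Q, which exceeds
      ln Q.\<close>
    also have "\<dots> \<le> t / (\<kappa> * ln t)"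
      using t \<kappa> lnt Q ln_le_minus_one[of Q] lnQ by (intro divide_left_mono) auto
    finally have "2 * (cshift C1)\<^sup>2 * (real m)\<^sup>2 \<le> 2 * (cshift C1)\<^sup>2 * (t / (\<kappa> * ln t))"
      by (intro mult_left_mono) auto
    then show ?thesis unfolding power_mult_distrib mult.assoc[symmetric] .
  qed
  finally have "Avg ?M (\<lambda>S. (U S)\<^sup>2) - (Avg ?M U)\<^sup>2 \<le> 2 * (cshift C1)\<^sup>2 * (t / (\<kappa> * ln t))
      + 2 * (2 * cen * t + c * (1 + 2 / \<alpha>) / \<alpha> * ((1 + \<delta>) * t / \<alpha>)) / (\<kappa> * ln t)"
    using lnQ by simp
  also have "\<dots> = cvar \<kappa> c * t / ln t"
    unfolding cvar_def using \<kappa> lnt \<alpha>_pos by (simp add: field_simps)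
  finally show ?thesis
    using Avg_local[OF fM, of M "\<lambda>S. (U S)\<^sup>2"] Avg_local[OF fM, of M U] loc by (metis (no_types, lifting) Un_upper1)
qed

text \<open>For bounded times the trivial estimate of \<open>U\<close> suffices; the factor ln 64 /
  ln t, which is at least 1, only brings it into the form of the large-time bound.\<close>

lemma variance_le_small_time:
  assumes t: "2 \<le> t" "t \<le> 64" and M: "finite M"
  shows "Avg M (\<lambda>S. (U S)\<^sup>2) - (Avg M U)\<^sup>2 \<le> (C1 + c0 C1 + \<delta>)\<^sup>2 * 64 * ln 64 * t / ln t"
proof -
  let ?c = "C1 + c0 C1 + \<delta>"
  have "Avg M (\<lambda>S. (U S)\<^sup>2) - (Avg M U)\<^sup>2 \<le> Avg M (\<lambda>S. (U S)\<^sup>2)" by simp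
  also have "\<dots> \<le> Avg M (\<lambda>S. (?c * t)\<^sup>2)"
  proof (intro Avg_mono)
    fix S
    have "0 \<le> ?c * t" using C1_pos c0(1)[of C1] \<delta>_pos t by simp
    then show "(U S)\<^sup>2 \<le> (?c * t)\<^sup>2"
      using U_abs_le[of S] by (subst abs_le_square_iff[symmetric]) simp
  qed
  also have "\<dots> = ?c\<^sup>2 * (t * t)" using M by (simp add: power_mult_distrib power2_eq_square)
  also have "\<dots> \<le> ?c\<^sup>2 * (64 * t * (ln 64 / ln t))"
  proof (rule mult_left_mono)
    have "1 \<le> ln 64 / ln t" using t by simp
    then have "(64 * t) * 1 \<le> (64 * t) * (ln 64 / ln t)" using t by (intro mult_left_mono) auto
    moreover have "t * t \<le> 64 * t" using t by (intro mult_right_mono) auto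
    ultimately show "t * t \<le> 64 * t * (ln 64 / ln t)" by linarith
  qed simp
  finally show ?thesis by (simp add: mult.assoc mult.left_commute mult.commute)
qed

end

section \<open>Choice of the exponents in dimension at least 3 and in dimension 2\<close>

lemma (in lagrangian) norm_le_of_power_bound:
  assumes \<nu>: "\<nu> > 1" and K: "\<And>z. norm z < 1 / 2 \<Longrightarrow> norm z powr \<nu> \<le> K z" and \<theta>: "0 < \<theta>" "\<theta> < 1 / 2"
  shows "norm z \<le> \<theta> + \<theta> powr (1 - \<nu>) * K z"
proof (cases "norm z \<le> \<theta>")
  case True
  have "0 \<le> \<theta> powr (1 - \<nu>) * K z" using K_nonneg[of z] by simp
  then show ?thesis using True by linarith
next
  case False
  then have z: "norm z > \<theta>" "norm z > 0" using \<theta> by auto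
  \<comment> \<open>The point q * z on the segment from 0 to z has norm \<theta>. Convexity and K 0
    = 0 give K z / |z| at least its value at that point, which is at least \<theta> powr (\<nu> -
    1).\<close>
  define q where "q = \<theta> / norm z"
  have q: "0 < q" "q < 1" using z \<theta> by (auto simp: q_def)
  have nq: "norm (q *\<^sub>R z) = \<theta>" using z \<theta> by (simp add: q_def)
  have "\<theta> powr \<nu> \<le> K (q *\<^sub>R z)" using K[of "q *\<^sub>R z"] nq \<theta> by simp
  also have "\<dots> = K ((1 - q) *\<^sub>R 0 + q *\<^sub>R z)" by simp
  also have "\<dots> \<le> (1 - q) * K 0 + q * K z"
    using q by (intro convex_onD[OF K_convex]) auto
  also have "\<dots> = \<theta> / norm z * K z" by (simp add: K_zero q_def)
  finally have "norm z * \<theta> powr \<nu> \<le> \<theta> * K z" using z by (simp add: field_simps)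
  moreover have "\<theta> powr (1 - \<nu>) * \<theta> powr \<nu> = \<theta>" using \<theta> by (simp add: powr_add[symmetric])
  ultimately have "norm z * \<theta> powr \<nu> \<le> (\<theta> powr (1 - \<nu>) * K z) * \<theta> powr \<nu>" by (simp add: mult_ac)
  then have "norm z \<le> \<theta> powr (1 - \<nu>) * K z" using \<theta> by (simp add: mult_le_cancel_right)
  then show ?thesis using \<theta> by linarith
qed

lemma half_powr_le_floor:
  assumes "1 \<le> (t::real)" "0 \<le> a"
  shows "t powr a / 2 \<le> real (nat \<lfloor>t powr a\<rfloor>)" "real (nat \<lfloor>t powr a\<rfloor>) \<le> t powr a" "1 \<le> nat \<lfloor>t powr a\<rfloor>"
proof -
  have "1 \<le> t powr a" using assms by (intro ge_one_powr_ge_zero) auto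
  then have "real (nat \<lfloor>t powr a\<rfloor>) = of_int \<lfloor>t powr a\<rfloor>" and *: "1 \<le> \<lfloor>t powr a\<rfloor>"
    by (auto simp: le_floor_iff)
  then have "t powr a / 2 \<le> real (nat \<lfloor>t powr a\<rfloor>) \<and> real (nat \<lfloor>t powr a\<rfloor>) \<le> t powr a"
    by linarith
  then show "t powr a / 2 \<le> real (nat \<lfloor>t powr a\<rfloor>)" "real (nat \<lfloor>t powr a\<rfloor>) \<le> t powr a" by auto
  show "1 \<le> nat \<lfloor>t powr a\<rfloor>" using * by linarith
qed

text \<open>The box has volume at least t powr (6/5) / 8, so the bound O(t) for all sites together
  is already small enough. The exponent 1/5 solves 3 * (1 - \<kappa>) / 2 = 1 + \<kappa>, the
  critical case d = 3.\<close>

lemma (in value_fun) box_bound_high_dim: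
  assumes d: "CARD('n) \<ge> 3" and R: "0 \<le> R"
  defines "m \<equiv> nat \<lfloor>t powr ((1 - 1 / 5) / 2)\<rfloor>"
  shows "(\<Sum>k\<in>ibox p m - S. U S - U (insert k S))
    \<le> 8 * (1 + \<delta>) * real m ^ CARD('n) * t powr (- (1 / 5)) * (1 + R)"
proof -
  have e: "(1 - 1 / 5) / 2 = (2 / 5 :: real)" by simp
  have m: "t powr (2 / 5) / 2 \<le> real m" "1 \<le> m"
    unfolding m_def e using half_powr_le_floor[of t "2 / 5"] t_ge by auto
  have "t powr (6 / 5) / 8 = (t powr (2 / 5) / 2) ^ 3"
    using t_ge by (simp add: power_divide powr_power)
  also have "\<dots> \<le> real m ^ 3" using m by (intro power_mono) auto
  also have "\<dots> \<le> real m ^ CARD('n)" using m d by (intro power_increasing) auto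
  finally have "t powr (6 / 5) * t powr (- (1 / 5)) \<le> 8 * real m ^ CARD('n) * t powr (- (1 / 5))"
    by (intro mult_right_mono) auto
  moreover have "t powr (6 / 5) * t powr (- (1 / 5)) = t" using t_ge by (simp add: powr_add[symmetric])
  ultimately have "t \<le> 8 * real m ^ CARD('n) * t powr (- (1 / 5))" by simp
  then have "(1 + \<delta>) * t * 1 \<le> (1 + \<delta>) * (8 * real m ^ CARD('n) * t powr (- (1 / 5))) * (1 + R)"
    using R \<delta>_pos t_ge by (intro mult_mono) auto
  moreover have "(1 + \<delta>) * (8 * real m ^ CARD('n) * t powr (- (1 / 5))) * (1 + R)
      = 8 * (1 + \<delta>) * real m ^ CARD('n) * t powr (- (1 / 5)) * (1 + R)" by (simp only: mult_ac)
  ultimately show ?thesis using sum_flip_le[OF finite_ibox[of p m], of S] by linarith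
qed

text \<open>The exponents balance the terms of \<open>sum_flip_box_le\<close>: with \<theta> of
  order t powr (-1 / (2 * \<nu>)), both \<theta> * t and \<mu> * m, as well as m, are at most of
  order t powr (1 - 1 / (2 * \<nu>)). The target m^2 * t powr (- \<kappa>) has exponent 1 - 2 *
  \<kappa>, whence \<kappa> = 1 / (4 * \<nu>).\<close>

lemma (in value_fun) box_bound_dim_2:
  assumes d: "CARD('n) = 2" and n: "t \<le> real n" and \<nu>: "\<nu> > 1"
    and K: "\<And>z. norm z < 1 / 2 \<Longrightarrow> norm z powr \<nu> \<le> K z"
  defines "m \<equiv> nat \<lfloor>t powr ((1 - 1 / (4 * \<nu>)) / 2)\<rfloor>"
  shows "(\<Sum>k\<in>ibox p m - S. U S - U (insert k S))
    \<le> 4 * cvisit * (2 + 4 powr (\<nu> - 1)) * real m ^ CARD('n) * t powr (- (1 / (4 * \<nu>)))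
       * (1 + (lead n (ray1 (cube_of x)) S + lead n (ray2 (cube_of x)) S))"
proof -
  let ?R = "1 + lead n (ray1 (cube_of x)) S + lead n (ray2 (cube_of x)) S"
  let ?a = "1 - 1 / (2 * \<nu>)" and ?b = "(1 - 1 / (4 * \<nu>)) / 2"
  have \<nu>4: "1 / (4 * \<nu>) < 1 / 4" "0 < 1 / (4 * \<nu>)" "1 / (2 * \<nu>) = 2 * (1 / (4 * \<nu>))" using \<nu> by (auto simp: field_simps)
  have b: "0 \<le> ?b" "?b \<le> 1 / 2" "?b \<le> ?a"
  proof -
    define u where "u = 1 / (4 * \<nu>)"
    have "u < 1 / 4" "0 < u" "1 / (2 * \<nu>) = 2 * u" using \<nu>4 by (auto simp: u_def)
    then show "0 \<le> ?b" "?b \<le> 1 / 2" "?b \<le> ?a" unfolding u_def[symmetric] by auto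
  qed
  have m: "t powr ?b / 2 \<le> real m" "real m \<le> t powr ?b" "1 \<le> m"
    unfolding m_def using half_powr_le_floor[of t ?b] t_ge b by auto
  \<comment> \<open>The factor 1/4 keeps \<theta> below 1/2, where the lower bound on
    \<open>K\<close> is available.\<close>
  define \<theta> where "\<theta> = t powr (- (1 / (2 * \<nu>))) / 4"
  have "t powr (- (1 / (2 * \<nu>))) \<le> t powr 0" using t_ge \<nu> by (intro powr_mono) auto
  then have \<theta>: "0 < \<theta>" "\<theta> < 1 / 2" using t_ge by (auto simp: \<theta>_def)
  define \<mu> where "\<mu> = \<theta> powr (1 - \<nu>)"
  have "(\<Sum>k\<in>ibox p m - S. U S - U (insert k S)) \<le> cvisit * ?R * (real m + \<theta> * t + \<mu> * real m)"
    by (rule sum_flip_box_le[OF m(3) n]) (use \<theta> norm_le_of_power_bound[OF \<nu> K \<theta>] in \<open>auto simp: \<mu>_def\<close>)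
  also have "\<dots> \<le> cvisit * ?R * ((2 + 4 powr (\<nu> - 1)) * t powr ?a)"
  proof (rule mult_left_mono)
    have "real m \<le> t powr ?a" using m(2) powr_mono[OF b(3), of t] t_ge by linarith
    moreover have "\<theta> * t \<le> t powr ?a"
    proof -
      have "t powr (- (1 / (2 * \<nu>))) * t powr 1 = t powr ?a" unfolding powr_add[symmetric] by simp
      then have "\<theta> * t = t powr ?a / 4" using t_ge by (simp add: \<theta>_def)
      moreover have "t powr ?a / 4 \<le> t powr ?a" by simp
      ultimately show ?thesis by (simp only:)
    qed
    moreover have "\<mu> * real m \<le> 4 powr (\<nu> - 1) * t powr ?a"
    proof -
      have "\<mu> = t powr (- (1 / (2 * \<nu>)) * (1 - \<nu>)) / 4 powr (1 - \<nu>)"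
        unfolding \<mu>_def \<theta>_def using t_ge by (simp add: powr_divide powr_powr)
      also have "- (1 / (2 * \<nu>)) * (1 - \<nu>) = 1 / 2 - 1 / (2 * \<nu>)" using \<nu> by (simp add: field_simps)
      also have "t powr (1 / 2 - 1 / (2 * \<nu>)) / 4 powr (1 - \<nu>) = 4 powr (\<nu> - 1) * t powr (1 / 2 - 1 / (2 * \<nu>))"
        by (simp add: powr_diff field_simps)
      finally have mu: "\<mu> = 4 powr (\<nu> - 1) * t powr (1 / 2 - 1 / (2 * \<nu>))" .
      have "\<mu> * real m \<le> \<mu> * t powr (1 / 2)"
        using m(2) powr_mono[OF b(2), of t] t_ge by (intro mult_left_mono) (auto simp: \<mu>_def)
      also have "\<dots> = 4 powr (\<nu> - 1) * t powr ?a"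
        unfolding mu by (simp add: powr_add[symmetric])
      finally show ?thesis .
    qed
    ultimately show "real m + \<theta> * t + \<mu> * real m \<le> (2 + 4 powr (\<nu> - 1)) * t powr ?a"
      by (simp add: distrib_right)
    have "0 \<le> cvisit" using vel_ge \<delta>_pos by (simp add: cvisit_def cflip_def)
    then show "0 \<le> cvisit * ?R"
      using lead_nonneg[of n "ray1 (cube_of x)" S] lead_nonneg[of n "ray2 (cube_of x)" S] by simp
  qed
  also have "\<dots> \<le> cvisit * ?R * ((2 + 4 powr (\<nu> - 1)) * (4 * real m ^ CARD('n) * t powr (- (1 / (4 * \<nu>)))))"
  proof (intro mult_left_mono)
    have "t powr (1 - 1 / (4 * \<nu>)) / 4 = (t powr ?b / 2)\<^sup>2"
    proof -
      have "t powr ?b * t powr ?b = t powr (?b + ?b)" by (simp only: powr_add)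
      also have "?b + ?b = 1 - 1 / (4 * \<nu>)" by (rule field_sum_of_halves)
      finally show ?thesis by (simp add: power2_eq_square)
    qed
    also have "\<dots> \<le> real m ^ CARD('n)" unfolding d using m by (intro power_mono) auto
    finally have "t powr (1 - 1 / (4 * \<nu>)) * t powr (- (1 / (4 * \<nu>))) \<le> 4 * real m ^ CARD('n) * t powr (- (1 / (4 * \<nu>)))"
      by (intro mult_right_mono) auto
    moreover have "t powr (1 - 1 / (4 * \<nu>)) * t powr (- (1 / (4 * \<nu>))) = t powr ?a"
      using \<nu>4(3) by (simp add: powr_add[symmetric])
    ultimately show "t powr ?a \<le> 4 * real m ^ CARD('n) * t powr (- (1 / (4 * \<nu>)))" by simp
    have "0 \<le> cvisit" using vel_ge \<delta>_pos by (simp add: cvisit_def cflip_def)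
    then show "0 \<le> cvisit * ?R"
      using lead_nonneg[of n "ray1 (cube_of x)" S] lead_nonneg[of n "ray2 (cube_of x)" S] by simp
  qed simp
  finally show ?thesis by (simp only: mult_ac add.assoc)
qed

text \<open>\<open>C\<close> precedes x, Dm, G, t and M. Therefore \<kappa> and c are first
  extracted from the two cases of the dimension in a form uniform in all of these, before any value
  function is fixed.\<close>

theorem value_variance_bound:
  fixes K :: "real^'n \<Rightarrow> real"
  assumes "lagrangian K \<delta>" and bi: "biased \<alpha>" and dim: "CARD('n) \<ge> 2"
    and K_dim2: "CARD('n) = 2 \<longrightarrow> (\<exists>\<nu>>1. \<forall>z. norm z < 1 / 2 \<longrightarrow> K z \<ge> norm z powr \<nu>)"
  shows "\<exists>C>0. \<forall>x Dm G t M. value_fun K \<delta> C1 x Dm G t \<longrightarrow> 2 \<le> t \<longrightarrow> finite M \<longrightarrow>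
     (\<forall>S. value_fun.U K \<delta> x Dm G t S = value_fun.U K \<delta> x Dm G t (S \<inter> M)) \<longrightarrow>
     biased.Avg \<alpha> M (\<lambda>S. (value_fun.U K \<delta> x Dm G t S)\<^sup>2) - (biased.Avg \<alpha> M (value_fun.U K \<delta> x Dm G t))\<^sup>2
       \<le> C * t / ln t"
proof -
  interpret lagrangian K \<delta> by fact
  interpret B: biased \<alpha> by fact
  have "\<exists>\<kappa> c. 0 < \<kappa> \<and> \<kappa> < 1 \<and> 0 \<le> c \<and> (\<forall>x Dm G t n p S. value_fun K \<delta> C1 x Dm G t \<longrightarrow> t \<le> real n \<longrightarrow>
     (\<Sum>k\<in>ibox p (nat \<lfloor>t powr ((1 - \<kappa>) / 2)\<rfloor>) - S. value_fun.U K \<delta> x Dm G t S - value_fun.U K \<delta> x Dm G t (insert k S))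
     \<le> c * real (nat \<lfloor>t powr ((1 - \<kappa>) / 2)\<rfloor>) ^ CARD('n) * t powr (- \<kappa>)
        * (1 + (lead n (ray1 (cube_of x)) S + lead n (ray2 (cube_of x)) S)))"
  proof (cases "CARD('n) = 2")
    case False
    then have d: "CARD('n) \<ge> 3" using dim by simp
    show ?thesis
    proof (intro exI conjI allI impI)
      show "0 < (1 / 5 :: real)" "(1 / 5 :: real) < 1" "0 \<le> 8 * (1 + \<delta>)" using \<delta>_pos by auto
      fix x Dm G t and n :: nat and p :: "int^'n" and S assume "value_fun K \<delta> C1 x Dm G t"
      then interpret value_fun K \<delta> C1 x Dm G t .
      show "(\<Sum>k\<in>ibox p (nat \<lfloor>t powr ((1 - 1 / 5) / 2)\<rfloor>) - S. U S - U (insert k S))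
         \<le> 8 * (1 + \<delta>) * real (nat \<lfloor>t powr ((1 - 1 / 5) / 2)\<rfloor>) ^ CARD('n) * t powr (- (1 / 5))
          * (1 + (lead n (ray1 (cube_of x)) S + lead n (ray2 (cube_of x)) S))"
        by (rule box_bound_high_dim[OF d]) (intro add_nonneg_nonneg lead_nonneg)
    qed
  next
    case True
    then obtain \<nu> where \<nu>: "\<nu> > 1" "\<And>z. norm z < 1 / 2 \<Longrightarrow> norm z powr \<nu> \<le> K z" using K_dim2 by auto
    show ?thesis
    proof (intro exI conjI allI impI)
      show "0 < 1 / (4 * \<nu>)" "1 / (4 * \<nu>) < 1" using \<nu> by auto
      have "0 \<le> cvisit" using vel_ge \<delta>_pos by (simp add: cvisit_def cflip_def)
      then show "0 \<le> 4 * cvisit * (2 + 4 powr (\<nu> - 1))" by simp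
      fix x Dm G t and n :: nat and p :: "int^'n" and S assume v: "value_fun K \<delta> C1 x Dm G t" "t \<le> real n"
      then interpret value_fun K \<delta> C1 x Dm G t by simp
      show "(\<Sum>k\<in>ibox p (nat \<lfloor>t powr ((1 - 1 / (4 * \<nu>)) / 2)\<rfloor>) - S. U S - U (insert k S))
         \<le> 4 * cvisit * (2 + 4 powr (\<nu> - 1)) * real (nat \<lfloor>t powr ((1 - 1 / (4 * \<nu>)) / 2)\<rfloor>) ^ CARD('n)
          * t powr (- (1 / (4 * \<nu>))) * (1 + (lead n (ray1 (cube_of x)) S + lead n (ray2 (cube_of x)) S))"
        by (rule box_bound_dim_2[OF True v(2) \<nu>])
    qed
  qed
  then obtain \<kappa> c where \<kappa>: "0 < \<kappa>" "\<kappa> < 1" "0 \<le> c"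
    and box: "\<And>x Dm G t n p S. value_fun K \<delta> C1 x Dm G t \<Longrightarrow> t \<le> real n \<Longrightarrow>
     (\<Sum>k\<in>ibox p (nat \<lfloor>t powr ((1 - \<kappa>) / 2)\<rfloor>) - S. value_fun.U K \<delta> x Dm G t S - value_fun.U K \<delta> x Dm G t (insert k S))
     \<le> c * real (nat \<lfloor>t powr ((1 - \<kappa>) / 2)\<rfloor>) ^ CARD('n) * t powr (- \<kappa>)
        * (1 + (lead n (ray1 (cube_of x)) S + lead n (ray2 (cube_of x)) S))"
    by blast
  \<comment> \<open>Although \<open>cvar\<close> lives in the locale of a fixed value function, it
    depends only on K, \<delta>, C1, \<alpha>, \<kappa> and c.\<close>
  define A1 where "A1 = random_value.cvar K \<delta> C1 \<alpha> \<kappa> c"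
  define A2 where "A2 = (C1 + c0 C1 + \<delta>)\<^sup>2 * 64 * ln 64"
  define C where "C = 1 + \<bar>A1\<bar> + \<bar>A2\<bar>"
  show ?thesis
  proof (intro exI conjI allI impI)
    show "0 < C" by (simp add: C_def)
    fix x Dm G t M
    assume v: "value_fun K \<delta> C1 x Dm G t" and t: "2 \<le> t" and M: "finite M"
      and loc: "\<forall>S. value_fun.U K \<delta> x Dm G t S = value_fun.U K \<delta> x Dm G t (S \<inter> M)"
    interpret value_fun K \<delta> C1 x Dm G t by fact
    interpret random_value K \<delta> C1 x Dm G t \<alpha> ..
    have lnt: "0 < ln t" using t by simp
    have AC: "A1 \<le> C" "A2 \<le> C" by (auto simp: C_def)
    have key: "A * t / ln t \<le> C * t / ln t" if "A \<le> C" for A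
      using that t lnt by (intro divide_right_mono mult_right_mono) auto
    show "B.Avg M (\<lambda>S. (U S)\<^sup>2) - (B.Avg M U)\<^sup>2 \<le> C * t / ln t"
    proof (cases "t \<le> 64")
      case True
      show ?thesis
        using variance_le_small_time[OF t True M] key[OF AC(2)] unfolding A2_def[symmetric] by linarith
    next
      case False
      have "B.Avg M (\<lambda>S. (U S)\<^sup>2) - (B.Avg M U)\<^sup>2 \<le> cvar \<kappa> c * t / ln t"
        by (rule variance_le_large_time[OF _ \<kappa> _ M]) (use False box[OF v] loc in \<open>auto simp: R_def\<close>)
      then show ?thesis using key[OF AC(1)] unfolding A1_def[symmetric] by linarith
    qed
  qed
qed

section \<open>The random environment\<close>

lemma prob_space_site_law: "prob_space (site_law a b \<alpha>)"
  unfolding site_law_def by (rule measure_pmf.prob_space_axioms)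

lemma sets_site_law [simp]: "sets (site_law a b \<alpha>) = UNIV" and space_site_law [simp]: "space (site_law a b \<alpha>) = UNIV"
  by (simp_all add: site_law_def)

lemma space_env_measure [simp]: "space (env_measure a b \<alpha>) = UNIV"
  by (simp add: env_measure_def space_PiM)

lemma product_prob_space_site_law: "product_prob_space (\<lambda>_. site_law a b \<alpha>)"
  by (intro product_prob_spaceI prob_space_site_law)

lemma prob_space_env_measure: "prob_space (env_measure a b \<alpha>)"
  unfolding env_measure_def by (rule prob_space_PiM) (rule prob_space_site_law)

lemma AE_env_measure: "AE \<omega> in (env_measure a b \<alpha> :: (int^'n \<Rightarrow> real) measure). \<forall>k. \<omega> k = a \<or> \<omega> k = b"
  unfolding AE_all_countable env_measure_def
proof
  fix k :: "int^'n"
  have "AE v in site_law a b \<alpha>. v = a \<or> v = b"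
    unfolding site_law_def AE_measure_pmf_iff by auto
  then show "AE \<omega> in PiM UNIV (\<lambda>_. site_law a b \<alpha>). \<omega> k = a \<or> \<omega> k = b"
    by (intro AE_PiM_component prob_space_site_law) auto
qed

text \<open>The factors carry the discrete sigma-algebra, so the product refines the product of the
  Borel ones; with countably many coordinates the latter is the Borel sigma-algebra of the product
  topology.\<close>

lemma env_measure_borel:
  assumes "f \<in> borel_measurable borel"
  shows "f \<in> borel_measurable (env_measure a b \<alpha> :: (int^'n \<Rightarrow> real) measure)"
proof -
  have "(\<lambda>\<omega>. \<lambda>i\<in>UNIV. \<omega> i) \<in> measurable (env_measure a b \<alpha> :: (int^'n \<Rightarrow> real) measure) (PiM UNIV (\<lambda>_. borel))"
  proof (rule measurable_restrict)
    fix i :: "int^'n"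
    have "(\<lambda>\<omega>. \<omega> i) \<in> measurable (env_measure a b \<alpha>) (site_law a b \<alpha>)"
      unfolding env_measure_def by (rule measurable_component_singleton) simp
    then show "(\<lambda>\<omega>. \<omega> i) \<in> borel_measurable (env_measure a b \<alpha>)"
      by (rule measurable_compose) (simp add: measurable_def)
  qed
  then have "(\<lambda>\<omega>. \<omega>) \<in> measurable (env_measure a b \<alpha> :: (int^'n \<Rightarrow> real) measure) borel"
    by (simp add: measurable_cong_sets[OF refl sets_PiM_equal_borel] restrict_UNIV)
  from measurable_compose[OF this assms] show ?thesis .
qed

text \<open>Turns expectations over environments into \<open>Avg\<close>. Only the event that a site
  has value \<open>b\<close> is tested; its complement has probability \<alpha>, the mass that
  \<open>site_law\<close> gives to \<open>a\<close>.\<close>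

lemma (in biased) env_measure_cylinder:
  fixes M :: "(int^'n) set" and \<phi> :: "(int^'n) set \<Rightarrow> real"
  assumes M: "finite M" and ab: "a \<noteq> b"
  shows "integrable (env_measure a b \<alpha>) (\<lambda>\<omega>. \<phi> {k \<in> M. \<omega> k = b})"
    and "integral\<^sup>L (env_measure a b \<alpha>) (\<lambda>\<omega>. \<phi> {k \<in> M. \<omega> k = b}) = Avg M \<phi>"
proof -
  interpret P: product_prob_space "\<lambda>_ :: int^'n. site_law a b \<alpha>" UNIV by (rule product_prob_space_site_law)
  let ?E = "env_measure a b \<alpha> :: (int^'n \<Rightarrow> real) measure"
  interpret E: prob_space ?E by (rule prob_space_env_measure)
  define A where "A S = {\<omega> :: int^'n \<Rightarrow> real. {k \<in> M. \<omega> k = b} = S}" for S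
  have cyl: "A S = prod_emb UNIV (\<lambda>_. site_law a b \<alpha>) M (PiE M (\<lambda>k. if k \<in> S then {b} else - {b}))"
    if "S \<subseteq> M" for S
  proof -
    have "\<omega> \<in> A S \<longleftrightarrow> (\<forall>k\<in>M. \<omega> k \<in> (if k \<in> S then {b} else - {b}))" for \<omega> :: "int^'n \<Rightarrow> real"
      using that by (auto simp: A_def)
    then show ?thesis by (simp add: prod_emb_def restrict_PiE_iff set_eq_iff Pi_iff)
  qed
  have As: "A S \<in> sets ?E" if "S \<subseteq> M" for S
    unfolding cyl[OF that] env_measure_def by (rule sets_PiM_I) (use M in auto)
  have b1: "measure (site_law a b \<alpha>) {b} = 1 - \<alpha>"
  proof -
    have "(\<lambda>c. if c then a else b) -` {b} = {False}" using ab by auto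
    then show ?thesis using \<alpha>_pos \<alpha>_lt1 unfolding site_law_def measure_map_pmf by (simp add: measure_pmf_single)
  qed
  have b2: "measure (site_law a b \<alpha>) (- {b}) = \<alpha>"
  proof -
    have "(\<lambda>c. if c then a else b) -` (- {b}) = {True}" using ab by (auto split: if_splits)
    then show ?thesis using \<alpha>_pos \<alpha>_lt1 unfolding site_law_def measure_map_pmf by (simp add: measure_pmf_single)
  qed
  have mA: "measure ?E (A S) = \<alpha> ^ card (M - S) * (1 - \<alpha>) ^ card S" if S: "S \<subseteq> M" for S
  proof -
    have "measure ?E (A S) = (\<Prod>k\<in>M. measure (site_law a b \<alpha>) (if k \<in> S then {b} else - {b}))"
      unfolding cyl[OF S] env_measure_def by (rule P.measure_PiM_emb) (use M in auto)
    also have "\<dots> = (\<Prod>k\<in>M. if k \<in> S then 1 - \<alpha> else \<alpha>)"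
      by (intro prod.cong refl) (simp add: b1 b2)
    also have "\<dots> = (\<Prod>k\<in>M \<inter> S. 1 - \<alpha>) * (\<Prod>k\<in>M - S. \<alpha>)"
      using M by (simp add: prod.If_cases Diff_eq)
    finally show ?thesis using S by (simp add: Int_absorb1 mult.commute)
  qed
  have eq: "(\<lambda>\<omega>. \<phi> {k \<in> M. \<omega> k = b}) = (\<lambda>\<omega>. \<Sum>S\<in>Pow M. \<phi> S * indicator (A S) \<omega>)"
  proof
    fix \<omega> :: "int^'n \<Rightarrow> real"
    have "(\<Sum>S\<in>Pow M. \<phi> S * indicator (A S) \<omega>) = (\<Sum>S\<in>Pow M. if S = {k \<in> M. \<omega> k = b} then \<phi> S else 0)"
      by (intro sum.cong) (auto simp: A_def indicator_def)
    then show "\<phi> {k \<in> M. \<omega> k = b} = (\<Sum>S\<in>Pow M. \<phi> S * indicator (A S) \<omega>)"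
      using M by (simp add: sum.delta)
  qed
  have int: "integrable ?E (\<lambda>\<omega>. \<phi> S * indicator (A S) \<omega>)" if "S \<subseteq> M" for S
    using As[OF that] by (intro integrable_mult_right integrable_real_indicator) (auto simp: E.emeasure_eq_measure)
  show "integrable ?E (\<lambda>\<omega>. \<phi> {k \<in> M. \<omega> k = b})"
    unfolding eq using int by (intro Bochner_Integration.integrable_sum) auto
  have "integral\<^sup>L ?E (\<lambda>\<omega>. \<phi> {k \<in> M. \<omega> k = b}) = (\<Sum>S\<in>Pow M. integral\<^sup>L ?E (\<lambda>\<omega>. \<phi> S * indicator (A S) \<omega>))"
    unfolding eq using int by (intro Bochner_Integration.integral_sum) auto
  also have "\<dots> = Avg M \<phi>"
    unfolding Avg_def
  proof (intro sum.cong refl)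
    fix S assume "S \<in> Pow M"
    then have S: "S \<subseteq> M" by simp
    have "integral\<^sup>L ?E (\<lambda>\<omega>. \<phi> S * indicator (A S) \<omega>) = \<phi> S * measure ?E (A S)"
      using As[OF S] by simp
    then show "integral\<^sup>L ?E (\<lambda>\<omega>. \<phi> S * indicator (A S) \<omega>) = \<alpha> ^ card (M - S) * (1 - \<alpha>) ^ card S * \<phi> S"
      using mA[OF S] by simp
  qed
  finally show "integral\<^sup>L ?E (\<lambda>\<omega>. \<phi> {k \<in> M. \<omega> k = b}) = Avg M \<phi>" .
qed

context lagrangian
begin

lemma action_eq:
  assumes lip: "L-lipschitz_on {0..t} \<gamma>" and v: "(\<lambda>s. \<omega> (cube_of (\<gamma> s))) integrable_on {0..t}"
  shows "action K t \<gamma> \<omega> = kin \<gamma> 0 t + integral {0..t} (\<lambda>s. \<omega> (cube_of (\<gamma> s)))"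
proof -
  have "action K t \<gamma> \<omega> = integral {0..t} (\<lambda>s. K (vector_derivative \<gamma> (at s)) + \<omega> (cube_of (\<gamma> s)))"
    unfolding action_def
  proof (rule integral_spike[of "{0, t}"])
    fix s assume "s \<in> {0..t} - {0, t}"
    then have "at s within {0..t} = at s" by (intro at_within_interior) auto
    then show "K (vector_derivative \<gamma> (at s)) + \<omega> (cube_of (\<gamma> s))
       = K (vector_derivative \<gamma> (at s within {0..t})) + V_pot (\<gamma> s) \<omega>"
      by (simp add: V_pot_def cube_of_def)
  qed simp
  also have "\<dots> = kin \<gamma> 0 t + integral {0..t} (\<lambda>s. \<omega> (cube_of (\<gamma> s)))"
    unfolding kin_def by (rule Henstock_Kurzweil_Integration.integral_add[OF kin_integrable[OF lip] v]) auto
  finally show ?thesis .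
qed

text \<open>Stated for all environments and not only for two-valued ones, since measurability
  concerns the whole sample space. The sum is finite because the path meets finitely many
  cubes.\<close>

lemma action_affine:
  assumes lip: "L-lipschitz_on {0..t} \<gamma>" and t: "0 \<le> t"
  shows "\<exists>P c. finite P \<and> (\<forall>\<omega>. action K t \<gamma> \<omega> = kin \<gamma> 0 t + (\<Sum>k\<in>P. \<omega> k * c k))"
proof -
  have cont: "continuous_on {0..t} \<gamma>" by (rule lipschitz_on_continuous_on[OF lip])
  define P where "P = (\<lambda>s. cube_of (\<gamma> s)) ` {0..t}"
  have fP: "finite P"
    unfolding P_def using card_visited_le(1)[OF lip t pq[of 1] pq_nonneg(1)[of 1] pq_nonneg(2)[of 1]] by simp
  have "action K t \<gamma> \<omega> = kin \<gamma> 0 t + (\<Sum>k\<in>P. \<omega> k * tim {k} \<gamma> 0 t)" for \<omega>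
  proof -
    have eq: "\<omega> (cube_of (\<gamma> s)) = (\<Sum>k\<in>P. \<omega> k * indicator {k} (cube_of (\<gamma> s)))" if "s \<in> {0..t}" for s
    proof -
      have "(\<Sum>k\<in>P. \<omega> k * indicator {k} (cube_of (\<gamma> s))) = (\<Sum>k\<in>P. if k = cube_of (\<gamma> s) then \<omega> k else 0)"
        by (intro sum.cong) (auto simp: indicator_def)
      then show ?thesis using fP that by (simp add: P_def)
    qed
    have int: "(\<lambda>s. \<omega> k * indicator {k} (cube_of (\<gamma> s))) integrable_on {0..t}" for k
      using tim_integrable[OF cont, of 0 t "{k}"] by (intro integrable_on_mult_right) auto
    have "(\<lambda>s. \<Sum>k\<in>P. \<omega> k * indicator {k} (cube_of (\<gamma> s))) integrable_on {0..t}"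
      using fP int by (intro Henstock_Kurzweil_Integration.integrable_sum) auto
    then have v: "(\<lambda>s. \<omega> (cube_of (\<gamma> s))) integrable_on {0..t}"
      by (rule integrable_eq) (rule eq[symmetric])
    have "integral {0..t} (\<lambda>s. \<omega> (cube_of (\<gamma> s))) = integral {0..t} (\<lambda>s. \<Sum>k\<in>P. \<omega> k * indicator {k} (cube_of (\<gamma> s)))"
      by (rule Henstock_Kurzweil_Integration.integral_cong) (rule eq)
    also have "\<dots> = (\<Sum>k\<in>P. integral {0..t} (\<lambda>s. \<omega> k * indicator {k} (cube_of (\<gamma> s))))"
      using fP int by (intro Henstock_Kurzweil_Integration.integral_sum) auto
    also have "\<dots> = (\<Sum>k\<in>P. \<omega> k * tim {k} \<gamma> 0 t)" by (simp add: tim_def)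
    finally show ?thesis using action_eq[OF lip v] by simp
  qed
  then show ?thesis
    by (intro exI[of _ P] exI[of _ "\<lambda>k. tim {k} \<gamma> 0 t"] conjI fP allI)
qed

lemma action_two_valued:
  assumes lip: "L-lipschitz_on {0..t} \<gamma>" and t: "0 \<le> t" and \<omega>: "\<And>k. \<omega> k = a \<or> \<omega> k = b" and ab: "b - a = \<delta>"
  shows "action K t \<gamma> \<omega> = kin \<gamma> 0 t + a * t + \<delta> * tim {k. \<omega> k = b} \<gamma> 0 t"
proof -
  have cont: "continuous_on {0..t} \<gamma>" by (rule lipschitz_on_continuous_on[OF lip])
  let ?S = "{k. \<omega> k = b}"
  have eq: "\<omega> k = a + \<delta> * indicator ?S k" for k
    using \<omega>[of k] ab \<delta>_pos by (auto simp: indicator_def)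
  have int: "(\<lambda>s. \<delta> * indicator ?S (cube_of (\<gamma> s))) integrable_on {0..t}"
    using tim_integrable[OF cont, of 0 t ?S] by (intro integrable_on_mult_right) auto
  have v: "(\<lambda>s. \<omega> (cube_of (\<gamma> s))) integrable_on {0..t}"
    unfolding eq[of "cube_of (\<gamma> s)" for s] by (intro integrable_add int) auto
  have "integral {0..t} (\<lambda>s. \<omega> (cube_of (\<gamma> s))) = integral {0..t} (\<lambda>s. a + \<delta> * indicator ?S (cube_of (\<gamma> s)))"
    by (rule Henstock_Kurzweil_Integration.integral_cong) (rule eq)
  also have "\<dots> = integral {0..t} (\<lambda>s. a) + integral {0..t} (\<lambda>s. \<delta> * indicator ?S (cube_of (\<gamma> s)))"
    by (rule Henstock_Kurzweil_Integration.integral_add) (auto intro: int)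
  finally show ?thesis using action_eq[OF lip v] t by (simp add: tim_def)
qed

text \<open>A supremum of functions that are affine in finitely many coordinates is lower semicontinuous for
  the product topology, so it is measurable although the set of paths is uncountable.\<close>

lemma u_val_measurable:
  fixes g :: "real^'n \<Rightarrow> ereal"
  assumes t: "0 \<le> t" and g: "\<And>y. g y < \<infinity>"
  shows "(\<lambda>\<omega>. u_val K g t x \<omega>) \<in> borel_measurable (env_measure a b \<alpha>)"
proof (rule env_measure_borel)
  show "(\<lambda>\<omega>. u_val K g t x \<omega>) \<in> borel_measurable borel"
    unfolding borel_measurable_ereal_iff_Ioi
  proof
    fix c :: ereal
    have "open {\<omega>. c < g (\<gamma> t) - ereal (action K t \<gamma> \<omega>)}" if "\<gamma> \<in> adm_paths t x" for \<gamma>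
    proof -
      obtain L where lip: "L-lipschitz_on {0..t} \<gamma>" using \<open>\<gamma> \<in> adm_paths t x\<close> by (auto simp: adm_paths_def)
      obtain P e where Pe: "\<And>\<omega>. action K t \<gamma> \<omega> = kin \<gamma> 0 t + (\<Sum>k\<in>P. \<omega> k * e k)"
        using action_affine[OF lip t] by blast
      show ?thesis
      proof (cases "g (\<gamma> t)")
        case (real r)
        have "open {\<omega> :: int^'n \<Rightarrow> real. v < r - (kin \<gamma> 0 t + (\<Sum>k\<in>P. \<omega> k * e k))}" for v
          by (intro open_Collect_less continuous_intros continuous_on_product_coordinates)
        then show ?thesis unfolding real Pe by (cases c) auto
      qed (use g[of "\<gamma> t"] in auto)
    qed
    then have "open (\<Union>\<gamma>\<in>adm_paths t x. {\<omega>. c < g (\<gamma> t) - ereal (action K t \<gamma> \<omega>)})" by blast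
    moreover have "(\<lambda>\<omega>. u_val K g t x \<omega>) -` {c<..} \<inter> space borel
       = (\<Union>\<gamma>\<in>adm_paths t x. {\<omega>. c < g (\<gamma> t) - ereal (action K t \<gamma> \<omega>)})"
      by (auto simp: u_val_def less_SUP_iff)
    ultimately show "(\<lambda>\<omega>. u_val K g t x \<omega>) -` {c<..} \<inter> space borel \<in> sets borel" by simp
  qed
qed

end

context value_fun
begin

lemma u_val_eq:
  assumes Dm: "Dm = {y. g y \<noteq> - \<infinity>}" and G: "\<And>y. G y = real_of_ereal (g y) - g0" and g: "\<And>y. g y < \<infinity>"
    and \<omega>: "\<And>k. \<omega> k = a \<or> \<omega> k = b" and ab: "b - a = \<delta>"
  shows "u_val K g t x \<omega> = ereal (g0 - a * t + U {k. \<omega> k = b})"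
proof (rule antisym)
  let ?S = "{k. \<omega> k = b}"
  have val: "g (\<gamma> t) - ereal (action K t \<gamma> \<omega>)
      = ereal (g0 - a * t + (G (\<gamma> t) - (kin \<gamma> 0 t + \<delta> * tim ?S \<gamma> 0 t)))"
    if lip: "L-lipschitz_on {0..t} \<gamma>" and D: "\<gamma> t \<in> Dm" for \<gamma> L
  proof -
    have "g (\<gamma> t) = ereal (G (\<gamma> t) + g0)"
      using D g[of "\<gamma> t"] by (cases "g (\<gamma> t)") (auto simp: Dm G)
    then show ?thesis using action_two_valued[OF lip _ \<omega> ab] t_ge by simp
  qed
  show "u_val K g t x \<omega> \<le> ereal (g0 - a * t + U ?S)"
    unfolding u_val_def
  proof (rule SUP_least)
    fix \<gamma> assume "\<gamma> \<in> adm_paths t x"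
    then obtain L where lip: "L-lipschitz_on {0..t} \<gamma>" and x0: "\<gamma> 0 = x" by (auto simp: adm_paths_def)
    show "g (\<gamma> t) - ereal (action K t \<gamma> \<omega>) \<le> ereal (g0 - a * t + U ?S)"
    \<comment> \<open>A path that ends outside \<open>Dm\<close> has payoff -\<infinity> and drops
      out of the supremum.\<close>
    proof (cases "\<gamma> t \<in> Dm")
      case True
      have "reach ?S t x (\<gamma> t) (kin \<gamma> 0 t + \<delta> * tim ?S \<gamma> 0 t)"
        using reach_sub[OF lip, of 0 t ?S] t_ge x0 by simp
      from payoff_le_U[OF True this] show ?thesis unfolding val[OF lip True] by simp
    qed (simp add: Dm)
  qed
  show "ereal (g0 - a * t + U ?S) \<le> u_val K g t x \<omega>"
  proof (rule ereal_le_epsilon2)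
    fix e :: real assume e: "0 < e"
    obtain \<gamma> where near: "nearopt ?S (min e 1) \<gamma>" using nearopt_exists[of "min e 1" ?S] e by auto
    then obtain L where lip: "L-lipschitz_on {0..t} \<gamma>" and D: "\<gamma> t \<in> Dm" by (auto simp: nearopt_def)
    have "g0 - a * t + U ?S - e \<le> g0 - a * t + (G (\<gamma> t) - (kin \<gamma> 0 t + \<delta> * tim ?S \<gamma> 0 t))"
      using near unfolding nearopt_def by linarith
    then have "ereal (g0 - a * t + U ?S - e) \<le> g (\<gamma> t) - ereal (action K t \<gamma> \<omega>)"
      unfolding val[OF lip D] by simp
    also have "\<dots> \<le> u_val K g t x \<omega>"
      unfolding u_val_def using near by (intro SUP_upper) (auto simp: adm_paths_def nearopt_def)
    finally have "ereal (g0 - a * t + U ?S - e) + ereal e \<le> u_val K g t x \<omega> + ereal e"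
      by (rule add_right_mono)
    then show "ereal (g0 - a * t + U ?S) \<le> u_val K g t x \<omega> + ereal e" by simp
  qed
qed

end

theorem theorem1p1:
  fixes K :: "real^'n \<Rightarrow> real" and \<alpha> C\<^sub>1 \<delta> :: real
  assumes dim: "CARD('n) \<ge> 2"
    and \<alpha>: "0 < \<alpha>" "\<alpha> < 1"
    and \<delta>: "\<delta> > 0"
    and K_convex: "convex_on UNIV K"
    and K_nonneg: "\<forall>z. K z \<ge> 0"
    and K_zero: "K 0 = 0"
    and K_superlin: "filterlim (\<lambda>z. K z / norm z) at_top at_infinity"
    and K_dim2: "CARD('n) = 2 \<longrightarrow> (\<exists>\<nu>>1. \<forall>z. norm z < 1/2 \<longrightarrow> K z \<ge> norm z powr \<nu>)"
  shows "\<exists>C>0. \<forall>a b (x::real^'n) (g::real^'n \<Rightarrow> ereal).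
           a < b \<and> b - a = \<delta> \<and> usc g \<and> \<bar>g x\<bar> \<noteq> \<infinity> \<and>
           (\<forall>y. g y < g x + ereal (C\<^sub>1 * (1 + norm (y - x)))) \<longrightarrow>
           (\<forall>t\<ge>2.
              (AE \<omega> in env_measure a b \<alpha>. \<bar>u_val K g t x \<omega>\<bar> \<noteq> \<infinity>) \<and>
              integrable (env_measure a b \<alpha>) (\<lambda>\<omega>. (real_of_ereal (u_val K g t x \<omega>))^2) \<and>
              var (env_measure a b \<alpha>) (\<lambda>\<omega>. real_of_ereal (u_val K g t x \<omega>)) \<le> C * t / ln t)"
proof -
  have lag: "lagrangian K \<delta>" using K_convex K_nonneg K_zero K_superlin \<delta> by unfold_locales auto
  have bi: "biased \<alpha>" using \<alpha> by unfold_locales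
  obtain C where CC: "C > 0 \<and> (\<forall>x Dm G t M. value_fun K \<delta> C\<^sub>1 x Dm G t \<longrightarrow> 2 \<le> t \<longrightarrow> finite M \<longrightarrow>
     (\<forall>S. value_fun.U K \<delta> x Dm G t S = value_fun.U K \<delta> x Dm G t (S \<inter> M)) \<longrightarrow>
     biased.Avg \<alpha> M (\<lambda>S. (value_fun.U K \<delta> x Dm G t S)\<^sup>2) - (biased.Avg \<alpha> M (value_fun.U K \<delta> x Dm G t))\<^sup>2
       \<le> C * t / ln t)"
    using value_variance_bound[OF lag bi dim K_dim2, of C\<^sub>1] by (rule exE) (rule that)
  note C = conjunct1[OF CC] and bound = conjunct2[OF CC]
  interpret lagrangian K \<delta> by (rule lag)
  interpret B: biased \<alpha> by (rule bi)
  show ?thesis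
  proof (intro exI[of _ C] conjI C allI impI)
    fix a b and x :: "real^'n" and g :: "real^'n \<Rightarrow> ereal" and t :: real
    assume A: "a < b \<and> b - a = \<delta> \<and> usc g \<and> \<bar>g x\<bar> \<noteq> \<infinity> \<and> (\<forall>y. g y < g x + ereal (C\<^sub>1 * (1 + norm (y - x))))"
      and t: "2 \<le> t"
    define g0 where "g0 = real_of_ereal (g x)"
    have gx: "g x = ereal g0" using A by (auto simp: g0_def ereal_real)
    have gy: "g y < ereal (g0 + C\<^sub>1 * (1 + norm (y - x)))" for y using A gx by simp
    \<comment> \<open>At y = x the growth condition is the strict inequality g x < g x +
      \<open>C\<^sub>1\<close>.\<close>
    have C1: "C\<^sub>1 > 0" using gy[of x] gx by simp
    have gfin: "g y < \<infinity>" for y using gy[of y] by (rule less_trans) simp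
    define Dm where "Dm = {y. g y \<noteq> - \<infinity>}"
    define G where "G y = real_of_ereal (g y) - g0" for y
    interpret value_fun K \<delta> C\<^sub>1 x Dm G t
    proof
      show "x \<in> Dm" "G x = 0" by (auto simp: Dm_def G_def gx)
      show "G y \<le> C\<^sub>1 * (1 + norm (y - x))" if "y \<in> Dm" for y
        using that gy[of y] by (cases "g y") (auto simp: Dm_def G_def)
    qed (use C1 t in auto)
    let ?E = "env_measure a b \<alpha> :: (int^'n \<Rightarrow> real) measure"
    let ?X = "\<lambda>\<omega>. real_of_ereal (u_val K g t x \<omega>)"
    obtain M where M': "finite M \<and> (\<forall>S S'. S \<inter> M = S' \<inter> M \<longrightarrow> U S = U S')"
      using U_local by (rule exE) (rule that)
    note M = conjunct1[OF M'] conjunct2[OF M', rule_format]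
    have loc: "U S = U (S \<inter> M)" for S by (rule M(2)) auto
    define c where "c = g0 - a * t"
    \<comment> \<open>Off the null set of environments with values other than \<open>a\<close> and
      \<open>b\<close>, the value depends only on the trace of the set of \<open>b\<close>-sites on
      \<open>M\<close>; every expectation below thus becomes a finite average.\<close>
    have AEu: "AE \<omega> in ?E. u_val K g t x \<omega> = ereal (c + U {k \<in> M. \<omega> k = b})"
      using AE_env_measure[of a b \<alpha>]
    proof eventually_elim
      case (elim \<omega>)
      have "U {k. \<omega> k = b} = U {k \<in> M. \<omega> k = b}" by (rule M(2)) auto
      moreover have "u_val K g t x \<omega> = ereal (g0 - a * t + U {k. \<omega> k = b})"
        by (rule u_val_eq[OF Dm_def G_def gfin]) (use elim A in auto)
      ultimately show ?case by (simp add: c_def)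
    qed
    then show "AE \<omega> in ?E. \<bar>u_val K g t x \<omega>\<bar> \<noteq> \<infinity>" by eventually_elim simp
    have AEX: "AE \<omega> in ?E. ?X \<omega> = c + U {k \<in> M. \<omega> k = b}" using AEu by eventually_elim simp
    have um: "(\<lambda>\<omega>. u_val K g t x \<omega>) \<in> borel_measurable ?E"
      by (rule u_val_measurable) (use t gfin in auto)
    then have Xm: "?X \<in> borel_measurable ?E" by measurable
    have ab: "a \<noteq> b" using A by auto
    note cyl = B.env_measure_cylinder[OF M(1) ab]
    show "integrable ?E (\<lambda>\<omega>. (?X \<omega>)^2)"
    proof (rule integrable_cong_AE_imp[OF cyl(1)[of "\<lambda>S. (c + U S)\<^sup>2"]])
      show "(\<lambda>\<omega>. (?X \<omega>)^2) \<in> borel_measurable ?E" using Xm by measurable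
      show "AE \<omega> in ?E. (c + U {k \<in> M. \<omega> k = b})\<^sup>2 = (?X \<omega>)\<^sup>2" using AEX by eventually_elim simp
    qed
    have EX: "integral\<^sup>L ?E ?X = c + B.Avg M U"
    proof -
      have "integral\<^sup>L ?E ?X = integral\<^sup>L ?E (\<lambda>\<omega>. c + U {k \<in> M. \<omega> k = b})"
        using borel_measurable_integrable[OF cyl(1)[of "\<lambda>S. c + U S"]] by (intro integral_cong_AE Xm AEX)
      also have "\<dots> = B.Avg M (\<lambda>S. c + U S)" by (rule cyl(2))
      finally show ?thesis using M(1) by (simp add: B.Avg_add)
    qed
    have "var ?E ?X = integral\<^sup>L ?E (\<lambda>\<omega>. (U {k \<in> M. \<omega> k = b} - B.Avg M U)\<^sup>2)"
      unfolding var_def EX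
    proof (rule integral_cong_AE)
      show "(\<lambda>\<omega>. (?X \<omega> - (c + B.Avg M U))\<^sup>2) \<in> borel_measurable ?E" using Xm by measurable
      show "(\<lambda>\<omega>. (U {k \<in> M. \<omega> k = b} - B.Avg M U)\<^sup>2) \<in> borel_measurable ?E"
        by (rule borel_measurable_integrable[OF cyl(1)[of "\<lambda>S. (U S - B.Avg M U)\<^sup>2"]])
      show "AE \<omega> in ?E. (?X \<omega> - (c + B.Avg M U))\<^sup>2 = (U {k \<in> M. \<omega> k = b} - B.Avg M U)\<^sup>2"
        using AEX by eventually_elim simp
    qed
    also have "\<dots> = B.Avg M (\<lambda>S. (U S - B.Avg M U)\<^sup>2)" by (rule cyl(2))
    also have "\<dots> = B.Avg M (\<lambda>S. (U S)\<^sup>2) - (B.Avg M U)\<^sup>2"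
    proof -
      define e where "e = B.Avg M U"
      have "(\<lambda>S. (U S - e)\<^sup>2) = (\<lambda>S. (U S)\<^sup>2 - (2 * e) * U S + e\<^sup>2)"
        by (auto simp: power2_diff algebra_simps)
      then have "B.Avg M (\<lambda>S. (U S - e)\<^sup>2) = B.Avg M (\<lambda>S. (U S)\<^sup>2) - (2 * e) * B.Avg M U + e\<^sup>2"
        using M(1) by (simp only: B.Avg_add B.Avg_diff B.Avg_cmult B.Avg_const)
      then show ?thesis by (simp add: e_def[symmetric] power2_eq_square)
    qed
    also have "\<dots> \<le> C * t / ln t"
      by (rule bound[rule_format, OF value_fun_axioms t M(1) loc])
    finally show "var ?E ?X \<le> C * t / ln t" .
  qed
qed

end
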